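(* Let $E\subset\mathbb{R}^2$ be a closed, nondegenerate, convex quadrilateral and let $r\ge1$. Let $\mathcal{DS}_{r+1}(E)=\mathbb{P}_{r+1}(E)\oplus\mathbb{S}_{r+1}^{\mathcal{DS}}(E)$ be any of the direct serendipity spaces described in the context (fully direct or with mapped supplements), and define $$\mathbf{V}_{r,\mathrm{curl}}^{\mathrm{full}}(E)=\nabla\,\mathcal{DS}_{r+1}(E)\oplus(x_2,-x_1)\mathbb{P}_{r}(E),\qquad \mathbf{V}_{r,\mathrm{curl}}^{\mathrm{red}}(E)=\nabla\,\mathcal{DS}_{r+1}(E)\oplus(x_2,-x_1)\mathbb{P}_{r-1}(E).$$ Then the sequences $$\mathbb{R}\hookrightarrow\mathcal{DS}_{r+1}(E)\xrightarrow{\ \mathrm{grad}\ }\mathbf{V}_{r,\mathrm{curl}}^{\mathrm{full}}(E)\xrightarrow{\ \mathrm{curl}\ }\mathbb{P}_{r}(E)\to0$$ and $$\mathbb{R}\hookrightarrow\mathcal{DS}_{r+1}(E)\xrightarrow{\ \mathrm{grad}\ }\mathbf{V}_{r,\mathrm{curl}}^{\mathrm{red}}(E)\xrightarrow{\ \mathrm{curl}\ }\mathbb{P}_{r-1}(E)\to0$$ are (well defined and) exact, i.e. the image of each map equals the kernel of the next.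
   Context: $\mathbb{P}_k(E)$ is the space of polynomials of total degree at most $k$ restricted to $E$. For a vector function $\psi=(\psi_1,\psi_2)$, $\mathrm{curl}\,\psi=\partial\psi_1/\partial x_2-\partial\psi_2/\partial x_1$ (a scalar). Derivatives are understood in the weak sense where necessary. $\mathbb{R}\hookrightarrow$ denotes inclusion of the constant functions. Quadrilateral. $E$ is nondegenerate if it does not degenerate to a triangle, segment or point. $\hat E=[-1,1]^2$, and $\mathbf{F}_E:\hat E\to E$ is the bilinear bijective map taking vertices to vertices (consecutive to consecutive). For $\hat\phi$ on $\hat E$, $F_E^0(\hat\phi)(\mathbf{x})=\hat\phi(\hat{\mathbf{x}})$ with $\mathbf{x}=\mathbf{F}_E(\hat{\mathbf{x}})$. The edges of $E$ are numbered so that $e_1,e_2$ (images of $\hat x_1=-1$, $\hat x_1=1$) and $e_3,e_4$ (images of $\hat x_2=-1$, $\hat x_2=1$) are the two pairs of opposite edges. $\nu_i$ is the unit outer normal to $e_i$, $\lambda_i(\mathbf{x})=-(\mathbf{x}-\mathbf{x}_i)\cdot\nu_i$ for any $\mathbf{x}_i\in e_i$, and $\mathcal{L}_i$ is the infinite line containing $e_i$. The direct serendipity spaces (of index $r+1\ge2$) are $\mathcal{DS}_{r+1}(E)=\mathbb{P}_{r+1}(E)\oplus\mathbb{S}_{r+1}^{\mathcal{DS}}(E)$, with one of the following choices of supplement space. (i) Fully direct: $\mathbb{S}_{r+1}^{\mathcal{DS}}(E)=\mathrm{span}\{\lambda_3\lambda_4\lambda_H^{r-1}R_V,\ \lambda_1\lambda_2\lambda_V^{r-1}R_H\}$,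 where: - $\lambda_H$ is a linear polynomial. If $e_1\parallel e_2$, its zero line intersects both $\mathcal{L}_1$ and $\mathcal{L}_2$; if $e_1\nparallel e_2$, $\lambda_H=\alpha_H\lambda_1+\beta_H\lambda_2+\gamma_H$ with $\alpha_H,\beta_H>0$, $\gamma_H\ne0$. - $\lambda_V$ is a linear polynomial. If $e_3\parallel e_4$, its zero line intersects both $\mathcal{L}_3$ and $\mathcal{L}_4$; if $e_3\nparallel e_4$, $\lambda_V=\alpha_V\lambda_3+\beta_V\lambda_4+\gamma_V$ with $\alpha_V,\beta_V>0$, $\gamma_V\ne0$. - $R_V,R_H$ are bounded functions on $E$, continuous and in $H^1(E)$, with $R_V=-\eta_V$ on $e_1$, $R_V=\xi_V$ on $e_2$, $R_H=-\eta_H$ on $e_3$, $R_H=\xi_H$ on $e_4$ for some positive constants $\eta_V,\xi_V,\eta_H,\xi_H$. (ii) Mapped supplements: $\mathbb{S}_{r+1}^{\mathcal{DS}}(E)=\mathrm{span}\{F_E^0((1-\hat x_2^2)\hat x_1\hat x_2^{r-1}),\ F_E^0((1-\hat x_1^2)\hat x_2\hat x_1^{r-1})\}$. *)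

theory Defs
  imports "HOL-Analysis.Analysis"
begin

section \<open>Quadrilaterals\<close>

text \<open>\<^term>\<open>a\<close>, \<^term>\<open>b\<close>, \<^term>\<open>c\<close>, \<^term>\<open>d\<close> are the vertices in consecutive (cyclic) order. Having four
  distinct extreme points excludes degeneration to a triangle, a segment or a point.\<close>

definition convex_quadrilateral ::
  "(real^2) set \<Rightarrow> real^2 \<Rightarrow> real^2 \<Rightarrow> real^2 \<Rightarrow> real^2 \<Rightarrow> bool" where
  "convex_quadrilateral E a b c d \<longleftrightarrow>
     polytope E \<and> {v. v extreme_point_of E} = {a, b, c, d} \<and> distinct [a, b, c, d] \<and>
     closed_segment a b edge_of E \<and> closed_segment b c edge_of E \<and>
     closed_segment c d edge_of E \<and> closed_segment d a edge_of E"

definition ref_square :: "(real^2) set" where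
  "ref_square = {xh. \<bar>xh$1\<bar> \<le> 1 \<and> \<bar>xh$2\<bar> \<le> 1}"

text \<open>The bilinear map with corner values
  (-1,-1) to \<^term>\<open>a\<close>, (1,-1) to \<^term>\<open>b\<close>, (1,1) to \<^term>\<open>c\<close>, (-1,1) to \<^term>\<open>d\<close>. It is affine on each side of
  the reference square, so the sides \<open>xh$1 = -1\<close>, \<open>xh$1 = 1\<close>, \<open>xh$2 = -1\<close>, \<open>xh$2 = 1\<close>
  are mapped to the segments \<open>a d\<close>, \<open>b c\<close>, \<open>a b\<close>, \<open>d c\<close>, respectively.\<close>

definition bilinear_map ::
  "real^2 \<Rightarrow> real^2 \<Rightarrow> real^2 \<Rightarrow> real^2 \<Rightarrow> real^2 \<Rightarrow> real^2" where
  "bilinear_map a b c d xh =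
     (1/4) *\<^sub>R (((1 - xh$1) * (1 - xh$2)) *\<^sub>R a + ((1 + xh$1) * (1 - xh$2)) *\<^sub>R b
            + ((1 + xh$1) * (1 + xh$2)) *\<^sub>R c + ((1 - xh$1) * (1 + xh$2)) *\<^sub>R d)"

text \<open>\<open>F\<^sub>E\<^sup>0\<close>; only the values on the quadrilateral are meaningful.\<close>

definition push_forward ::
  "real^2 \<Rightarrow> real^2 \<Rightarrow> real^2 \<Rightarrow> real^2 \<Rightarrow> (real^2 \<Rightarrow> real) \<Rightarrow> real^2 \<Rightarrow> real" where
  "push_forward a b c d \<phi> x = \<phi> (inv_into ref_square (bilinear_map a b c d) x)"

definition unit_outer_normal :: "(real^2) set \<Rightarrow> (real^2) set \<Rightarrow> real^2 \<Rightarrow> bool" where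
  "unit_outer_normal E e \<nu> \<longleftrightarrow>
     norm \<nu> = 1 \<and> (\<forall>x\<in>e. \<forall>y\<in>e. (y - x) \<bullet> \<nu> = 0) \<and> (\<forall>x\<in>e. \<forall>y\<in>E. (y - x) \<bullet> \<nu> \<le> 0)"

definition edge_function :: "(real^2) set \<Rightarrow> (real^2) set \<Rightarrow> (real^2 \<Rightarrow> real) \<Rightarrow> bool" where
  "edge_function E e l \<longleftrightarrow>
     (\<exists>\<nu> x0. unit_outer_normal E e \<nu> \<and> x0 \<in> e \<and> l = (\<lambda>x. - ((x - x0) \<bullet> \<nu>)))"

section \<open>Weak derivatives\<close>

definition partial :: "2 \<Rightarrow> (real^2 \<Rightarrow> real) \<Rightarrow> real^2 \<Rightarrow> real" where
  "partial i f x = frechet_derivative f (at x) (axis i 1)"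

definition smooth :: "(real^2 \<Rightarrow> real) \<Rightarrow> bool" where
  "smooth f \<longleftrightarrow> (\<forall>is x. fold partial is f differentiable (at x))"

definition test_function :: "(real^2) set \<Rightarrow> (real^2 \<Rightarrow> real) \<Rightarrow> bool" where
  "test_function U \<phi> \<longleftrightarrow>
     smooth \<phi> \<and> compact (closure {x. \<phi> x \<noteq> 0}) \<and> closure {x. \<phi> x \<noteq> 0} \<subseteq> U"

definition locally_integrable ::
  "(real^2) set \<Rightarrow> (real^2 \<Rightarrow> 'b::euclidean_space) \<Rightarrow> bool" where
  "locally_integrable U f \<longleftrightarrow> (\<forall>K. compact K \<and> K \<subseteq> U \<longrightarrow> f absolutely_integrable_on K)"

definition weak_gradient ::
  "(real^2) set \<Rightarrow> (real^2 \<Rightarrow> real) \<Rightarrow> (real^2 \<Rightarrow> real^2) \<Rightarrow> bool" where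
  "weak_gradient E f g \<longleftrightarrow>
     locally_integrable (interior E) f \<and> locally_integrable (interior E) g \<and>
     (\<forall>\<phi>. test_function (interior E) \<phi> \<longrightarrow>
        (\<forall>i. (LINT x|lebesgue_on E. f x * partial i \<phi> x) = - (LINT x|lebesgue_on E. g x $ i * \<phi> x)))"

definition weak_curl ::
  "(real^2) set \<Rightarrow> (real^2 \<Rightarrow> real^2) \<Rightarrow> (real^2 \<Rightarrow> real) \<Rightarrow> bool" where
  "weak_curl E \<psi> w \<longleftrightarrow>
     locally_integrable (interior E) \<psi> \<and> locally_integrable (interior E) w \<and>
     (\<forall>\<phi>. test_function (interior E) \<phi> \<longrightarrow>
        (LINT x|lebesgue_on E. \<psi> x $ 1 * partial 2 \<phi> x - \<psi> x $ 2 * partial 1 \<phi> x)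
          = - (LINT x|lebesgue_on E. w x * \<phi> x))"

definition square_integrable ::
  "(real^2) set \<Rightarrow> (real^2 \<Rightarrow> 'b::euclidean_space) \<Rightarrow> bool" where
  "square_integrable E f \<longleftrightarrow>
     f \<in> borel_measurable (lebesgue_on E) \<and> integrable (lebesgue_on E) (\<lambda>x. (norm (f x))\<^sup>2)"

definition H1 :: "(real^2) set \<Rightarrow> (real^2 \<Rightarrow> real) \<Rightarrow> bool" where
  "H1 E f \<longleftrightarrow> square_integrable E f \<and> (\<exists>g. weak_gradient E f g \<and> square_integrable E g)"

section \<open>Functions on \<open>E\<close> modulo equality almost everywhere\<close>

text \<open>All function spaces below are sets of classes \<^term>\<open>ae_class E f\<close>. Since \<^term>\<open>E\<close> is the closure
  of its interior, a continuous function on \<^term>\<open>E\<close> is determined by its class.\<close>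

definition ae_class :: "(real^2) set \<Rightarrow> (real^2 \<Rightarrow> 'b) \<Rightarrow> (real^2 \<Rightarrow> 'b) set" where
  "ae_class E f = {g. AE x in lebesgue_on E. g x = f x}"

definition zero_class :: "(real^2) set \<Rightarrow> (real^2 \<Rightarrow> 'b::zero) set" where
  "zero_class E = ae_class E (\<lambda>_. 0)"

definition const_class :: "(real^2) set \<Rightarrow> real \<Rightarrow> (real^2 \<Rightarrow> real) set" where
  "const_class E t = ae_class E (\<lambda>_. t)"

definition L1loc :: "(real^2) set \<Rightarrow> (real^2 \<Rightarrow> 'b::euclidean_space) set set" where
  "L1loc E = {ae_class E f | f. locally_integrable (interior E) f}"

definition class_add ::
  "(real^2 \<Rightarrow> 'b::plus) set \<Rightarrow> (real^2 \<Rightarrow> 'b) set \<Rightarrow> (real^2 \<Rightarrow> 'b) set" where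
  "class_add u v = {\<lambda>x. f x + g x | f g. f \<in> u \<and> g \<in> v}"

definition space_sum ::
  "(real^2 \<Rightarrow> 'b::plus) set set \<Rightarrow> (real^2 \<Rightarrow> 'b) set set \<Rightarrow> (real^2 \<Rightarrow> 'b) set set" where
  "space_sum U W = {class_add u w | u w. u \<in> U \<and> w \<in> W}"

definition is_direct ::
  "(real^2) set \<Rightarrow> (real^2 \<Rightarrow> 'b::zero) set set \<Rightarrow> (real^2 \<Rightarrow> 'b) set set \<Rightarrow> bool" where
  "is_direct E U W \<longleftrightarrow> U \<inter> W = {zero_class E}"

text \<open>For a class \<^term>\<open>u\<close> possessing a weak gradient, the set of all weak gradients of its
  representatives is exactly one class; otherwise it is empty. Likewise for the curl.\<close>

definition grad :: "(real^2) set \<Rightarrow> (real^2 \<Rightarrow> real) set \<Rightarrow> (real^2 \<Rightarrow> real^2) set" where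
  "grad E u = {g. \<exists>f\<in>u. weak_gradient E f g}"

definition curl :: "(real^2) set \<Rightarrow> (real^2 \<Rightarrow> real^2) set \<Rightarrow> (real^2 \<Rightarrow> real) set" where
  "curl E v = {w. \<exists>\<psi>\<in>v. weak_curl E \<psi> w}"

section \<open>Polynomial and direct serendipity spaces\<close>

definition poly_fun :: "nat \<Rightarrow> (real^2 \<Rightarrow> real) set" where
  "poly_fun k = {\<lambda>x. \<Sum>(i, j)\<in>{(i, j). i + j \<le> k}. q i j * (x$1) ^ i * (x$2) ^ j | q. True}"

definition poly_space :: "(real^2) set \<Rightarrow> nat \<Rightarrow> (real^2 \<Rightarrow> real) set set" where
  "poly_space E k = ae_class E ` poly_fun k"

definition span2 ::
  "(real^2) set \<Rightarrow> (real^2 \<Rightarrow> real) \<Rightarrow> (real^2 \<Rightarrow> real) \<Rightarrow> (real^2 \<Rightarrow> real) set set" where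
  "span2 E f g = {ae_class E (\<lambda>x. s * f x + t * g x) | s t. True}"

definition linear_poly :: "(real^2 \<Rightarrow> real) \<Rightarrow> bool" where
  "linear_poly l \<longleftrightarrow> (\<exists>n m. n \<noteq> 0 \<and> l = (\<lambda>x. n \<bullet> x + m))"

text \<open>Admissible \<open>\<lambda>\<^sub>H\<close> for the opposite edges \<open>e\<^sub>1\<close>, \<open>e\<^sub>2\<close> with edge functions \<open>\<lambda>\<^sub>1\<close>, \<open>\<lambda>\<^sub>2\<close>;
  also used for \<open>\<lambda>\<^sub>V\<close> with \<open>e\<^sub>3\<close>, \<open>e\<^sub>4\<close>.\<close>

definition admissible_linear ::
  "(real^2) set \<Rightarrow> (real^2) set \<Rightarrow> (real^2 \<Rightarrow> real) \<Rightarrow> (real^2 \<Rightarrow> real) \<Rightarrow> (real^2 \<Rightarrow> real) \<Rightarrow> bool" where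
  "admissible_linear e e' l l' lH \<longleftrightarrow>
     linear_poly lH \<and>
     (if affine_parallel (affine hull e) (affine hull e')
      then {x. lH x = 0} \<inter> affine hull e \<noteq> {} \<and> {x. lH x = 0} \<inter> affine hull e' \<noteq> {}
      else \<exists>\<alpha> \<beta> \<gamma>. \<alpha> > 0 \<and> \<beta> > 0 \<and> \<gamma> \<noteq> 0 \<and> lH = (\<lambda>x. \<alpha> * l x + \<beta> * l' x + \<gamma>))"

definition admissible_R ::
  "(real^2) set \<Rightarrow> (real^2) set \<Rightarrow> (real^2) set \<Rightarrow> (real^2 \<Rightarrow> real) \<Rightarrow> bool" where
  "admissible_R E e e' R \<longleftrightarrow>
     bounded (R ` E) \<and> continuous_on E R \<and> H1 E R \<and>
     (\<exists>\<eta> \<xi>. \<eta> > 0 \<and> \<xi> > 0 \<and> (\<forall>x\<in>e. R x = - \<eta>) \<and> (\<forall>x\<in>e'. R x = \<xi>))"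

definition fully_direct_supplement ::
  "(real^2) set \<Rightarrow> real^2 \<Rightarrow> real^2 \<Rightarrow> real^2 \<Rightarrow> real^2 \<Rightarrow> nat \<Rightarrow> (real^2 \<Rightarrow> real) set set \<Rightarrow> bool" where
  "fully_direct_supplement E a b c d r S \<longleftrightarrow>
     (let e1 = closed_segment a d; e2 = closed_segment b c;
          e3 = closed_segment a b; e4 = closed_segment d c
      in \<exists>l1 l2 l3 l4 lH lV RV RH.
           edge_function E e1 l1 \<and> edge_function E e2 l2 \<and>
           edge_function E e3 l3 \<and> edge_function E e4 l4 \<and>
           admissible_linear e1 e2 l1 l2 lH \<and> admissible_linear e3 e4 l3 l4 lV \<and>
           admissible_R E e1 e2 RV \<and> admissible_R E e3 e4 RH \<and>
           S = span2 E (\<lambda>x. l3 x * l4 x * lH x ^ (r - 1) * RV x)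
                       (\<lambda>x. l1 x * l2 x * lV x ^ (r - 1) * RH x))"

definition mapped_supplement ::
  "(real^2) set \<Rightarrow> real^2 \<Rightarrow> real^2 \<Rightarrow> real^2 \<Rightarrow> real^2 \<Rightarrow> nat \<Rightarrow> (real^2 \<Rightarrow> real) set set" where
  "mapped_supplement E a b c d r =
     span2 E (push_forward a b c d (\<lambda>xh. (1 - (xh$2)\<^sup>2) * xh$1 * (xh$2) ^ (r - 1)))
             (push_forward a b c d (\<lambda>xh. (1 - (xh$1)\<^sup>2) * xh$2 * (xh$1) ^ (r - 1)))"

text \<open>The supplements admitted in the direct serendipity space of index \<^term>\<open>r + 1\<close>.\<close>

definition DS_supplement ::
  "(real^2) set \<Rightarrow> real^2 \<Rightarrow> real^2 \<Rightarrow> real^2 \<Rightarrow> real^2 \<Rightarrow> nat \<Rightarrow> (real^2 \<Rightarrow> real) set set \<Rightarrow> bool" where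
  "DS_supplement E a b c d r S \<longleftrightarrow>
     fully_direct_supplement E a b c d r S \<or> S = mapped_supplement E a b c d r"

definition DS :: "(real^2) set \<Rightarrow> nat \<Rightarrow> (real^2 \<Rightarrow> real) set set \<Rightarrow> (real^2 \<Rightarrow> real) set set" where
  "DS E r S = space_sum (poly_space E (r + 1)) S"

definition rot_poly_space :: "(real^2) set \<Rightarrow> nat \<Rightarrow> (real^2 \<Rightarrow> real^2) set set" where
  "rot_poly_space E k = {ae_class E (\<lambda>x. p x *\<^sub>R vector [x$2, - x$1]) | p. p \<in> poly_fun k}"

definition V_full :: "(real^2) set \<Rightarrow> nat \<Rightarrow> (real^2 \<Rightarrow> real) set set \<Rightarrow> (real^2 \<Rightarrow> real^2) set set" where
  "V_full E r S = space_sum (grad E ` DS E r S) (rot_poly_space E r)"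

definition V_red :: "(real^2) set \<Rightarrow> nat \<Rightarrow> (real^2 \<Rightarrow> real) set set \<Rightarrow> (real^2 \<Rightarrow> real^2) set set" where
  "V_red E r S = space_sum (grad E ` DS E r S) (rot_poly_space E (r - 1))"

section \<open>Exactness\<close>

text \<open>The sequence of the constants, \<^term>\<open>D\<close>, \<^term>\<open>V\<close>, \<^term>\<open>W\<close> and 0, the maps being the inclusion,
  the gradient and the curl: every map is well defined between the given spaces.\<close>

definition well_defined_sequence ::
  "(real^2) set \<Rightarrow> (real^2 \<Rightarrow> real) set set \<Rightarrow> (real^2 \<Rightarrow> real^2) set set \<Rightarrow> (real^2 \<Rightarrow> real) set set \<Rightarrow> bool" where
  "well_defined_sequence E D V W \<longleftrightarrow>
     D \<subseteq> L1loc E \<and> V \<subseteq> L1loc E \<and> W \<subseteq> L1loc E \<and>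
     range (const_class E) \<subseteq> D \<and> grad E ` D \<subseteq> V \<and> curl E ` V \<subseteq> W"

definition exact_sequence ::
  "(real^2) set \<Rightarrow> (real^2 \<Rightarrow> real) set set \<Rightarrow> (real^2 \<Rightarrow> real^2) set set \<Rightarrow> (real^2 \<Rightarrow> real) set set \<Rightarrow> bool" where
  "exact_sequence E D V W \<longleftrightarrow>
     inj (const_class E) \<and>
     range (const_class E) = {u \<in> D. grad E u = zero_class E} \<and>
     grad E ` D = {v \<in> V. curl E v = zero_class E} \<and>
     curl E ` V = W"

end

theory Submission
  imports Defs
begin

text \<open>
The proof separates analysis from geometry. Suppose that every element of a space \<open>D\<close> has a continuous
representative with a weak gradient, and let \<open>V\<close> be spanned by the gradients of \<open>D\<close> and by
\<open>(x\<^sub>2, -x\<^sub>1) p\<close> with \<open>p\<close> a polynomial of degree at most \<open>k\<close>. Curls of weak gradients vanish, because mixed partial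
derivatives of test functions commute, and the curl of \<open>(x\<^sub>2, -x\<^sub>1) p\<close> is \<open>2 p + x \<bullet> \<nabla> p\<close>, which multiplies the
homogeneous part of degree \<open>n\<close> by \<open>n + 2\<close> and so is a bijection on polynomials. Hence the sum is direct, the
kernel of the curl consists of the gradients, and the curl is onto. The kernel of the gradient consists of the
constants, since a continuous function with vanishing weak gradient is constant
(\<open>weak_gradient_0_constant\<close>). This is \<open>exact_of_regular_representatives\<close>; applied with \<open>k = r\<close> and
\<open>k = r - 1\<close> it covers the full and the reduced sequence.

Gradients and curls act on classes modulo null sets, so their uniqueness is needed
(\<open>fundamental_lemma\<close>). Test functions are built from \<open>exp(-1/t)\<close>: the roots of a bump approximate the
indicator of a box, and boxes generate the Borel sets. Integration by parts follows from translation
invariance of the integral.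

The geometric part (\<open>DS_properties\<close>) shows that the supplements are regular enough and meet the polynomials of
degree at most \<open>r + 1\<close> only in zero. For fully direct supplements regularity is the product rule; for mapped
ones it rests on the bilinear map being a bijection onto \<open>E\<close> with nonvanishing Jacobian
(\<open>F_inj\<close>, \<open>F_image\<close>, \<open>jac_nonzero\<close>). Directness has one reason for both kinds
(\<open>opposite_trace_independent\<close>): each spanning function belongs to one pair of opposite
edges and has polynomial traces there. A polynomial with the same traces extends them to the two edge lines,
where they clash: they have opposite signs at the intersection point, or, for parallel edges, in the
coefficient of top degree.
\<close>

section \<open>Smooth functions\<close>

lemma partial_eq: "(f has_derivative D) (at x) \<Longrightarrow> partial i f x = D (axis i 1)"
  unfolding partial_def using frechet_derivative_at by fastforce

lemma smooth_iff:
  "smooth f \<longleftrightarrow> (\<forall>x. f differentiable (at x)) \<and> (\<forall>i. smooth (partial i f))"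
proof
  assume s: "smooth f"
  have "\<forall>is x. fold partial is (partial i f) differentiable (at x)" for i
    using s unfolding smooth_def by (metis fold_Cons comp_apply)
  moreover have "\<forall>x. f differentiable (at x)"
    using s unfolding smooth_def by (metis fold_Nil id_apply)
  ultimately show "(\<forall>x. f differentiable (at x)) \<and> (\<forall>i. smooth (partial i f))"
    by (simp add: smooth_def)
next
  assume a: "(\<forall>x. f differentiable (at x)) \<and> (\<forall>i. smooth (partial i f))"
  have "fold partial is f differentiable (at x)" for "is" x
    using a by (cases "is") (auto simp: smooth_def)
  then show "smooth f" by (simp add: smooth_def)
qed

text \<open>Smoothness quantifies over all iterated partial derivatives, so it follows from membership in any
  class of differentiable functions that is invariant under taking partial derivatives.\<close>

lemma smooth_coinduct:
  assumes "f \<in> C" "\<And>f x. f \<in> C \<Longrightarrow> f differentiable (at x)" "\<And>f i. f \<in> C \<Longrightarrow> partial i f \<in> C"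
  shows "smooth f"
proof -
  have "fold partial is f \<in> C" for "is"
    using assms(1) by (induction "is" arbitrary: f) (auto intro: assms(3))
  then show ?thesis unfolding smooth_def using assms(2) by blast
qed

lemma smooth_differentiable: "smooth f \<Longrightarrow> f differentiable (at x)"
  using smooth_iff by blast

lemma smooth_partial: "smooth f \<Longrightarrow> smooth (partial i f)"
  using smooth_iff by blast

lemma smooth_continuous_on: "smooth f \<Longrightarrow> continuous_on S f"
  by (meson continuous_at_imp_continuous_on differentiable_imp_continuous_within smooth_differentiable)

lemma has_derivative_partial:
  fixes f :: "real^2 \<Rightarrow> real"
  assumes "f differentiable (at x)"
  shows "(f has_derivative (\<lambda>v. v$1 * partial 1 f x + v$2 * partial 2 f x)) (at x)"
proof -
  obtain D where D: "(f has_derivative D) (at x)" using assms differentiable_def by blast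
  interpret bounded_linear D using D by (rule has_derivative_bounded_linear)
  have "D v = v$1 * partial 1 f x + v$2 * partial 2 f x" for v
  proof -
    have "v = (v$1) *\<^sub>R axis 1 1 + (v$2) *\<^sub>R axis 2 1"
      by (simp add: vec_eq_iff forall_2 axis_def)
    then have "D v = D ((v$1) *\<^sub>R axis 1 1 + (v$2) *\<^sub>R axis 2 1)" by simp
    also have "\<dots> = v$1 * D (axis 1 1) + v$2 * D (axis 2 1)" by (simp add: add scaleR)
    finally show ?thesis by (simp add: partial_eq[OF D])
  qed
  then have "D = (\<lambda>v. v$1 * partial 1 f x + v$2 * partial 2 f x)" by blast
  then show ?thesis using D by simp
qed

text \<open>The functions \<open>q(1/t) exp(-1/t)\<close>, extended by zero to \<open>t \<le> 0\<close>. Allowing a polynomial factor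
  makes the family stable under differentiation; the members with \<open>q = 1\<close> are the building blocks of
  every test function below.\<close>

definition flat :: "real poly \<Rightarrow> real \<Rightarrow> real" where
  "flat q t = (if t > 0 then poly q (1/t) * exp (-1/t) else 0)"

lemma flat_tendsto_0: "(flat q \<longlongrightarrow> 0) (at 0)"
proof -
  have *: "((\<lambda>s. poly q s / exp s) \<longlongrightarrow> 0) at_top" for q :: "real poly"
  proof -
    have "((\<lambda>s. \<Sum>i\<le>degree q. coeff q i * (s ^ i / exp s)) \<longlongrightarrow> (\<Sum>i\<le>degree q. coeff q i * 0)) at_top"
      by (intro tendsto_intros tendsto_power_div_exp_0)
    then show ?thesis by (simp add: poly_altdef sum_divide_distrib)
  qed
  have r: "(flat q \<longlongrightarrow> 0) (at_right 0)"
  proof (rule Lim_transform_eventually)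
    show "((\<lambda>t. poly q (inverse t) / exp (inverse t)) \<longlongrightarrow> 0) (at_right 0)"
      by (rule filterlim_compose[OF * filterlim_inverse_at_top_right])
    show "\<forall>\<^sub>F t in at_right 0. poly q (inverse t) / exp (inverse t) = flat q t"
      by (rule eventually_at_right_less[THEN eventually_mono])
         (simp add: flat_def exp_minus field_simps)
  qed
  have l: "(flat q \<longlongrightarrow> 0) (at_left 0)"
  proof (rule Lim_transform_eventually[OF tendsto_const])
    show "\<forall>\<^sub>F t in at_left 0. 0 = flat q t"
      by (rule eventually_at_leftI[of "-1"]) (auto simp: flat_def)
  qed
  show ?thesis using l r by (simp add: filterlim_at_split)
qed

text \<open>At \<open>t = 0\<close> the difference quotient of \<open>flat q\<close> is \<open>flat (X q)\<close>, which tends to zero because the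
  exponential beats every polynomial.\<close>

lemma flat_has_derivative:
  "(flat q has_real_derivative flat ([:0,0,1:] * (q - pderiv q)) t) (at t)"
proof (cases t "0::real" rule: linorder_cases)
  case less
  have "((\<lambda>_. 0) has_real_derivative 0) (at t)" by simp
  then have "(flat q has_real_derivative 0) (at t)"
    by (rule has_field_derivative_transform_within_open[of _ _ _ "{..<0}"])
       (use less in \<open>auto simp: flat_def\<close>)
  then show ?thesis using less by (simp add: flat_def)
next
  case equal
  have "((\<lambda>h. flat q h / h) \<longlongrightarrow> 0) (at 0)"
  proof (rule Lim_transform_eventually[OF flat_tendsto_0[of "[:0,1:] * q"]])
    show "\<forall>\<^sub>F h in at 0. flat ([:0,1:] * q) h = flat q h / h"
      by (rule eventually_at_topological[THEN iffD2]) (auto simp: flat_def intro!: exI[of _ UNIV])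
  qed
  then show ?thesis using equal by (simp add: DERIV_def flat_def)
next
  case greater
  have "((\<lambda>t. poly q (1/t) * exp (-1/t)) has_real_derivative
     flat ([:0,0,1:] * (q - pderiv q)) t) (at t)"
    using greater
    by (auto intro!: derivative_eq_intros simp: flat_def field_simps power2_eq_square)
  then show ?thesis
    by (rule has_field_derivative_transform_within_open[of _ _ _ "{0<..}"])
       (use greater in \<open>auto simp: flat_def\<close>)
qed

text \<open>Sum, product and chain rule express the partial derivatives of these functions by functions of the
  same kind, so the whole set satisfies the coinduction principle. This yields the closure properties
  of smooth functions in one stroke, without a Leibniz formula for iterated derivatives.\<close>

inductive_set smooth_closure :: "(real^2 \<Rightarrow> real) set" where
  smooth: "smooth f \<Longrightarrow> f \<in> smooth_closure"
| add: "f \<in> smooth_closure \<Longrightarrow> g \<in> smooth_closure \<Longrightarrow> (\<lambda>x. f x + g x) \<in> smooth_closure"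
| mult: "f \<in> smooth_closure \<Longrightarrow> g \<in> smooth_closure \<Longrightarrow> (\<lambda>x. f x * g x) \<in> smooth_closure"
| flat: "f \<in> smooth_closure \<Longrightarrow> (\<lambda>x. flat q (f x)) \<in> smooth_closure"

lemma smooth_closure_derivative:
  assumes "f \<in> smooth_closure"
  shows "\<exists>D. (\<forall>x. (f has_derivative D x) (at x)) \<and> (\<forall>i. (\<lambda>x. D x (axis i 1)) \<in> smooth_closure)"
  using assms
proof induction
  case (smooth f)
  show ?case
  proof (intro exI conjI allI)
    show "(f has_derivative frechet_derivative f (at x)) (at x)" for x
      using smooth smooth_differentiable frechet_derivative_works by blast
    show "(\<lambda>x. frechet_derivative f (at x) (axis i 1)) \<in> smooth_closure" for i
      using smooth_partial[OF smooth, of i] by (auto simp: partial_def[abs_def] intro: smooth_closure.smooth)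
  qed
next
  case (add f g)
  then obtain D D' where "\<forall>x. (f has_derivative D x) (at x)" "\<forall>i. (\<lambda>x. D x (axis i 1)) \<in> smooth_closure"
    "\<forall>x. (g has_derivative D' x) (at x)" "\<forall>i. (\<lambda>x. D' x (axis i 1)) \<in> smooth_closure" by blast
  then show ?case
    by (intro exI[of _ "\<lambda>x v. D x v + D' x v"])
       (auto intro!: derivative_eq_intros smooth_closure.add)
next
  case (mult f g)
  then obtain D D' where "\<forall>x. (f has_derivative D x) (at x)" "\<forall>i. (\<lambda>x. D x (axis i 1)) \<in> smooth_closure"
    "\<forall>x. (g has_derivative D' x) (at x)" "\<forall>i. (\<lambda>x. D' x (axis i 1)) \<in> smooth_closure" by blast
  then show ?case using mult.hyps
    by (intro exI[of _ "\<lambda>x v. f x * D' x v + D x v * g x"])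
       (auto intro!: has_derivative_mult smooth_closure.add smooth_closure.mult)
next
  case (flat f q)
  then obtain D where D: "\<forall>x. (f has_derivative D x) (at x)" "\<forall>i. (\<lambda>x. D x (axis i 1)) \<in> smooth_closure"
    by blast
  let ?q = "[:0,0,1:] * (q - pderiv q)"
  have "((\<lambda>x. flat q (f x)) has_derivative (\<lambda>v. flat ?q (f x) * D x v)) (at x)" for x
    using has_derivative_compose[of f "D x" x UNIV "flat q" "(*) (flat ?q (f x))"]
      D(1) flat_has_derivative[of q "f x"]
    by (auto simp: has_field_derivative_def)
  then show ?case using flat.hyps D(2)
    by (intro exI[of _ "\<lambda>x v. flat ?q (f x) * D x v"]) (auto intro!: smooth_closure.mult smooth_closure.flat)
qed

lemma smooth_closure_smooth: "f \<in> smooth_closure \<Longrightarrow> smooth f"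
proof (erule smooth_coinduct)
  fix f x assume "f \<in> smooth_closure"
  then show "f differentiable (at x)"
    using smooth_closure_derivative differentiable_def by blast
next
  fix f i assume "f \<in> smooth_closure"
  then obtain D where D: "\<forall>x. (f has_derivative D x) (at x)" "\<forall>i. (\<lambda>x. D x (axis i 1)) \<in> smooth_closure"
    using smooth_closure_derivative by blast
  then have "partial i f = (\<lambda>x. D x (axis i 1))" using partial_eq by blast
  then show "partial i f \<in> smooth_closure" using D by simp
qed

lemma smooth_const [simp]: "smooth (\<lambda>x. c)"
proof (rule smooth_coinduct)
  show "(\<lambda>x. c) \<in> range (\<lambda>c x. c)" by blast
  fix f :: "real^2 \<Rightarrow> real" and i assume "f \<in> range (\<lambda>c x. c)"
  then obtain c where f: "f = (\<lambda>x. c)" by blast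
  show "f differentiable (at x)" for x using f by simp
  have "partial i f = (\<lambda>x. 0)"
    using partial_eq[OF has_derivative_const] f by blast
  then show "partial i f \<in> range (\<lambda>c x. c)" by blast
qed

lemma partial_linear: "partial i (\<lambda>x. n \<bullet> x + m) = (\<lambda>x. n $ i)"
proof
  fix x :: "real^2"
  have "((\<lambda>x. n \<bullet> x + m) has_derivative (\<lambda>v. n \<bullet> v)) (at x)"
    by (auto intro!: derivative_eq_intros)
  then have "partial i (\<lambda>x. n \<bullet> x + m) x = n \<bullet> axis i 1" by (rule partial_eq)
  then show "partial i (\<lambda>x. n \<bullet> x + m) x = n $ i" by (simp add: inner_axis)
qed

lemma smooth_linear: "smooth (\<lambda>x. n \<bullet> x + m)"
proof (subst smooth_iff, intro conjI allI)
  fix x :: "real^2"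
  have "((\<lambda>x. n \<bullet> x + m) has_derivative (\<lambda>v. n \<bullet> v)) (at x)"
    by (auto intro!: derivative_eq_intros)
  then show "(\<lambda>x. n \<bullet> x + m) differentiable at x" by (rule differentiableI)
qed (simp add: partial_linear)

lemma smooth_add: "smooth f \<Longrightarrow> smooth g \<Longrightarrow> smooth (\<lambda>x. f x + g x)"
  and smooth_mult: "smooth f \<Longrightarrow> smooth g \<Longrightarrow> smooth (\<lambda>x. f x * g x)"
  and smooth_flat: "smooth f \<Longrightarrow> smooth (\<lambda>x. flat q (f x))"
  by (blast intro: smooth_closure_smooth smooth_closure.intros)+

lemma smooth_component: "smooth (\<lambda>x. x $ i)"
  using smooth_linear[of "axis i 1" 0] by (simp add: inner_axis' )

lemma smooth_cmult: "smooth f \<Longrightarrow> smooth (\<lambda>x. c * f x)"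
  using smooth_mult[of "\<lambda>_. c"] by simp

lemma smooth_uminus: "smooth f \<Longrightarrow> smooth (\<lambda>x. - f x)"
  using smooth_cmult[of f "-1"] by simp

lemma smooth_diff: "smooth f \<Longrightarrow> smooth g \<Longrightarrow> smooth (\<lambda>x. f x - g x)"
  using smooth_add[of f "\<lambda>x. - g x"] smooth_uminus[of g] by simp

lemma smooth_power: "smooth f \<Longrightarrow> smooth (\<lambda>x. f x ^ n)"
  by (induction n) (auto intro: smooth_mult)

lemma smooth_sum: "(\<And>i. i \<in> I \<Longrightarrow> smooth (f i)) \<Longrightarrow> smooth (\<lambda>x. \<Sum>i\<in>I. f i x)"
  by (induction I rule: infinite_finite_induct) (auto intro: smooth_add)

lemma partial_mult:
  assumes "f differentiable (at x)" "g differentiable (at x)"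
  shows "partial i (\<lambda>x. f x * g x) x = partial i f x * g x + f x * partial i g x"
  using partial_eq[OF has_derivative_mult[OF assms[unfolded frechet_derivative_works]], of i]
  by (simp add: partial_def)

lemma has_derivative_along:
  assumes "smooth f"
  shows "((\<lambda>t. f (x + t *\<^sub>R axis i 1)) has_real_derivative partial i f (x + t *\<^sub>R axis i 1)) (at t)"
proof -
  have D: "(f has_derivative (frechet_derivative f (at y))) (at y)" for y
    using smooth_differentiable[OF assms] frechet_derivative_works by blast
  have "((\<lambda>t. f (x + t *\<^sub>R axis i 1)) has_derivative
     (\<lambda>s. frechet_derivative f (at (x + t *\<^sub>R axis i 1)) (s *\<^sub>R axis i 1))) (at t)"
    by (rule has_derivative_compose[OF _ D]) (auto intro!: derivative_eq_intros)
  moreover have "frechet_derivative f (at y) (s *\<^sub>R axis i 1) = partial i f y * s" for y s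
    using linear_cmul[OF has_derivative_linear[OF D[of y]]] by (simp add: partial_def)
  ultimately show ?thesis by (simp add: has_field_derivative_def mult_commute_abs)
qed

text \<open>The second difference is symmetric in the two directions, while the mean value theorem, applied once
  in each direction, turns it into a mixed partial derivative at a nearby point. Letting \<open>h\<close> tend to zero
  gives Schwarz's theorem.\<close>

lemma difference_quotient_mixed:
  assumes "smooth f" "h > 0"
  shows "\<exists>s t. 0 < s \<and> s < h \<and> 0 < t \<and> t < h \<and>
    f (x + h *\<^sub>R axis i 1 + h *\<^sub>R axis j 1) - f (x + h *\<^sub>R axis i 1) - f (x + h *\<^sub>R axis j 1) + f x
      = h\<^sup>2 * partial j (partial i f) (x + s *\<^sub>R axis i 1 + t *\<^sub>R axis j 1)"
proof -
  let ?g = "\<lambda>s. f (x + h *\<^sub>R axis j 1 + s *\<^sub>R axis i 1) - f (x + s *\<^sub>R axis i 1)"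
  let ?g' = "\<lambda>s. partial i f (x + h *\<^sub>R axis j 1 + s *\<^sub>R axis i 1) - partial i f (x + s *\<^sub>R axis i 1)"
  have "(?g has_real_derivative ?g' s) (at s)" for s
    by (intro DERIV_diff has_derivative_along assms)
  then obtain s where s: "0 < s" "s < h" "?g h - ?g 0 = (h - 0) * ?g' s"
    using MVT2[of 0 h ?g ?g'] assms by blast
  let ?k = "\<lambda>t. partial i f (x + s *\<^sub>R axis i 1 + t *\<^sub>R axis j 1)"
  have "(?k has_real_derivative partial j (partial i f) (x + s *\<^sub>R axis i 1 + t *\<^sub>R axis j 1)) (at t)" for t
    by (intro has_derivative_along smooth_partial assms)
  then obtain t where t: "0 < t" "t < h"
    "?k h - ?k 0 = (h - 0) * partial j (partial i f) (x + s *\<^sub>R axis i 1 + t *\<^sub>R axis j 1)"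
    using MVT2[of 0 h ?k "\<lambda>t. partial j (partial i f) (x + s *\<^sub>R axis i 1 + t *\<^sub>R axis j 1)"] assms by blast
  show ?thesis
    using s t by (intro exI[of _ s] exI[of _ t]) (simp add: power2_eq_square algebra_simps)
qed

lemma partial_commute:
  assumes "smooth f"
  shows "partial i (partial j f) = partial j (partial i f)"
proof
  fix x
  let ?a = "partial j (partial i f)" and ?b = "partial i (partial j f)"
  have near: "\<exists>d>0. \<forall>s t. 0 < s \<and> s < d \<and> 0 < t \<and> t < d \<longrightarrow>
      \<bar>k (x + s *\<^sub>R axis i 1 + t *\<^sub>R axis j 1) - k x\<bar> < e"
    if "continuous_on UNIV k" "e > 0" for k :: "real^2 \<Rightarrow> real" and e i j
  proof -
    from that obtain d where d: "d > 0" "\<forall>y. dist y x < d \<longrightarrow> dist (k y) (k x) < e"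
      unfolding continuous_on_iff by (metis UNIV_I)
    show ?thesis
    proof (intro exI[of _ "d/2"] conjI allI impI)
      fix s t :: real assume st: "0 < s \<and> s < d/2 \<and> 0 < t \<and> t < d/2"
      have "norm (s *\<^sub>R axis i (1::real) + t *\<^sub>R axis j 1 :: real^2) \<le> s + t"
        using norm_triangle_ineq[of "s *\<^sub>R axis i (1::real)" "t *\<^sub>R axis j (1::real)"] st by simp
      then have "dist (x + s *\<^sub>R axis i 1 + t *\<^sub>R axis j 1) x < d"
        using st by (simp add: dist_norm add.assoc)
      then show "\<bar>k (x + s *\<^sub>R axis i 1 + t *\<^sub>R axis j 1) - k x\<bar> < e"
        using d by (simp add: dist_real_def)
    qed (use d in simp)
  qed
  have "\<bar>?a x - ?b x\<bar> < 2 * e" if e0: "e > 0" for e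
  proof -
    have c: "continuous_on UNIV ?a" "continuous_on UNIV ?b"
      by (intro smooth_continuous_on smooth_partial assms)+
    obtain d1 where d1: "d1 > 0" "\<forall>s t. 0 < s \<and> s < d1 \<and> 0 < t \<and> t < d1 \<longrightarrow>
      \<bar>?a (x + s *\<^sub>R axis i 1 + t *\<^sub>R axis j 1) - ?a x\<bar> < e" using near[OF c(1) e0, of i j] by blast
    obtain d2 where d2: "d2 > 0" "\<forall>s t. 0 < s \<and> s < d2 \<and> 0 < t \<and> t < d2 \<longrightarrow>
      \<bar>?b (x + s *\<^sub>R axis j 1 + t *\<^sub>R axis i 1) - ?b x\<bar> < e" using near[OF c(2) e0, of j i] by blast
    define h where "h = min d1 d2"
    have h: "h > 0" "h \<le> d1" "h \<le> d2" using d1 d2 by (auto simp: h_def)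
    obtain s t where st: "0 < s" "s < h" "0 < t" "t < h"
      "f (x + h *\<^sub>R axis i 1 + h *\<^sub>R axis j 1) - f (x + h *\<^sub>R axis i 1) - f (x + h *\<^sub>R axis j 1) + f x
      = h\<^sup>2 * ?a (x + s *\<^sub>R axis i 1 + t *\<^sub>R axis j 1)"
      using difference_quotient_mixed[OF assms h(1)] by metis
    obtain s' t' where st': "0 < s'" "s' < h" "0 < t'" "t' < h"
      "f (x + h *\<^sub>R axis j 1 + h *\<^sub>R axis i 1) - f (x + h *\<^sub>R axis j 1) - f (x + h *\<^sub>R axis i 1) + f x
      = h\<^sup>2 * ?b (x + s' *\<^sub>R axis j 1 + t' *\<^sub>R axis i 1)"
      using difference_quotient_mixed[OF assms h(1)] by metis
    have "h\<^sup>2 * ?a (x + s *\<^sub>R axis i 1 + t *\<^sub>R axis j 1) = h\<^sup>2 * ?b (x + s' *\<^sub>R axis j 1 + t' *\<^sub>R axis i 1)"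
      using st(5) st'(5) by (simp add: algebra_simps)
    then have "?a (x + s *\<^sub>R axis i 1 + t *\<^sub>R axis j 1) = ?b (x + s' *\<^sub>R axis j 1 + t' *\<^sub>R axis i 1)"
      using h by simp
    moreover have "\<bar>?a (x + s *\<^sub>R axis i 1 + t *\<^sub>R axis j 1) - ?a x\<bar> < e" using d1 st h by auto
    moreover have "\<bar>?b (x + s' *\<^sub>R axis j 1 + t' *\<^sub>R axis i 1) - ?b x\<bar> < e" using d2 st' h by auto
    ultimately show ?thesis by linarith
  qed
  from this[of "\<bar>?a x - ?b x\<bar> / 2"] show "?b x = ?a x" by (cases "?a x = ?b x") auto
qed

section \<open>Test functions\<close>

lemma test_functionI:
  assumes "smooth \<phi>" "compact K" "K \<subseteq> U" "\<And>x. x \<notin> K \<Longrightarrow> \<phi> x = 0"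
  shows "test_function U \<phi>"
proof -
  have "closure {x. \<phi> x \<noteq> 0} \<subseteq> K"
    using assms(2,4) by (intro closure_minimal) (auto intro: compact_imp_closed)
  moreover from this have "compact (closure {x. \<phi> x \<noteq> 0})"
    using assms(2) closed_subset compact_closure bounded_subset compact_imp_bounded closure_subset
    by metis
  ultimately show ?thesis
    using assms(1,3) unfolding test_function_def by blast
qed

lemma test_functionE:
  assumes "test_function U \<phi>"
  obtains K where "smooth \<phi>" "compact K" "K \<subseteq> U" "\<forall>x. x \<notin> K \<longrightarrow> \<phi> x = 0"
proof
  show "smooth \<phi>" "compact (closure {x. \<phi> x \<noteq> 0})" "closure {x. \<phi> x \<noteq> 0} \<subseteq> U"
    using assms by (auto simp: test_function_def)
  show "\<forall>x. x \<notin> closure {x. \<phi> x \<noteq> 0} \<longrightarrow> \<phi> x = 0"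
    using closure_subset[of "{x. \<phi> x \<noteq> 0}"] by fast
qed

lemma partial_zero_outside:
  assumes "closed K" "\<And>x. x \<notin> K \<Longrightarrow> \<phi> x = 0" "x \<notin> K"
  shows "partial i \<phi> x = 0"
proof -
  have "(\<phi> has_derivative (\<lambda>_. 0)) (at x)"
    by (rule has_derivative_transform_within_open[of "\<lambda>_. 0" _ _ _ "- K"]) (use assms in auto)
  then show ?thesis by (rule partial_eq)
qed

lemma test_function_partial:
  assumes "test_function U \<phi>"
  shows "test_function U (partial i \<phi>)"
proof -
  obtain K where K: "smooth \<phi>" "compact K" "K \<subseteq> U" "\<forall>x. x \<notin> K \<longrightarrow> \<phi> x = 0"
    using assms by (rule test_functionE)
  show ?thesis
    using K partial_zero_outside[OF compact_imp_closed[OF K(2)] K(4)[rule_format]]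
    by (intro test_functionI[of _ K] smooth_partial)
qed

lemma test_function_mult:
  assumes "smooth p" "test_function U \<phi>"
  shows "test_function U (\<lambda>x. p x * \<phi> x)"
proof -
  obtain K where K: "smooth \<phi>" "compact K" "K \<subseteq> U" "\<forall>x. x \<notin> K \<longrightarrow> \<phi> x = 0"
    using assms(2) by (rule test_functionE)
  show ?thesis
  proof (rule test_functionI[OF smooth_mult[OF assms(1) K(1)] K(2,3)])
    show "p x * \<phi> x = 0" if "x \<notin> K" for x using K(4) that by simp
  qed
qed

lemma test_function_smooth: "test_function U \<phi> \<Longrightarrow> smooth \<phi>"
  by (simp add: test_function_def)

lemma test_function_outside: "test_function U \<phi> \<Longrightarrow> x \<notin> U \<Longrightarrow> \<phi> x = 0"
  by (elim test_functionE) blast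

section \<open>Integrals against test functions\<close>

lemma integral_on_eq_integral:
  fixes h :: "real^2 \<Rightarrow> real"
  assumes "E \<in> sets lebesgue" "\<And>x. x \<notin> E \<Longrightarrow> h x = 0"
  shows "integral\<^sup>L (lebesgue_on E) h = integral\<^sup>L lebesgue h"
    and "integrable (lebesgue_on E) h \<longleftrightarrow> integrable lebesgue h"
proof -
  have "(\<lambda>x. indicator E x *\<^sub>R h x) = h"
  proof
    show "indicator E x *\<^sub>R h x = h x" for x
      by (cases "x \<in> E") (use assms(2)[of x] in simp_all)
  qed
  then show "integral\<^sup>L (lebesgue_on E) h = integral\<^sup>L lebesgue h"
    "integrable (lebesgue_on E) h \<longleftrightarrow> integrable lebesgue h"
    using assms(1) by (simp_all add: integral_restrict_space integrable_restrict_space)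
qed

lemma bounded_on_compact:
  fixes p :: "real^2 \<Rightarrow> real"
  assumes "compact K" "continuous_on UNIV p"
  obtains B where "\<forall>x\<in>K. \<bar>p x\<bar> \<le> B"
proof -
  have "compact (p ` K)"
    by (rule compact_continuous_image[OF continuous_on_subset[OF assms(2) subset_UNIV] assms(1)])
  then show ?thesis using that by (auto dest!: compact_imp_bounded simp: bounded_real)
qed

text \<open>Test functions and their derivatives are bounded and live on a compact set on which the other
  factor is integrable; this is what makes all the integrals in the weak formulations meaningful.\<close>

lemma absolutely_integrable_mult_continuous:
  fixes f p :: "real^2 \<Rightarrow> real"
  assumes f: "f absolutely_integrable_on K" and K: "compact K" and p: "continuous_on UNIV p"
  shows "(\<lambda>x. p x * f x) absolutely_integrable_on K"
proof -
  obtain B where B: "\<forall>x\<in>K. \<bar>p x\<bar> \<le> B" using K p by (rule bounded_on_compact)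
  have i: "integrable lebesgue (\<lambda>x. indicator K x *\<^sub>R f x)"
    using f by (simp add: set_integrable_def)
  have m: "p \<in> borel_measurable lebesgue"
    using p by (intro measurable_completion) (simp add: borel_measurable_continuous_onI)
  have "integrable lebesgue (\<lambda>x. p x * (indicator K x *\<^sub>R f x))"
  proof (rule Bochner_Integration.integrable_bound[OF integrable_mult_right[OF i, of B]])
    show "(\<lambda>x. p x * (indicator K x *\<^sub>R f x)) \<in> borel_measurable lebesgue"
      by (intro borel_measurable_times borel_measurable_integrable[OF i] m)
    show "AE x in lebesgue. norm (p x * (indicator K x *\<^sub>R f x)) \<le> norm (B * indicator K x *\<^sub>R f x)"
    proof (intro AE_I2)
      fix x
      have "\<bar>p x\<bar> \<le> \<bar>B\<bar>" if "x \<in> K" using B that by fastforce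
      then show "norm (p x * (indicator K x *\<^sub>R f x)) \<le> norm (B * indicator K x *\<^sub>R f x)"
        by (auto simp: indicator_def abs_mult intro: mult_right_mono)
    qed
  qed
  then show ?thesis
    unfolding set_integrable_def by (simp add: mult.left_commute)
qed

lemma integrable_times_compact_support:
  fixes f \<phi> :: "real^2 \<Rightarrow> real"
  assumes "f absolutely_integrable_on K" "compact K" "continuous_on UNIV \<phi>"
    and 0: "\<And>x. x \<notin> K \<Longrightarrow> \<phi> x = 0"
  shows "integrable lebesgue (\<lambda>x. f x * \<phi> x)"
proof -
  have "(\<lambda>x. indicator K x *\<^sub>R (\<phi> x * f x)) = (\<lambda>x. f x * \<phi> x)"
  proof
    show "indicator K x *\<^sub>R (\<phi> x * f x) = f x * \<phi> x" for x
      by (cases "x \<in> K") (simp_all add: 0)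
  qed
  with absolutely_integrable_mult_continuous[OF assms(1-3)] show ?thesis
    by (simp only: set_integrable_def)
qed

lemma test_integrable:
  fixes f :: "real^2 \<Rightarrow> real"
  assumes "E \<in> sets lebesgue" "locally_integrable (interior E) f" "test_function (interior E) \<phi>"
  shows "integrable (lebesgue_on E) (\<lambda>x. f x * \<phi> x)"
proof -
  obtain K where K: "smooth \<phi>" "compact K" "K \<subseteq> interior E" "\<forall>x. x \<notin> K \<longrightarrow> \<phi> x = 0"
    using assms(3) by (rule test_functionE)
  have "integrable lebesgue (\<lambda>x. f x * \<phi> x)"
    using assms(2) K
    by (intro integrable_times_compact_support[where K = K]) (auto simp: locally_integrable_def smooth_continuous_on)
  moreover have "\<phi> x = 0" if "x \<notin> E" for x using K(3,4) interior_subset that by blast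
  ultimately show ?thesis using assms(1) by (subst integral_on_eq_integral) auto
qed

lemma locally_integrable_component:
  "locally_integrable U g \<Longrightarrow> locally_integrable U (\<lambda>x. g x $ i)" for g :: "real^2 \<Rightarrow> real^2"
  unfolding locally_integrable_def
  by (metis (no_types, lifting) absolutely_integrable_component cart_eq_inner_axis
      set_integrable_cong)

lemma locally_integrable_vec:
  fixes g :: "real^2 \<Rightarrow> real^2"
  assumes "\<And>i. locally_integrable U (\<lambda>x. g x $ i)"
  shows "locally_integrable U g"
  unfolding locally_integrable_def
proof (intro allI impI)
  fix K assume "compact K \<and> K \<subseteq> U"
  then have c: "(\<lambda>x. g x $ i) absolutely_integrable_on K" for i
    using assms by (auto simp: locally_integrable_def)
  show "g absolutely_integrable_on K"
  proof (rule absolutely_integrable_componentwise)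
    fix b :: "real^2" assume "b \<in> Basis"
    then obtain i where "b = axis i 1" by (auto simp: Basis_vec_def)
    then show "(\<lambda>x. g x \<bullet> b) absolutely_integrable_on K"
      using c[of i] by (simp only: inner_axis inner_real_def mult_1_right)
  qed
qed

lemma locally_integrable_add:
  "locally_integrable U f \<Longrightarrow> locally_integrable U g \<Longrightarrow> locally_integrable U (\<lambda>x. f x + g x)"
  unfolding locally_integrable_def by (auto intro: set_integral_add(1))

lemma locally_integrable_cmult:
  fixes f :: "real^2 \<Rightarrow> real"
  shows "locally_integrable U f \<Longrightarrow> locally_integrable U (\<lambda>x. c * f x)"
  unfolding locally_integrable_def by auto

lemma locally_integrable_continuous:
  fixes f :: "real^2 \<Rightarrow> real"
  assumes "continuous_on U f"
  shows "locally_integrable U f"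
  unfolding locally_integrable_def
proof (intro allI impI)
  fix K assume K: "compact K \<and> K \<subseteq> U"
  then have "integrable lborel (\<lambda>x. indicator K x *\<^sub>R f x)"
    using assms continuous_on_subset by (intro borel_integrable_compact) auto
  then show "f absolutely_integrable_on K"
    unfolding set_integrable_def by (intro integrable_completion[THEN iffD2]) (auto intro: borel_measurable_integrable)
qed

lemma locally_integrable_mult_continuous:
  fixes f p :: "real^2 \<Rightarrow> real"
  assumes "locally_integrable U f" "continuous_on UNIV p"
  shows "locally_integrable U (\<lambda>x. p x * f x)"
  using assms absolutely_integrable_mult_continuous unfolding locally_integrable_def by blast

section \<open>The fundamental lemma of the calculus of variations\<close>

lemma flat_one: "flat 1 t = (if t > 0 then exp (-1/t) else 0)"
  by (simp add: flat_def)

lemma flat_one_tendsto: "t > 0 \<Longrightarrow> (\<lambda>n. flat 1 (real (Suc n) * t)) \<longlonglongrightarrow> 1"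
proof -
  assume t: "t > 0"
  have "(\<lambda>n. exp (- inverse (real (Suc n)) * (1/t))) \<longlonglongrightarrow> exp (- 0 * (1/t))"
    by (intro tendsto_intros LIMSEQ_inverse_real_of_nat)
  moreover have "exp (- inverse (real (Suc n)) * (1/t)) = flat 1 (real (Suc n) * t)" for n
    using t by (simp add: flat_one inverse_eq_divide mult_ac)
  ultimately show ?thesis by simp
qed

lemma flat_one_bounds: "0 \<le> flat 1 t" "flat 1 t \<le> 1"
  by (auto simp: flat_one)

lemma flat_one_eq_0_iff: "flat 1 t = 0 \<longleftrightarrow> t \<le> 0"
  by (auto simp: flat_one)

text \<open>Since \<open>flat 1 (n t)\<close> is the \<open>n\<close>-th root of \<open>flat 1 t\<close>, these smooth functions
  increase to the indicator of the open box. The factor is \<open>Suc n\<close> so that it never vanishes.\<close>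

definition box_bump :: "real^2 \<Rightarrow> real^2 \<Rightarrow> nat \<Rightarrow> real^2 \<Rightarrow> real" where
  "box_bump a b n x = (\<Prod>i\<in>UNIV. flat 1 (real (Suc n) * (x$i - a$i)) * flat 1 (real (Suc n) * (b$i - x$i)))"

lemma mem_box_2: "x \<in> box a b \<longleftrightarrow> (\<forall>i. a$i < x$i \<and> x$i < b$i)" for x :: "real^2"
  by (simp add: mem_box_cart)

lemma box_bump_smooth: "smooth (box_bump a b n)"
proof -
  have l: "smooth (\<lambda>x::real^2. real (Suc n) * (x$i - a$i))" "smooth (\<lambda>x::real^2. real (Suc n) * (b$i - x$i))" for i
    by (intro smooth_cmult smooth_diff smooth_component smooth_const)+
  show ?thesis
    unfolding box_bump_def[abs_def] UNIV_2 by (simp del: of_nat_Suc) (intro smooth_mult smooth_flat l)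
qed

lemma box_bump_outside: "x \<notin> box a b \<Longrightarrow> box_bump a b n x = 0"
  by (auto simp: box_bump_def mem_box_2 flat_one_eq_0_iff mult_le_0_iff not_less simp del: of_nat_Suc)

lemma box_bump_bounds: "0 \<le> box_bump a b n x" "box_bump a b n x \<le> 1"
  unfolding box_bump_def using flat_one_bounds
  by (auto intro!: prod_nonneg prod_le_1 mult_le_one simp del: of_nat_Suc)

lemma box_bump_tendsto: "(\<lambda>n. box_bump a b n x) \<longlonglongrightarrow> indicator (box a b) x"
proof (cases "x \<in> box a b")
  case True
  have "(\<lambda>n. box_bump a b n x) \<longlonglongrightarrow> (\<Prod>i\<in>(UNIV::2 set). 1 * 1)"
    unfolding box_bump_def
    using True by (intro tendsto_intros flat_one_tendsto) (auto simp: mem_box_2)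
  then show ?thesis using True by simp
qed (simp add: box_bump_outside)

lemma box_bump_test_function:
  assumes "cbox a b \<subseteq> U"
  shows "test_function U (box_bump a b n)"
  using assms box_subset_cbox
  by (intro test_functionI[of _ "cbox a b"] box_bump_smooth box_bump_outside) auto

lemma integral_box_eq_0:
  fixes g :: "real^2 \<Rightarrow> real"
  assumes E: "E \<in> sets lebesgue" and g: "locally_integrable (interior E) g"
    and 0: "\<And>\<phi>. test_function (interior E) \<phi> \<Longrightarrow> (LINT x|lebesgue_on E. g x * \<phi> x) = 0"
    and ab: "cbox a b \<subseteq> interior E"
  shows "(LINT x|lebesgue. indicator (box a b) x * g x) = 0"
proof -
  let ?\<phi> = "box_bump a b"
  have t: "test_function (interior E) (?\<phi> n)" for n by (rule box_bump_test_function[OF ab])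
  have out: "?\<phi> n x = 0" if "x \<notin> E" for n x
    using test_function_outside[OF t] interior_subset that by blast
  have gi: "integrable lebesgue (\<lambda>x. indicator (cbox a b) x *\<^sub>R g x)"
    using g ab by (auto simp: locally_integrable_def set_integrable_def)
  have i: "integrable lebesgue (\<lambda>x. g x * ?\<phi> n x)" for n
    using test_integrable[OF E g t] integral_on_eq_integral(2)[OF E] out by simp
  have "(\<lambda>n. LINT x|lebesgue. g x * ?\<phi> n x) \<longlonglongrightarrow> (LINT x|lebesgue. indicator (box a b) x * g x)"
  proof (rule integral_dominated_convergence[where w = "\<lambda>x. norm (indicator (cbox a b) x *\<^sub>R g x)"])
    have "set_integrable lebesgue (box a b) g"
      by (rule set_integrable_subset[of _ "cbox a b"])
         (use gi box_subset_cbox in \<open>auto simp: set_integrable_def\<close>)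
    then show "(\<lambda>x. indicator (box a b) x * g x) \<in> borel_measurable lebesgue"
      unfolding set_integrable_def real_scaleR_def by (rule borel_measurable_integrable)
    show "AE x in lebesgue. (\<lambda>n. g x * ?\<phi> n x) \<longlonglongrightarrow> indicator (box a b) x * g x"
      by (intro AE_I2) (subst mult.commute, intro tendsto_intros box_bump_tendsto)
    show "AE x in lebesgue. norm (g x * ?\<phi> n x) \<le> norm (indicator (cbox a b) x *\<^sub>R g x)" for n
    proof (intro AE_I2)
      fix x
      show "norm (g x * ?\<phi> n x) \<le> norm (indicator (cbox a b) x *\<^sub>R g x)"
      proof (cases "x \<in> cbox a b")
        case True
        have "\<bar>g x\<bar> * \<bar>?\<phi> n x\<bar> \<le> \<bar>g x\<bar> * 1"
          using box_bump_bounds[of a b n x] by (intro mult_left_mono) auto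
        then show ?thesis using True by (simp add: abs_mult)
      next
        case False
        then have "x \<notin> box a b" using box_subset_cbox by blast
        then show ?thesis by (simp add: box_bump_outside)
      qed
    qed
  qed (use gi i in \<open>auto intro: borel_measurable_integrable integrable_norm\<close>)
  moreover have "(LINT x|lebesgue. g x * ?\<phi> n x) = 0" for n
    using 0[OF t] integral_on_eq_integral(1)[OF E, of "\<lambda>x. g x * ?\<phi> n x"] out by simp
  ultimately show ?thesis by (simp add: LIMSEQ_const_iff)
qed

text \<open>The Borel sets over which \<open>g\<close>, cut off to the box, integrates to zero form a Dynkin system
  containing all open boxes, which are stable under intersection; hence they are all the Borel sets.
  Integrating over the sets where \<open>g\<close> is positive or negative then leaves only null sets.\<close>

lemma AE_box_eq_0:
  fixes g :: "real^2 \<Rightarrow> real"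
  assumes g: "g absolutely_integrable_on cbox c d"
    and 0: "\<And>a b. cbox a b \<subseteq> cbox c d \<Longrightarrow> (LINT x|lebesgue. indicator (box a b) x * g x) = 0"
  shows "AE x in lebesgue. x \<in> cbox c d \<longrightarrow> g x = 0"
proof -
  define f where "f x = indicator (box c d) x *\<^sub>R g x" for x
  have f: "integrable lebesgue f"
  proof -
    have "set_integrable lebesgue (box c d) g"
      by (rule set_integrable_subset[OF g]) (use box_subset_cbox in auto)
    then show ?thesis by (simp add: set_integrable_def f_def[abs_def])
  qed
  have f0: "(LINT x|lebesgue. f x) = 0"
    using 0[of c d] by (simp add: f_def)
  let ?G = "range (\<lambda>(a, b). box a b :: (real^2) set)"
  have P: "set_lebesgue_integral lebesgue A f = 0" if "A \<in> sets borel" for A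
  proof -
    have sets_borel: "sets (borel :: (real^2) measure) = sigma_sets UNIV ?G"
      unfolding borel_eq_box by (rule sets_measure_of) simp
    have box_Int: "\<exists>u v. box a b \<inter> box a' b' = box u v" for a b a' b' :: "real^2"
      unfolding box_Int_box by (intro exI) (rule refl)
    have "Int_stable ?G"
    proof (rule Int_stableI)
      fix X Y assume "X \<in> ?G" "Y \<in> ?G"
      then obtain a b a' b' where "X = box a b" "Y = box a' b'" by auto
      then show "X \<inter> Y \<in> ?G" using box_Int[of a b a' b'] by auto
    qed
    moreover have "?G \<subseteq> Pow UNIV" by simp
    moreover have "A \<in> sigma_sets UNIV ?G" using that sets_borel by simp
    ultimately show ?thesis
    proof (induction rule: sigma_sets_induct_disjoint)
      case (basic A)
      then obtain a b where A: "A = box a b" by auto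
      have ie: "(\<lambda>x. indicator A x *\<^sub>R f x) = (\<lambda>x. indicator (A \<inter> box c d) x * g x)"
        by (rule ext) (simp add: f_def split: split_indicator)
      obtain a' b' where ab: "A \<inter> box c d = box a' b'"
        using box_Int[of a b c d] A by auto
      show ?case
      proof (cases "box a' b' = {}")
        case True
        then show ?thesis unfolding set_lebesgue_integral_def ie ab by simp
      next
        case False
        have "cbox a' b' \<subseteq> cbox c d"
          using closure_mono[of "box a' b'" "box c d"] ab False
          by (metis Int_lower2 box_eq_empty(1) closure_box inf_bot_right)
        then show ?thesis unfolding set_lebesgue_integral_def ie ab by (rule 0)
      qed
    next
      case empty
      show ?case by (simp add: set_lebesgue_integral_def)
    next
      case (compl A)
      then have A: "A \<in> sets lebesgue"
        by (simp add: sets_borel[symmetric])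
      have "(\<lambda>x. indicator (UNIV - A) x *\<^sub>R f x) = (\<lambda>x. f x - indicator A x *\<^sub>R f x)"
        by (rule ext) (simp split: split_indicator)
      then show ?case
        using compl f f0 A integrable_mult_indicator[OF A f]
        by (simp add: set_lebesgue_integral_def)
    next
      case (union A)
      then have A: "A i \<in> sets lebesgue" for i
        using sets_borel by (auto simp: range_subsetD)
      have "set_lebesgue_integral lebesgue (\<Union>i. A i) f = (\<Sum>i. set_lebesgue_integral lebesgue (A i) f)"
      proof (rule lebesgue_integral_countable_add)
        show "set_integrable lebesgue (\<Union>i. A i) f"
          unfolding set_integrable_def using A f by (intro integrable_mult_indicator) auto
      qed (use A union in \<open>auto simp: disjoint_family_on_def\<close>)
      then show ?case using union by simp
    qed
  qed
  have Z: "set_lebesgue_integral lebesgue A f = 0" if A: "A \<in> sets lebesgue" for A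
  proof -
    obtain S N N' where S: "A = S \<union> N" "N \<subseteq> N'" "N' \<in> null_sets lborel" "S \<in> sets lborel"
      using A by (rule sets_completionE)
    have "AE x in lebesgue. x \<notin> N'"
      using S(3) by (intro AE_not_in null_sets_completionI)
    then have "AE x in lebesgue. indicator A x *\<^sub>R f x = indicator S x *\<^sub>R f x"
      by eventually_elim (use S(1,2) in \<open>auto split: split_indicator\<close>)
    then have "set_lebesgue_integral lebesgue A f = set_lebesgue_integral lebesgue S f"
      unfolding set_lebesgue_integral_def
      using A S(4) f
      by (intro integral_cong_AE borel_measurable_integrable integrable_mult_indicator) auto
    then show ?thesis using P S(4) by simp
  qed
  have m: "f \<in> borel_measurable lebesgue" using f by (rule borel_measurable_integrable)
  have pos: "{x. f x > 0} \<in> sets lebesgue" and neg: "{x. f x < 0} \<in> sets lebesgue"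
    using borel_measurable_pred_less[OF borel_measurable_const m, of 0]
      borel_measurable_pred_less[OF m borel_measurable_const, of 0]
    by (simp_all add: pred_def)
  have "AE x in lebesgue. indicator {x. f x > 0} x *\<^sub>R f x = 0"
    using Z[OF pos] integral_nonneg_eq_0_iff_AE[OF integrable_mult_indicator[OF pos f]]
    by (auto simp: set_lebesgue_integral_def indicator_def)
  moreover have "AE x in lebesgue. - (indicator {x. f x < 0} x *\<^sub>R f x) = 0"
    using Z[OF neg] integral_nonneg_eq_0_iff_AE[OF integrable_minus[OF integrable_mult_indicator[OF neg f]]]
    by (auto simp: set_lebesgue_integral_def indicator_def)
  ultimately have "AE x in lebesgue. f x = 0"
  proof eventually_elim
    case (elim x)
    then show "f x = 0" by (cases "f x" "0::real" rule: linorder_cases) auto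
  qed
  moreover have "AE x in lebesgue. x \<notin> cbox c d - box c d"
    using negligible_frontier_interval[of c d] unfolding negligible_iff_null_sets by (rule AE_not_in)
  ultimately show ?thesis
  proof eventually_elim
    case (elim x)
    show "x \<in> cbox c d \<longrightarrow> g x = 0"
    proof
      assume "x \<in> cbox c d"
      then have "x \<in> box c d" using elim(2) by blast
      then show "g x = 0" using elim(1) unfolding f_def by simp
    qed
  qed
qed

text \<open>Testing with the smooth approximations of indicators shows that \<open>g\<close> integrates to zero over every
  box inside \<open>E\<close>, and countably many boxes cover the interior. This makes weak gradients and weak
  curls unique up to null sets.\<close>

lemma fundamental_lemma:
  fixes g :: "real^2 \<Rightarrow> real"
  assumes E: "E \<in> sets lebesgue" "negligible (E - interior E)"
    and g: "locally_integrable (interior E) g"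
    and 0: "\<And>\<phi>. test_function (interior E) \<phi> \<Longrightarrow> (LINT x|lebesgue_on E. g x * \<phi> x) = 0"
  shows "AE x in lebesgue_on E. g x = 0"
proof -
  obtain \<D> where D: "countable \<D>" "\<D> \<subseteq> Pow (interior E)" "\<forall>X\<in>\<D>. \<exists>a b. X = cbox a b" "\<Union>\<D> = interior E"
    by (rule open_countable_Union_open_cbox[OF open_interior[of E]], erule that) auto
  have "AE x in lebesgue. \<forall>X\<in>\<D>. x \<in> X \<longrightarrow> g x = 0"
  proof (intro AE_ball_countable'[OF _ D(1)])
    fix X assume X: "X \<in> \<D>"
    then obtain c d where cd0: "X = cbox c d" using D(3) by blast
    have "X \<subseteq> interior E" using X D(2) by auto
    with cd0 have cd: "X = cbox c d" "cbox c d \<subseteq> interior E" by auto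
    show "AE x in lebesgue. x \<in> X \<longrightarrow> g x = 0"
      unfolding cd(1)
    proof (rule AE_box_eq_0)
      show "g absolutely_integrable_on cbox c d"
        using g cd(2) by (auto simp: locally_integrable_def)
      show "(LINT x|lebesgue. indicator (box a b) x * g x) = 0" if "cbox a b \<subseteq> cbox c d" for a b
        using that cd(2) by (intro integral_box_eq_0[OF E(1) g 0]) auto
    qed
  qed
  moreover have "AE x in lebesgue. x \<notin> E - interior E"
    using E(2) unfolding negligible_iff_null_sets by (rule AE_not_in)
  ultimately have "AE x in lebesgue. x \<in> E \<longrightarrow> g x = 0"
    by eventually_elim (use D(4) in auto)
  then show ?thesis using E(1) by (simp add: AE_restrict_space_iff)
qed

section \<open>Integration by parts\<close>

lemma integral_lborel_translation:
  fixes h :: "real^2 \<Rightarrow> real"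
  assumes "h \<in> borel_measurable borel"
  shows "(LINT x|lborel. h (x + v)) = (LINT x|lborel. h x)"
    and "integrable lborel (\<lambda>x. h (x + v)) \<longleftrightarrow> integrable lborel h"
proof -
  have m: "(+) v \<in> lborel \<rightarrow>\<^sub>M borel" by simp
  show "(LINT x|lborel. h (x + v)) = (LINT x|lborel. h x)"
    using integral_distr[OF m assms] unfolding lborel_distr_plus by (simp add: add.commute)
  show "integrable lborel (\<lambda>x. h (x + v)) \<longleftrightarrow> integrable lborel h"
    using integrable_distr_eq[OF m assms] unfolding lborel_distr_plus by (simp add: add.commute)
qed

lemma integrable_lborel_compact_support:
  fixes h :: "real^2 \<Rightarrow> real"
  assumes "compact K" "continuous_on K h" "\<And>x. x \<notin> K \<Longrightarrow> h x = 0"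
  shows "integrable lborel h"
proof -
  have "(\<lambda>x. indicator K x *\<^sub>R h x) = h"
  proof
    show "indicator K x *\<^sub>R h x = h x" for x
      by (cases "x \<in> K") (use assms(3)[of x] in simp_all)
  qed
  with borel_integrable_compact[OF assms(1,2)] show ?thesis by simp
qed

text \<open>Translation invariance makes the integral of every difference quotient vanish. The quotients are
  bounded by the maximum of the derivative and supported in a fixed compact set, so dominated
  convergence transfers this to the derivative.\<close>

lemma integral_directional_derivative_eq_0:
  fixes h :: "real^2 \<Rightarrow> real"
  assumes D: "\<And>x. (h has_derivative D x) (at x)"
    and c: "continuous_on UNIV (\<lambda>x. D x e)"
    and K: "compact K" "\<And>x. x \<notin> K \<Longrightarrow> h x = 0"
  shows "(LINT x|lebesgue. D x e) = 0"
proof -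
  define t where "t n = inverse (real (Suc n))" for n
  have t: "0 < t n" "t n \<le> 1" for n by (auto simp: t_def field_simps)
  define q where "q n x = (h (x + t n *\<^sub>R e) - h x) / t n" for n x
  have ch: "continuous_on UNIV h"
    using D by (meson continuous_at_imp_continuous_on has_derivative_continuous)
  have mh: "h \<in> borel_measurable borel" using ch by (rule borel_measurable_continuous_onI)
  have ih: "integrable lborel h"
    using K continuous_on_subset[OF ch subset_UNIV] by (intro integrable_lborel_compact_support)
  have D0: "D x e = 0" if "x \<notin> K" for x
  proof -
    have "(h has_derivative (\<lambda>_. 0)) (at x)"
      by (rule has_derivative_transform_within_open[of "\<lambda>_. 0" _ _ _ "- K"])
         (use K that compact_imp_closed in auto)
    then show ?thesis using has_derivative_unique[OF D] by metis
  qed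
  have line: "((\<lambda>s. h (x + s *\<^sub>R e)) has_real_derivative D (x + s *\<^sub>R e) e) (at s)" for x s
  proof -
    have "((\<lambda>s. h (x + s *\<^sub>R e)) has_derivative (\<lambda>u. D (x + s *\<^sub>R e) (u *\<^sub>R e))) (at s)"
      by (rule has_derivative_compose[OF _ D]) (auto intro!: derivative_eq_intros)
    moreover have "D y (u *\<^sub>R e) = D y e * u" for y u
      using linear_cmul[OF has_derivative_linear[OF D[of y]]] by simp
    ultimately show ?thesis by (simp add: has_field_derivative_def mult_commute_abs)
  qed
  \<comment> \<open>The derivative vanishes off \<open>K\<close>, so a bound on \<open>K\<close> is a global one.\<close>
  obtain B where B: "\<forall>x\<in>K. \<bar>D x e\<bar> \<le> B" using K(1) c by (rule bounded_on_compact)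
  have B': "\<bar>D x e\<bar> \<le> \<bar>B\<bar>" for x
    by (cases "x \<in> K") (use B D0[of x] in \<open>auto intro: order_trans\<close>)
  \<comment> \<open>Contains the supports of all difference quotients with step at most 1.\<close>
  define K' where "K' = (\<lambda>(x, s). x + s *\<^sub>R e) ` (K \<times> {-1..1})"
  have "compact K'"
    unfolding K'_def using K(1)
    by (intro compact_continuous_image compact_Times) (auto intro!: continuous_intros simp: case_prod_unfold)
  have outside: "x + s *\<^sub>R e \<notin> K" if "x \<notin> K'" "0 \<le> s" "s \<le> 1" for x s
  proof
    assume "x + s *\<^sub>R e \<in> K"
    then have "(x + s *\<^sub>R e, - s) \<in> K \<times> {-1..1}" using that by auto
    from imageI[OF this, of "\<lambda>(x, s). x + s *\<^sub>R e"]
    have "x + s *\<^sub>R e + (- s) *\<^sub>R e \<in> K'" unfolding K'_def by (simp only: case_prod_conv)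
    then show False using that by simp
  qed
  have q_bound: "\<bar>q n x\<bar> \<le> \<bar>B\<bar> * indicator K' x" for n x
  proof (cases "x \<in> K'")
    case True
    obtain s where "0 < s" "s < t n" "h (x + t n *\<^sub>R e) - h (x + 0 *\<^sub>R e) = (t n - 0) * D (x + s *\<^sub>R e) e"
      using MVT2[of 0 "t n" "\<lambda>s. h (x + s *\<^sub>R e)" "\<lambda>s. D (x + s *\<^sub>R e) e"] line t[of n] by blast
    then have "q n x = D (x + s *\<^sub>R e) e" using t[of n] by (simp add: q_def)
    then show ?thesis using True B' by simp
  next
    case False
    have "h (x + t n *\<^sub>R e) = 0" "h x = 0"
      using outside[OF False, of "t n"] outside[OF False, of 0] t[of n] K(2) by auto
    then show ?thesis by (simp add: q_def)
  qed
  have q_lim: "(\<lambda>n. q n x) \<longlonglongrightarrow> D x e" for x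
  proof -
    have "((\<lambda>s. (h (x + s *\<^sub>R e) - h x) / s) \<longlongrightarrow> D x e) (at 0)"
      using line[of x 0] by (simp add: DERIV_def)
    moreover have "filterlim t (at 0) sequentially"
      unfolding filterlim_at t_def using LIMSEQ_inverse_real_of_nat by simp
    ultimately show ?thesis
      unfolding q_def by (rule filterlim_compose)
  qed
  have q_int: "(LINT x|lborel. q n x) = 0" for n
  proof -
    have "(LINT x|lborel. q n x) = ((LINT x|lborel. h (x + t n *\<^sub>R e)) - (LINT x|lborel. h x)) / t n"
      unfolding q_def using ih integral_lborel_translation(2)[OF mh] by simp
    then show ?thesis using integral_lborel_translation(1)[OF mh] by simp
  qed
  have "(\<lambda>n. LINT x|lborel. q n x) \<longlonglongrightarrow> (LINT x|lborel. D x e)"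
  proof (rule integral_dominated_convergence[where w = "\<lambda>x. \<bar>B\<bar> * indicator K' x"])
    show "(\<lambda>x. D x e) \<in> borel_measurable lborel"
      using borel_measurable_continuous_onI[OF c] by simp
    have "continuous_on UNIV (q n)" for n
      unfolding q_def using t[of n]
      by (intro continuous_intros continuous_on_compose2[OF ch]) auto
    then show "q n \<in> borel_measurable lborel" for n
      using borel_measurable_continuous_onI[of "q n"] by simp
    show "integrable lborel (\<lambda>x. \<bar>B\<bar> * indicator K' x)"
      using \<open>compact K'\<close> emeasure_compact_finite[of K']
      by (intro integrable_mult_right) (simp add: compact_imp_closed borel_closed)
  qed (use q_lim q_bound in auto)
  then have "(LINT x|lborel. D x e) = 0"
    using q_int by (simp add: LIMSEQ_const_iff)
  then show ?thesis
    using borel_measurable_continuous_onI[OF c] by (simp add: integral_completion)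
qed

text \<open>The function \<open>f\<close> need only be differentiable inside \<open>E\<close>: its product with a test function, extended
  by zero, is continuously differentiable on the whole plane. This generality is what the mapped
  supplements require, whose derivatives are only controlled in the interior.\<close>

lemma integration_by_parts:
  assumes E: "E \<in> sets lebesgue" and \<phi>: "test_function (interior E) \<phi>"
    and D: "\<And>x. x \<in> interior E \<Longrightarrow> (f has_derivative D x) (at x)"
    and c: "continuous_on (interior E) (\<lambda>x. D x (axis i 1))"
  shows "(LINT x|lebesgue_on E. f x * partial i \<phi> x) = - (LINT x|lebesgue_on E. D x (axis i 1) * \<phi> x)"
proof -
  let ?U = "interior E"
  obtain K where K: "smooth \<phi>" "compact K" "K \<subseteq> ?U" "\<forall>x. x \<notin> K \<longrightarrow> \<phi> x = 0"
    using \<phi> by (rule test_functionE)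
  have K0: "closed K" using K(2) by (rule compact_imp_closed)
  have p0: "partial j \<phi> x = 0" if "x \<notin> K" for x j
    by (rule partial_zero_outside[OF K0]) (use K(4) that in auto)
  define h where "h x = (if x \<in> ?U then f x * \<phi> x else 0)" for x
  define D' where "D' x = (if x \<in> ?U then (\<lambda>v. f x * (v$1 * partial 1 \<phi> x + v$2 * partial 2 \<phi> x) + D x v * \<phi> x)
    else (\<lambda>v. 0))" for x
  have cf: "continuous_on ?U f"
    using D by (meson continuous_at_imp_continuous_on has_derivative_continuous)
  have hD: "(h has_derivative D' x) (at x)" for x
  proof (cases "x \<in> ?U")
    case True
    have "((\<lambda>x. f x * \<phi> x) has_derivative D' x) (at x)"
      unfolding D'_def using True
        has_derivative_mult[OF D[OF True] has_derivative_partial[OF smooth_differentiable[OF K(1)]]]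
      by simp
    then show ?thesis
      by (rule has_derivative_transform_within_open[of _ _ _ _ ?U]) (use True in \<open>auto simp: h_def\<close>)
  next
    case False
    have "(h has_derivative (\<lambda>_. 0)) (at x)"
      by (rule has_derivative_transform_within_open[of "\<lambda>_. 0" _ _ _ "- K"])
         (use False K K0 in \<open>auto simp: h_def\<close>)
    then show ?thesis using False by (simp add: D'_def)
  qed
  have D'e: "D' x (axis i 1) = (if x \<in> ?U then f x * partial i \<phi> x + D x (axis i 1) * \<phi> x else 0)" for x
    using exhaust_2[of i] by (auto simp: D'_def axis_def)
  have cD: "continuous_on UNIV (\<lambda>x. D' x (axis i 1))"
  proof -
    have "continuous_on ?U (\<lambda>x. D' x (axis i 1))"
    proof (rule continuous_on_cong[THEN iffD2])
      show "continuous_on ?U (\<lambda>x. f x * partial i \<phi> x + D x (axis i 1) * \<phi> x)"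
        by (intro continuous_on_add continuous_on_mult cf c smooth_continuous_on smooth_partial K(1))
    qed (simp_all add: D'e)
    moreover have "continuous_on (- K) (\<lambda>x. D' x (axis i 1))"
      by (rule continuous_on_cong[THEN iffD2, OF refl, of _ _ "\<lambda>x. 0"]) (use K(4) p0 in \<open>auto simp: D'e\<close>)
    ultimately have "continuous_on (?U \<union> - K) (\<lambda>x. D' x (axis i 1))"
      by (intro continuous_on_open_Un) (use K0 in auto)
    moreover have "?U \<union> - K = UNIV" using K(3) by blast
    ultimately show ?thesis by simp
  qed
  have h0: "h x = 0" if "x \<notin> K" for x using K(4) that by (simp add: h_def)
  have "(LINT x|lebesgue. D' x (axis i 1)) = 0"
    by (rule integral_directional_derivative_eq_0[OF hD cD K(2) h0])
  moreover have "(LINT x|lebesgue_on E. D' x (axis i 1)) = (LINT x|lebesgue. D' x (axis i 1))"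
    by (rule integral_on_eq_integral[OF E]) (use interior_subset in \<open>auto simp: D'e\<close>)
  moreover have "D' x (axis i 1) = f x * partial i \<phi> x + D x (axis i 1) * \<phi> x" for x
    by (cases "x \<in> K") (use p0[of x i] K(3,4) in \<open>auto simp: D'e\<close>)
  moreover have "integrable (lebesgue_on E) (\<lambda>x. f x * partial i \<phi> x)"
    by (intro test_integrable E locally_integrable_continuous cf test_function_partial \<phi>)
  moreover have "integrable (lebesgue_on E) (\<lambda>x. D x (axis i 1) * \<phi> x)"
    by (intro test_integrable E locally_integrable_continuous c \<phi>)
  ultimately show ?thesis by simp
qed

lemma weak_gradient_classical:
  assumes "E \<in> sets lebesgue"
    and "\<And>x. x \<in> interior E \<Longrightarrow> (f has_derivative D x) (at x)"
    and "\<And>i. continuous_on (interior E) (\<lambda>x. D x (axis i 1))"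
  shows "weak_gradient E f (\<lambda>x. \<chi> i. D x (axis i 1))"
proof -
  have "continuous_on (interior E) f"
    using assms(2) by (meson continuous_at_imp_continuous_on has_derivative_continuous)
  then show ?thesis
    unfolding weak_gradient_def
    using integration_by_parts[OF assms(1) _ assms(2,3)]
    by (auto intro!: locally_integrable_continuous locally_integrable_vec assms(3))
qed

lemma integration_by_parts_smooth:
  assumes "E \<in> sets lebesgue" "test_function (interior E) \<phi>" "smooth f"
  shows "(LINT x|lebesgue_on E. f x * partial i \<phi> x) = - (LINT x|lebesgue_on E. partial i f x * \<phi> x)"
proof -
  have "(\<lambda>x. frechet_derivative f (at x) (axis i 1)) = partial i f"
    by (simp add: partial_def[abs_def])
  with integration_by_parts[OF assms(1,2), of f "\<lambda>x. frechet_derivative f (at x)" i]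
  show ?thesis
    using smooth_differentiable[OF assms(3)] smooth_continuous_on[OF smooth_partial[OF assms(3)]]
    by (simp add: frechet_derivative_works partial_def)
qed

lemma weak_gradient_smooth:
  assumes "E \<in> sets lebesgue" "smooth f"
  shows "weak_gradient E f (\<lambda>x. \<chi> i. partial i f x)"
  unfolding weak_gradient_def
  using assms integration_by_parts_smooth[OF assms(1) _ assms(2)]
  by (auto intro!: locally_integrable_continuous locally_integrable_vec smooth_continuous_on smooth_partial)

lemma weak_curl_smooth:
  assumes E: "E \<in> sets lebesgue" and s: "\<And>i. smooth (\<lambda>x. \<psi> x $ i)"
  shows "weak_curl E \<psi> (\<lambda>x. partial 2 (\<lambda>x. \<psi> x $ 1) x - partial 1 (\<lambda>x. \<psi> x $ 2) x)"
  unfolding weak_curl_def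
proof (intro conjI allI impI)
  let ?w = "\<lambda>x. partial 2 (\<lambda>x. \<psi> x $ 1) x - partial 1 (\<lambda>x. \<psi> x $ 2) x"
  have li: "locally_integrable (interior E) f" if "smooth f" for f
    using that by (intro locally_integrable_continuous smooth_continuous_on)
  show "locally_integrable (interior E) \<psi>"
    by (intro locally_integrable_vec li s)
  show "locally_integrable (interior E) ?w"
    by (intro li smooth_diff smooth_partial s)
  fix \<phi> assume \<phi>: "test_function (interior E) \<phi>"
  let ?L = "LINT x|lebesgue_on E. \<psi> x $ 1 * partial 2 \<phi> x - \<psi> x $ 2 * partial 1 \<phi> x"
  note ti = test_integrable[OF E li]
  have "?L
      = (LINT x|lebesgue_on E. \<psi> x $ 1 * partial 2 \<phi> x) - (LINT x|lebesgue_on E. \<psi> x $ 2 * partial 1 \<phi> x)"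
    by (intro Bochner_Integration.integral_diff ti s test_function_partial \<phi>)
  also have "\<dots> = - ((LINT x|lebesgue_on E. partial 2 (\<lambda>x. \<psi> x $ 1) x * \<phi> x)
      - (LINT x|lebesgue_on E. partial 1 (\<lambda>x. \<psi> x $ 2) x * \<phi> x))"
    by (simp add: integration_by_parts_smooth[OF E \<phi> s])
  also have "\<dots> = - (LINT x|lebesgue_on E. ?w x * \<phi> x)"
    unfolding left_diff_distrib
    by (subst Bochner_Integration.integral_diff) (auto intro!: ti s \<phi> smooth_partial)
  finally show "?L = - (LINT x|lebesgue_on E. ?w x * \<phi> x)" .
qed

lemma weak_gradient_add:
  assumes E: "E \<in> sets lebesgue" and f: "weak_gradient E f g" and f': "weak_gradient E f' g'"
  shows "weak_gradient E (\<lambda>x. f x + f' x) (\<lambda>x. g x + g' x)"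
  unfolding weak_gradient_def
proof (intro conjI allI impI)
  note fg = f[unfolded weak_gradient_def] f'[unfolded weak_gradient_def]
  show "locally_integrable (interior E) (\<lambda>x. f x + f' x)" "locally_integrable (interior E) (\<lambda>x. g x + g' x)"
    using fg by (auto intro: locally_integrable_add)
  fix \<phi> i assume \<phi>: "test_function (interior E) \<phi>"
  have i: "integrable (lebesgue_on E) (\<lambda>x. f x * partial i \<phi> x)" "integrable (lebesgue_on E) (\<lambda>x. f' x * partial i \<phi> x)"
    "integrable (lebesgue_on E) (\<lambda>x. g x $ i * \<phi> x)" "integrable (lebesgue_on E) (\<lambda>x. g' x $ i * \<phi> x)"
    using fg by (auto intro!: test_integrable E locally_integrable_component \<phi> test_function_partial)
  show "(LINT x|lebesgue_on E. (f x + f' x) * partial i \<phi> x) = - (LINT x|lebesgue_on E. (g x + g' x) $ i * \<phi> x)"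
    using fg \<phi> i by (simp add: distrib_right)
qed

text \<open>The smooth factor is moved onto the test function, where the product rule is classical.\<close>

lemma weak_gradient_mult_smooth:
  assumes E: "E \<in> sets lebesgue" and f: "weak_gradient E f g" and p: "smooth p"
  shows "weak_gradient E (\<lambda>x. p x * f x) (\<lambda>x. p x *\<^sub>R g x + f x *\<^sub>R (\<chi> i. partial i p x))"
  unfolding weak_gradient_def
proof (intro conjI allI impI)
  note fg = f[unfolded weak_gradient_def]
  have cp: "continuous_on UNIV p" "continuous_on UNIV (partial i p)" for i
    by (intro smooth_continuous_on smooth_partial p)+
  show "locally_integrable (interior E) (\<lambda>x. p x * f x)"
    using fg cp by (intro locally_integrable_mult_continuous) auto
  have gi: "locally_integrable (interior E) (\<lambda>x. g x $ i)" for i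
    using fg by (intro locally_integrable_component) auto
  have fp: "locally_integrable (interior E) (\<lambda>x. partial i p x * f x)" for i
    using fg by (intro locally_integrable_mult_continuous cp) auto
  have "locally_integrable (interior E) (\<lambda>x. p x * g x $ i + partial i p x * f x)" for i
    by (intro locally_integrable_add locally_integrable_mult_continuous gi cp fp)
  then show "locally_integrable (interior E) (\<lambda>x. p x *\<^sub>R g x + f x *\<^sub>R (\<chi> i. partial i p x))"
    by (intro locally_integrable_vec) (simp add: mult.commute)
  fix \<phi> i assume \<phi>: "test_function (interior E) \<phi>"
  let ?L = "LINT x|lebesgue_on E. p x * f x * partial i \<phi> x"
  let ?A = "LINT x|lebesgue_on E. g x $ i * (p x * \<phi> x)"
  let ?B = "LINT x|lebesgue_on E. partial i p x * f x * \<phi> x"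
  let ?C = "LINT x|lebesgue_on E. f x * partial i (\<lambda>x. p x * \<phi> x) x"
  let ?R = "LINT x|lebesgue_on E. (p x *\<^sub>R g x + f x *\<^sub>R (\<chi> i. partial i p x)) $ i * \<phi> x"
  have p\<phi>: "test_function (interior E) (\<lambda>x. p x * \<phi> x)" by (rule test_function_mult[OF p \<phi>])
  have part: "partial i (\<lambda>x. p x * \<phi> x) x = partial i p x * \<phi> x + p x * partial i \<phi> x" for x
    by (intro partial_mult smooth_differentiable p test_function_smooth[OF \<phi>])
  have i1: "integrable (lebesgue_on E) (\<lambda>x. f x * partial i (\<lambda>x. p x * \<phi> x) x)"
    using fg by (intro test_integrable E test_function_partial p\<phi>) auto
  have i2: "integrable (lebesgue_on E) (\<lambda>x. partial i p x * f x * \<phi> x)"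
    by (intro test_integrable E fp \<phi>)
  have i3: "integrable (lebesgue_on E) (\<lambda>x. g x $ i * (p x * \<phi> x))"
    by (intro test_integrable E gi p\<phi>)
  have "?L
    = (LINT x|lebesgue_on E. f x * partial i (\<lambda>x. p x * \<phi> x) x - partial i p x * f x * \<phi> x)"
    unfolding part by (simp add: algebra_simps)
  also have "\<dots> = ?C - ?B"
    by (rule Bochner_Integration.integral_diff[OF i1 i2])
  also have "?C = - ?A"
    using fg p\<phi> by simp
  also have "- ?A - ?B
    = - (LINT x|lebesgue_on E. g x $ i * (p x * \<phi> x) + partial i p x * f x * \<phi> x)"
    using Bochner_Integration.integral_add[OF i3 i2] by simp
  also have "\<dots> = - ?R"
    by (simp add: algebra_simps)
  finally show "?L
    = - ?R" .
qed

text \<open>Moving both derivatives onto the test function leaves the commutator of its mixed partial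
  derivatives.\<close>

lemma weak_curl_gradient:
  assumes E: "E \<in> sets lebesgue" and f: "weak_gradient E f g"
  shows "weak_curl E g (\<lambda>_. 0)"
  unfolding weak_curl_def
proof (intro conjI allI impI)
  note fg = f[unfolded weak_gradient_def]
  show "locally_integrable (interior E) g" using fg by simp
  show "locally_integrable (interior E) (\<lambda>_. 0::real)" by (rule locally_integrable_continuous) simp
  fix \<phi> assume \<phi>: "test_function (interior E) \<phi>"
  have t: "test_function (interior E) (partial i \<phi>)" for i by (rule test_function_partial[OF \<phi>])
  have i: "integrable (lebesgue_on E) (\<lambda>x. g x $ i * partial j \<phi> x)" for i j
    using fg by (intro test_integrable E t locally_integrable_component) auto
  have "(LINT x|lebesgue_on E. g x $ 1 * partial 2 \<phi> x) = - (LINT x|lebesgue_on E. f x * partial 1 (partial 2 \<phi>) x)"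
    "(LINT x|lebesgue_on E. g x $ 2 * partial 1 \<phi> x) = - (LINT x|lebesgue_on E. f x * partial 2 (partial 1 \<phi>) x)"
    using fg t by auto
  moreover have "partial 1 (partial 2 \<phi>) = partial 2 (partial 1 \<phi>)"
    by (rule partial_commute[OF test_function_smooth[OF \<phi>]])
  ultimately show "(LINT x|lebesgue_on E. g x $ 1 * partial 2 \<phi> x - g x $ 2 * partial 1 \<phi> x) = - (LINT x|lebesgue_on E. 0 * \<phi> x)"
    using i by simp
qed

lemma weak_curl_add:
  assumes E: "E \<in> sets lebesgue" and f: "weak_curl E f g" and f': "weak_curl E f' g'"
  shows "weak_curl E (\<lambda>x. f x + f' x) (\<lambda>x. g x + g' x)"
  unfolding weak_curl_def
proof (intro conjI allI impI)
  note fg = f[unfolded weak_curl_def] f'[unfolded weak_curl_def]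
  show "locally_integrable (interior E) (\<lambda>x. f x + f' x)" "locally_integrable (interior E) (\<lambda>x. g x + g' x)"
    using fg by (auto intro: locally_integrable_add)
  fix \<phi> assume \<phi>: "test_function (interior E) \<phi>"
  let ?L = "LINT x|lebesgue_on E. (f x + f' x) $ 1 * partial 2 \<phi> x - (f x + f' x) $ 2 * partial 1 \<phi> x"
  let ?R = "LINT x|lebesgue_on E. (g x + g' x) * \<phi> x"
  have i: "integrable (lebesgue_on E) (\<lambda>x. f x $ i * partial j \<phi> x)" "integrable (lebesgue_on E) (\<lambda>x. f' x $ i * partial j \<phi> x)"
    "integrable (lebesgue_on E) (\<lambda>x. g x * \<phi> x)" "integrable (lebesgue_on E) (\<lambda>x. g' x * \<phi> x)" for i j
    using fg by (auto intro!: test_integrable E locally_integrable_component \<phi> test_function_partial)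
  have "?L
    = (LINT x|lebesgue_on E. (f x $ 1 * partial 2 \<phi> x - f x $ 2 * partial 1 \<phi> x)
        + (f' x $ 1 * partial 2 \<phi> x - f' x $ 2 * partial 1 \<phi> x))"
    by (simp add: algebra_simps)
  also have "\<dots> = (LINT x|lebesgue_on E. f x $ 1 * partial 2 \<phi> x - f x $ 2 * partial 1 \<phi> x)
        + (LINT x|lebesgue_on E. f' x $ 1 * partial 2 \<phi> x - f' x $ 2 * partial 1 \<phi> x)"
    using i by (intro Bochner_Integration.integral_add Bochner_Integration.integrable_diff)
  also have "\<dots> = - ?R"
  proof -
    have "?R = (LINT x|lebesgue_on E. g x * \<phi> x) + (LINT x|lebesgue_on E. g' x * \<phi> x)"
      using i by (simp add: distrib_right)
    then show ?thesis using fg \<phi> by (simp only: minus_add_distrib)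
  qed
  finally show "?L
    = - ?R" .
qed

section \<open>Functions with vanishing weak gradient\<close>

text \<open>A smooth monotone step, equal to zero for \<open>t \<le> 0\<close> and constant for \<open>t \<ge> 1\<close>. Composing
  \<open>exp(-1/t)\<close> with itself gives it in closed form, so that it and its derivative
  are smooth by the closure properties alone.\<close>

definition ramp :: "real \<Rightarrow> real" where
  "ramp t = flat 1 (flat 1 1 - flat 1 (1 - t))"

definition ramp' :: "real \<Rightarrow> real" where
  "ramp' t = flat [:0,0,1:] (flat 1 1 - flat 1 (1 - t)) * flat [:0,0,1:] (1 - t)"

definition bump :: "real \<Rightarrow> real" where
  "bump t = flat 1 t * flat 1 (1 - t)"

lemma flat_one_mono: "s \<le> t \<Longrightarrow> flat 1 s \<le> flat 1 t"
  by (auto simp: flat_one frac_le)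

lemma flat_one_strict_mono: "s < t \<Longrightarrow> 0 < t \<Longrightarrow> flat 1 s < flat 1 t"
  by (auto simp: flat_one frac_less2 intro!: divide_strict_left_mono)

lemma flat_sq_nonneg: "0 \<le> flat [:0,0,1:] t"
  by (simp add: flat_def)

lemma flat_sq_pos: "0 < t \<Longrightarrow> 0 < flat [:0,0,1:] t"
  by (simp add: flat_def)

lemma ramp_left: "t \<le> 0 \<Longrightarrow> ramp t = 0"
  using flat_one_mono[of 1 "1 - t"] by (simp add: ramp_def flat_one_eq_0_iff)

lemma ramp_right: "1 \<le> t \<Longrightarrow> ramp t = ramp 1"
  by (simp add: ramp_def flat_one)

lemma ramp'_left: "t \<le> 0 \<Longrightarrow> ramp' t = 0"
  using flat_one_mono[of 1 "1 - t"] by (simp add: ramp'_def flat_def)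

lemma ramp'_right: "1 \<le> t \<Longrightarrow> ramp' t = 0"
  by (simp add: ramp'_def flat_def)

lemma ramp'_nonneg: "0 \<le> ramp' t"
  by (simp add: ramp'_def flat_sq_nonneg)

lemma ramp'_pos: "0 < t \<Longrightarrow> t < 1 \<Longrightarrow> 0 < ramp' t"
  using flat_one_strict_mono[of "1 - t" 1] by (simp add: ramp'_def flat_sq_pos)

lemma bump_nonneg: "0 \<le> bump t"
  by (simp add: bump_def flat_one_bounds)

lemma bump_pos: "0 < t \<Longrightarrow> t < 1 \<Longrightarrow> 0 < bump t"
  by (simp add: bump_def flat_one)

lemma bump_outside: "t \<le> 0 \<or> 1 \<le> t \<Longrightarrow> bump t = 0"
  by (auto simp: bump_def flat_one)

lemma flat_one_derivative: "(flat 1 has_real_derivative flat [:0,0,1:] t) (at t)"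
  using flat_has_derivative[of 1 t] by simp

lemma ramp_derivative: "(ramp has_real_derivative ramp' t) (at t)"
proof -
  have "((\<lambda>t. flat 1 (1 - t)) has_real_derivative flat [:0,0,1:] (1 - t) * (- 1)) (at t)"
    by (rule DERIV_chain2[OF flat_one_derivative]) (auto intro!: derivative_eq_intros)
  then have "((\<lambda>t. flat 1 1 - flat 1 (1 - t)) has_real_derivative flat [:0,0,1:] (1 - t)) (at t)"
    by (auto intro!: derivative_eq_intros)
  from DERIV_chain2[OF flat_one_derivative this] show ?thesis
    by (simp add: ramp_def[abs_def] ramp'_def)
qed

lemma smooth_ramp: "smooth f \<Longrightarrow> smooth (\<lambda>x. ramp (f x))"
  unfolding ramp_def by (intro smooth_flat smooth_diff smooth_const)

lemma smooth_ramp': "smooth f \<Longrightarrow> smooth (\<lambda>x. ramp' (f x))"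
  unfolding ramp'_def by (intro smooth_mult smooth_flat smooth_diff smooth_const)

lemma smooth_bump: "smooth f \<Longrightarrow> smooth (\<lambda>x. bump (f x))"
  unfolding bump_def by (intro smooth_mult smooth_flat smooth_diff smooth_const)

lemma vec_nth_has_derivative: "((\<lambda>x::real^2. x $ i) has_derivative (\<lambda>h. h $ i)) (at x)"
  by (rule bounded_linear_imp_has_derivative[OF bounded_linear_vec_nth])

lemma component_has_derivative:
  assumes "(A has_real_derivative d) (at (x $ k))"
  shows "((\<lambda>x::real^2. A (x $ k)) has_derivative (\<lambda>v. d * v $ k)) (at x)"
  using has_derivative_compose[OF vec_nth_has_derivative, of A "(*) d"] assms
  by (simp add: has_field_derivative_def)

lemma bump_derivative: "(bump has_real_derivative
    flat 1 t * (flat [:0,0,1:] (1 - t) * (- 1)) + flat [:0,0,1:] t * flat 1 (1 - t)) (at t)"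
proof -
  have "((\<lambda>t. flat 1 (1 - t)) has_real_derivative flat [:0,0,1:] (1 - t) * (- 1)) (at t)"
    by (rule DERIV_chain2[OF flat_one_derivative]) (auto intro!: derivative_eq_intros)
  from DERIV_mult'[OF flat_one_derivative this] show ?thesis
    by (simp add: bump_def[abs_def])
qed

lemma smooth_affine_component: "smooth (\<lambda>x. (x $ k - c) / \<delta>)"
  using smooth_cmult[OF smooth_diff[OF smooth_component smooth_const[of c]], of "1/\<delta>" k] by simp

text \<open>Differences of two translated ramps are test functions whose derivative is a bump minus its
  translate. Vanishing of the weak gradient therefore means that \<open>f\<close> and its translate have the same
  integral against the bump; if \<open>f\<close> increased from \<open>y\<close> to the translated point, it would do so
  near \<open>y\<close>, and a bump concentrated there would see the difference.\<close>

lemma weak_gradient_0_no_increase: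
  assumes E: "E \<in> sets lebesgue" and f: "continuous_on (interior E) f"
    and g: "weak_gradient E f g" "AE x in lebesgue_on E. g x = 0"
    and uv: "cbox u v \<subseteq> interior E" "y \<in> box u v" "y + s *\<^sub>R axis i 1 \<in> box u v" "s > 0"
  shows "\<not> f y < f (y + s *\<^sub>R axis i 1)"
proof
  assume less: "f y < f (y + s *\<^sub>R axis i 1)"
  define e :: "real^2" where "e = axis i 1"
  obtain j where j: "i \<noteq> j" "\<forall>k. k = i \<or> k = j"
  proof (cases "i = 1")
    case True then show ?thesis using that[of 2] exhaust_2 by auto
  next
    case False then show ?thesis using that[of 1] exhaust_2 by auto
  qed
  have ei: "e $ i = 1" and ej: "e $ j = 0" using j by (auto simp: e_def axis_def)
  have yi: "u$i < y$i" "y$i + s < v$i" and yj: "u$j < y$j" "y$j < v$j"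
    using uv(2)[unfolded mem_box_2, rule_format, of i] uv(2)[unfolded mem_box_2, rule_format, of j]
      uv(3)[unfolded mem_box_2 e_def[symmetric], rule_format, of i] ei by auto
  have fc: "isCont f x" if "x \<in> interior E" for x
    using f that continuous_on_eq_continuous_at open_interior by blast
  have "y \<in> interior E" "y + s *\<^sub>R e \<in> interior E"
    using uv box_subset_cbox unfolding e_def by blast+
  then have "isCont (\<lambda>x. f (x + s *\<^sub>R e) - f x) y"
    by (intro continuous_intros isCont_o2[of y "\<lambda>x. x + s *\<^sub>R e" f] fc)
  then have "\<forall>\<^sub>F x in at y. 0 < f (x + s *\<^sub>R e) - f x"
    using less unfolding isCont_def e_def by (intro order_tendstoD) auto
  then obtain d where d: "d > 0" "\<forall>x. x \<noteq> y \<and> dist x y < d \<longrightarrow> 0 < f (x + s *\<^sub>R e) - f x"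
    unfolding eventually_at by auto
  have d': "0 < f (x + s *\<^sub>R e) - f x" if "dist x y < d" for x
    using d(2) less that by (cases "x = y") (auto simp: e_def)
  \<comment> \<open>Small enough for the bump to fit where the increment is positive and, with its translate, into the box.\<close>
  define \<delta> where "\<delta> = Min {d / 3, (v$i - y$i - s) / 2, (v$j - y$j) / 2}"
  have \<delta>: "\<delta> > 0" "2 * \<delta> < d" "y$i + s + \<delta> < v$i" "y$j + \<delta> < v$j"
    using d(1) yi yj by (auto simp: \<delta>_def min_def field_simps)
  define Q where "Q = {x :: real^2. (y$i < x$i \<and> x$i < y$i + \<delta>) \<and> (y$j < x$j \<and> x$j < y$j + \<delta>)}"
  have Q_near: "dist x y < d" if "x \<in> Q" for x
  proof -
    have "dist x y \<le> (\<Sum>k\<in>UNIV. \<bar>(x - y) $ k\<bar>)" unfolding dist_norm by (rule norm_le_l1_cart)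
    also have "\<dots> \<le> (\<Sum>k\<in>(UNIV :: 2 set). \<delta>)"
    proof (rule sum_mono)
      fix k :: 2
      show "\<bar>(x - y) $ k\<bar> \<le> \<delta>" using j(2)[rule_format, of k] that by (auto simp: Q_def)
    qed
    also have "\<dots> < d" using \<delta> by simp
    finally show ?thesis .
  qed
  define K where "K = {x :: real^2. (y$i \<le> x$i \<and> x$i \<le> y$i + s + \<delta>) \<and> (y$j \<le> x$j \<and> x$j \<le> y$j + \<delta>)}"
  have K_cbox: "K \<subseteq> cbox u v"
  proof
    fix x assume x: "x \<in> K"
    show "x \<in> cbox u v"
      unfolding mem_box_cart
    proof
      fix k show "u $ k \<le> x $ k \<and> x $ k \<le> v $ k"
        using j(2)[rule_format, of k] x \<delta> yi yj by (auto simp: K_def)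
    qed
  qed
  have "closed K"
    unfolding K_def by (intro closed_Collect_conj closed_Collect_le continuous_intros)
  then have "compact K"
    using K_cbox by (metis bounded_cbox bounded_subset compact_eq_bounded_closed)
  have K_int: "K \<subseteq> interior E" using K_cbox uv(1) by (rule order_trans)
  define \<psi> where "\<psi> x = ramp' ((x$i - y$i) / \<delta>) * bump ((x$j - y$j) / \<delta>)" for x :: "real^2"
  \<comment> \<open>The factor \<open>\<delta>\<close> cancels the inner derivative of the rescaled ramps.\<close>
  define A where "A t = \<delta> * (ramp ((t - y$i) / \<delta>) - ramp ((t - (y$i + s)) / \<delta>))" for t
  define \<phi> where "\<phi> x = A (x$i) * bump ((x$j - y$j) / \<delta>)" for x :: "real^2"
  have \<psi>_nonneg: "\<psi> x \<ge> 0" for x by (simp add: \<psi>_def ramp'_nonneg bump_nonneg)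
  have \<psi>_out: "\<psi> x = 0" if "x \<notin> Q" for x
  proof -
    have "(x$i - y$i) / \<delta> \<le> 0 \<or> 1 \<le> (x$i - y$i) / \<delta> \<or> (x$j - y$j) / \<delta> \<le> 0 \<or> 1 \<le> (x$j - y$j) / \<delta>"
      using that \<delta>(1) by (auto simp: Q_def field_simps)
    then show ?thesis using ramp'_left ramp'_right bump_outside by (auto simp: \<psi>_def)
  qed
  have \<psi>_pos: "\<psi> x > 0" if "x \<in> Q" for x
    using that \<delta>(1) by (auto simp: \<psi>_def Q_def intro!: mult_pos_pos ramp'_pos bump_pos)
  have \<psi>K: "\<psi> x = 0" "\<psi> (x - s *\<^sub>R e) = 0" if "x \<notin> K" for x
    using that uv(4) \<delta>(1) ei ej by (auto intro!: \<psi>_out simp: Q_def K_def)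
  have \<phi>K: "\<phi> x = 0" if out: "x \<notin> K" for x
  proof -
    consider "x$i < y$i" | "x$i > y$i + s + \<delta>" | "x$j < y$j" | "x$j > y$j + \<delta>"
      using out unfolding K_def by fastforce
    then show ?thesis
    proof cases
      case 1
      then have "A (x$i) = 0" using \<delta>(1) uv(4) by (simp add: A_def ramp_left divide_nonpos_pos)
      then show ?thesis by (simp add: \<phi>_def)
    next
      case 2
      then have "ramp ((x$i - y$i) / \<delta>) = ramp 1" "ramp ((x$i - (y$i + s)) / \<delta>) = ramp 1"
        using \<delta>(1) uv(4) by (auto intro!: ramp_right)
      then show ?thesis by (simp add: \<phi>_def A_def)
    qed (use \<delta>(1) in \<open>auto simp: \<phi>_def intro!: bump_outside divide_nonpos_pos\<close>)
  qed
  have s\<phi>: "smooth \<phi>"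
    unfolding \<phi>_def A_def
    by (intro smooth_mult smooth_const smooth_diff smooth_ramp smooth_bump smooth_affine_component)
  have s\<psi>: "smooth \<psi>"
    unfolding \<psi>_def by (intro smooth_mult smooth_ramp' smooth_bump smooth_affine_component)
  have t\<phi>: "test_function (interior E) \<phi>"
    using s\<phi> \<open>compact K\<close> K_int \<phi>K by (rule test_functionI)
  have part: "partial i \<phi> x = \<psi> x - \<psi> (x - s *\<^sub>R e)" for x
  proof -
    have r: "((\<lambda>t. ramp ((t - c) / \<delta>)) has_real_derivative ramp' ((t - c) / \<delta>) * (1 / \<delta>)) (at t)" for c t
      by (rule DERIV_chain2[OF ramp_derivative]) (use \<delta>(1) in \<open>auto intro!: derivative_eq_intros\<close>)
    have "(A has_real_derivative \<delta> * (ramp' ((t - y$i) / \<delta>) * (1 / \<delta>) - ramp' ((t - (y$i + s)) / \<delta>) * (1 / \<delta>))) (at t)" for t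
      unfolding A_def by (intro DERIV_cmult DERIV_diff r)
    then have "(A has_real_derivative ramp' ((x$i - y$i) / \<delta>) - ramp' ((x$i - (y$i + s)) / \<delta>)) (at (x$i))"
      using \<delta>(1) by (simp add: algebra_simps)
    note a = component_has_derivative[OF this]
    have "\<exists>b. ((\<lambda>t. bump ((t - y$j) / \<delta>)) has_real_derivative b * (1 / \<delta>)) (at (x$j))"
      by (rule exI, rule DERIV_chain2[OF bump_derivative]) (use \<delta>(1) in \<open>auto intro!: derivative_eq_intros\<close>)
    then obtain b where "((\<lambda>t. bump ((t - y$j) / \<delta>)) has_real_derivative b * (1 / \<delta>)) (at (x$j))" ..
    note b = component_has_derivative[OF this]
    have "partial i \<phi> x = A (x$i) * (b * (1 / \<delta>) * axis i 1 $ j)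
       + (ramp' ((x$i - y$i) / \<delta>) - ramp' ((x$i - (y$i + s)) / \<delta>)) * axis i 1 $ i * bump ((x$j - y$j) / \<delta>)"
      unfolding \<phi>_def by (rule partial_eq[OF has_derivative_mult[OF a b]])
    then show ?thesis
      using ei ej by (simp add: \<psi>_def e_def[symmetric] algebra_simps)
  qed
  define H where "H x = f x * \<psi> (x - s *\<^sub>R e)" for x
  have cf: "continuous_on K f" using f K_int by (rule continuous_on_subset)
  have c\<psi>: "continuous_on K (\<lambda>x. \<psi> (x - s *\<^sub>R e))"
    by (rule continuous_on_compose2[OF smooth_continuous_on[OF s\<psi>, of UNIV]]) (auto intro!: continuous_intros)
  have iH: "integrable lborel H"
    unfolding H_def using \<psi>K
    by (intro integrable_lborel_compact_support[OF \<open>compact K\<close>] continuous_on_mult cf c\<psi>) auto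
  have i\<psi>: "integrable lborel (\<lambda>x. f x * \<psi> x)"
    using \<psi>K
    by (intro integrable_lborel_compact_support[OF \<open>compact K\<close>] continuous_on_mult cf smooth_continuous_on s\<psi>) auto
  have mH: "H \<in> borel_measurable borel" using borel_measurable_integrable[OF iH] by simp
  have Hs: "H (x + s *\<^sub>R e) = f (x + s *\<^sub>R e) * \<psi> x" for x by (simp add: H_def)
  have "(LINT x|lebesgue_on E. f x * partial i \<phi> x) = - (LINT x|lebesgue_on E. g x $ i * \<phi> x)"
    using g(1) t\<phi> by (simp add: weak_gradient_def)
  also have "(LINT x|lebesgue_on E. g x $ i * \<phi> x) = 0"
    by (rule integral_eq_zero_AE) (use g(2) in eventually_elim, simp)
  finally have "0 = (LINT x|lebesgue_on E. f x * partial i \<phi> x)" by simp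
  also have "\<dots> = (LINT x|lebesgue. f x * partial i \<phi> x)"
  proof (rule integral_on_eq_integral(1)[OF E])
    fix x assume "x \<notin> E"
    then have "x \<notin> K" using K_int interior_subset by blast
    then show "f x * partial i \<phi> x = 0" using \<psi>K by (simp add: part)
  qed
  also have "\<dots> = (LINT x|lebesgue. f x * \<psi> x - H x)"
    by (simp add: part H_def right_diff_distrib)
  also have "\<dots> = (LINT x|lborel. f x * \<psi> x - H x)"
    using i\<psi> iH by (intro integral_completion) auto
  also have "\<dots> = (LINT x|lborel. f x * \<psi> x) - (LINT x|lborel. H x)"
    using i\<psi> iH by simp
  also have "(LINT x|lborel. H x) = (LINT x|lborel. H (x + s *\<^sub>R e))"
    using integral_lborel_translation(1)[OF mH] by simp
  finally have eq: "(LINT x|lborel. H (x + s *\<^sub>R e) - f x * \<psi> x) = 0"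
    using i\<psi> iH integral_lborel_translation(2)[OF mH, of "s *\<^sub>R e"] by simp
  have nonneg: "0 \<le> H (x + s *\<^sub>R e) - f x * \<psi> x" for x
  proof (cases "x \<in> Q")
    case True
    then show ?thesis
      using d'[OF Q_near] \<psi>_nonneg[of x] unfolding Hs left_diff_distrib[symmetric]
      by (intro mult_nonneg_nonneg) (auto intro: less_imp_le)
  qed (simp add: Hs \<psi>_out)
  have "AE x in lborel. H (x + s *\<^sub>R e) - f x * \<psi> x = 0"
    using eq nonneg i\<psi> iH integral_lborel_translation(2)[OF mH, of "s *\<^sub>R e"]
    by (subst integral_nonneg_eq_0_iff_AE[symmetric]) auto
  then have ae: "AE x in lborel. x \<notin> Q"
  proof eventually_elim
    case (elim x)
    show "x \<notin> Q"
    proof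
      assume "x \<in> Q"
      then have "0 < (f (x + s *\<^sub>R e) - f x) * \<psi> x"
        using d'[OF Q_near] \<psi>_pos by (intro mult_pos_pos) auto
      then show False using elim unfolding Hs left_diff_distrib by simp
    qed
  qed
  have "open Q"
    unfolding Q_def by (intro open_Collect_conj open_Collect_less continuous_intros)
  then have "Q \<in> null_sets lborel"
    using ae by (subst (asm) AE_iff_null) (auto simp: borel_open)
  then have "negligible Q"
    unfolding negligible_iff_null_sets by (rule null_sets_completionI)
  moreover have "(\<chi> k. y$k + \<delta> / 2) \<in> Q" using \<delta>(1) by (simp add: Q_def)
  ultimately show False using open_not_negligible \<open>open Q\<close> by blast
qed

section \<open>Classes of functions on a convex body\<close>

lemma partial_const: "partial i (\<lambda>x. c) x = 0"
  using partial_eq[OF has_derivative_const] by blast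

text \<open>Convexity makes the boundary negligible and \<open>E\<close> the closure of its interior, so that continuous
  functions on \<open>E\<close> are determined by their classes.\<close>

locale convex_body =
  fixes E :: "(real^2) set"
  assumes compact: "compact E" and convex: "convex E" and interior_nonempty: "interior E \<noteq> {}"
begin

lemma sets_lebesgue: "E \<in> sets lebesgue"
  using compact by (simp add: compact_imp_closed borel_closed)

lemma negligible_boundary: "negligible (E - interior E)"
  by (rule negligible_subset[OF negligible_convex_frontier[OF convex]])
     (use closure_subset in \<open>auto simp: frontier_def\<close>)

lemma closure_interior: "closure (interior E) = E"
  using convex_closure_interior[OF convex interior_nonempty] compact_imp_closed[OF compact] by simp

lemma AE_continuous_eq_0:
  fixes f :: "real^2 \<Rightarrow> real"
  assumes f: "continuous_on E f" and ae: "AE x in lebesgue_on E. f x = 0" and x: "x \<in> E"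
  shows "f x = 0"
proof -
  let ?N = "{x \<in> interior E. f x \<noteq> 0}"
  have "continuous_on (interior E) f" using f interior_subset by (rule continuous_on_subset)
  then have "open (interior E \<inter> f -` (- {0}))"
    by (intro continuous_open_preimage) auto
  moreover have "interior E \<inter> f -` (- {0}) = ?N" by auto
  ultimately have N: "open ?N" by simp
  have "AE x in lebesgue. x \<in> E \<longrightarrow> f x = 0"
    using ae sets_lebesgue by (simp add: AE_restrict_space_iff)
  then have "AE x in lebesgue. x \<notin> ?N"
    by eventually_elim (use interior_subset in blast)
  then have "?N \<in> null_sets lebesgue"
    using N by (subst (asm) AE_iff_null) (auto simp: borel_open)
  then have "negligible ?N" by (simp only: negligible_iff_null_sets)
  then have "?N = {}"
    using open_not_negligible[OF N] by argo
  then have "\<And>x. x \<in> interior E \<Longrightarrow> f x = 0" by blast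
  then show ?thesis
    using continuous_constant_on_closure[of "interior E" f 0 x] f x closure_interior by auto
qed

lemma AE_continuous_eq:
  fixes f g :: "real^2 \<Rightarrow> real"
  assumes "continuous_on E f" "continuous_on E g" "AE x in lebesgue_on E. f x = g x" "x \<in> E"
  shows "f x = g x"
proof -
  have "AE x in lebesgue_on E. f x - g x = 0" using assms(3) by eventually_elim simp
  from AE_continuous_eq_0[OF continuous_on_diff[OF assms(1,2)] this assms(4)] show ?thesis by simp
qed

lemma weak_gradient_0_step:
  assumes f: "continuous_on (interior E) f"
    and g: "weak_gradient E f g" "AE x in lebesgue_on E. g x = 0"
    and uv: "cbox u v \<subseteq> interior E" "y \<in> box u v" "y + s *\<^sub>R axis i 1 \<in> box u v"
  shows "f y = f (y + s *\<^sub>R axis i 1)"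
proof -
  have step: "f y = f (y + s *\<^sub>R axis i 1)"
    if y: "y \<in> box u v" "y + s *\<^sub>R axis i 1 \<in> box u v" and s: "s > 0" for y s
  proof -
    let ?g = "\<lambda>x. - 1 *\<^sub>R g x + f x *\<^sub>R (\<chi> i. partial i (\<lambda>x. - 1) x)"
    have m: "weak_gradient E (\<lambda>x. - 1 * f x) ?g"
      by (rule weak_gradient_mult_smooth[OF sets_lebesgue g(1) smooth_const])
    have "AE x in lebesgue_on E. ?g x = 0"
      using g(2) by eventually_elim (simp add: partial_const vec_eq_iff)
    with weak_gradient_0_no_increase[OF sets_lebesgue _ m this uv(1) y s] f
    have "\<not> - 1 * f y < - 1 * f (y + s *\<^sub>R axis i 1)"
      by (auto intro: continuous_intros)
    moreover have "\<not> f y < f (y + s *\<^sub>R axis i 1)"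
      by (rule weak_gradient_0_no_increase[OF sets_lebesgue f g uv(1) y s])
    ultimately show ?thesis by simp
  qed
  \<comment> \<open>A negative step is a positive one from the other end.\<close>
  consider "s > 0" | "s = 0" | "s < 0" by linarith
  then show ?thesis
  proof cases
    case 3
    then show ?thesis using step[of "y + s *\<^sub>R axis i 1" "- s"] uv by simp
  qed (use step uv in auto)
qed

text \<open>Inside a box any two points are joined by one horizontal and one vertical step, so \<open>f\<close> is locally
  constant on the connected interior.\<close>

lemma weak_gradient_0_constant:
  assumes f: "continuous_on E f"
    and g: "weak_gradient E f g" "AE x in lebesgue_on E. g x = 0"
  obtains c where "\<forall>x\<in>E. f x = c"
proof -
  have fi: "continuous_on (interior E) f" using f interior_subset by (rule continuous_on_subset)
  have loc: "\<forall>\<^sub>F q in at p within interior E. f p = f q" if p: "p \<in> interior E" for p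
  proof -
    obtain u v where uv: "cbox u v \<subseteq> interior E" "p \<in> box u v"
      by (rule open_contains_cbox[OF open_interior p], erule that)
    have "f p = f q" if q: "q \<in> box u v" for q
    proof -
      define r where "r = p + (q$1 - p$1) *\<^sub>R axis 1 1"
      have rq: "q = r + (q$2 - p$2) *\<^sub>R axis 2 1"
        by (simp add: r_def vec_eq_iff forall_2 axis_def)
      have r: "r \<in> box u v"
        using uv(2) q by (auto simp: r_def mem_box_2 forall_2 axis_def)
      have "f p = f r"
        using weak_gradient_0_step[OF fi g uv] r by (simp add: r_def)
      also have "f r = f q"
        using weak_gradient_0_step[OF fi g uv(1) r, of "q$2 - p$2" 2] rq q by simp
      finally show ?thesis .
    qed
    then show ?thesis
      unfolding eventually_at_topological using uv(2) by (intro exI[of _ "box u v"]) (auto intro: open_box)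
  qed
  obtain p where p: "p \<in> interior E" using interior_nonempty by blast
  define c where "c = f p"
  have ic: "f x = c" if "x \<in> interior E" for x
    unfolding c_def
    by (rule connected_local_const[OF convex_connected[OF convex_interior[OF convex]] that p])
       (use loc in blast)
  have "f x = c" if "x \<in> E" for x
    using continuous_constant_on_closure[of "interior E" f c x] f closure_interior ic that by simp
  then have "\<forall>x\<in>E. f x = c" by blast
  then show ?thesis by (rule that)
qed

lemma locally_integrable_cong_AE:
  assumes f: "locally_integrable (interior E) f" and ae: "AE x in lebesgue_on E. f' x = f x"
  shows "locally_integrable (interior E) f'"
  unfolding locally_integrable_def
proof (intro allI impI)
  fix K assume K: "compact K \<and> K \<subseteq> interior E"
  have "AE x in lebesgue. x \<in> E \<longrightarrow> f' x = f x"
    using ae sets_lebesgue by (simp add: AE_restrict_space_iff)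
  then obtain N where N: "N \<in> null_sets lebesgue" "{x \<in> space lebesgue. \<not> (x \<in> E \<longrightarrow> f' x = f x)} \<subseteq> N"
    unfolding eventually_ae_filter by blast
  have "negligible N" using N(1) by (simp add: negligible_iff_null_sets)
  moreover have "f' x = f x" if "x \<in> K - N" for x
    using N(2) that K interior_subset[of E] by auto
  moreover have "f absolutely_integrable_on K"
    using f K by (simp add: locally_integrable_def)
  ultimately show "f' absolutely_integrable_on K"
    using absolutely_integrable_spike by blast
qed

lemma integral_test_cong_AE:
  fixes f :: "real^2 \<Rightarrow> real"
  assumes f: "locally_integrable (interior E) f" and ae: "AE x in lebesgue_on E. f' x = f x"
    and \<phi>: "test_function (interior E) \<phi>"
  shows "(LINT x|lebesgue_on E. f' x * \<phi> x) = (LINT x|lebesgue_on E. f x * \<phi> x)"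
  using test_integrable[OF sets_lebesgue f \<phi>]
    test_integrable[OF sets_lebesgue locally_integrable_cong_AE[OF f ae] \<phi>] ae
  by (intro integral_cong_AE borel_measurable_integrable) (auto elim: eventually_mono)

lemma AE_component: "AE x in lebesgue_on E. f' x = f x \<Longrightarrow> AE x in lebesgue_on E. f' x $ i = f x $ i"
  for f :: "real^2 \<Rightarrow> real^2"
  by (auto elim: eventually_mono)

lemma weak_gradient_cong_AE:
  assumes f: "weak_gradient E f g"
    and ae: "AE x in lebesgue_on E. f' x = f x" "AE x in lebesgue_on E. g' x = g x"
  shows "weak_gradient E f' g'"
proof -
  have fg: "locally_integrable (interior E) f" "locally_integrable (interior E) g"
    "test_function (interior E) \<phi> \<Longrightarrow>
      (LINT x|lebesgue_on E. f x * partial i \<phi> x) = - (LINT x|lebesgue_on E. g x $ i * \<phi> x)" for \<phi> i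
    using f by (auto simp: weak_gradient_def)
  have "(LINT x|lebesgue_on E. f' x * partial i \<phi> x) = - (LINT x|lebesgue_on E. g' x $ i * \<phi> x)"
    if \<phi>: "test_function (interior E) \<phi>" for \<phi> i
    using integral_test_cong_AE[OF fg(1) ae(1) test_function_partial[OF \<phi>]] fg(3)[OF \<phi>]
      integral_test_cong_AE[OF locally_integrable_component[OF fg(2)] AE_component[OF ae(2)] \<phi>] by simp
  then show ?thesis
    using locally_integrable_cong_AE[OF fg(1) ae(1)] locally_integrable_cong_AE[OF fg(2) ae(2)]
    by (simp add: weak_gradient_def)
qed

lemma AE_eq_of_test_integrals:
  fixes g g' :: "real^2 \<Rightarrow> real"
  assumes g: "locally_integrable (interior E) g" "locally_integrable (interior E) g'"
    and eq: "\<And>\<phi>. test_function (interior E) \<phi> \<Longrightarrow>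
      (LINT x|lebesgue_on E. g x * \<phi> x) = (LINT x|lebesgue_on E. g' x * \<phi> x)"
  shows "AE x in lebesgue_on E. g x = g' x"
proof -
  have "AE x in lebesgue_on E. g x - g' x = 0"
  proof (rule fundamental_lemma[OF sets_lebesgue negligible_boundary])
    from locally_integrable_add[OF g(1) locally_integrable_cmult[OF g(2), of "-1"]]
    show "locally_integrable (interior E) (\<lambda>x. g x - g' x)" by simp
    fix \<phi> assume \<phi>: "test_function (interior E) \<phi>"
    show "(LINT x|lebesgue_on E. (g x - g' x) * \<phi> x) = 0"
      using eq[OF \<phi>] test_integrable[OF sets_lebesgue g(1) \<phi>] test_integrable[OF sets_lebesgue g(2) \<phi>]
      by (simp add: left_diff_distrib)
  qed
  then show ?thesis by eventually_elim simp
qed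

lemma weak_gradient_unique:
  assumes "weak_gradient E f g" "weak_gradient E f g'"
  shows "AE x in lebesgue_on E. g x = g' x"
proof -
  note fg = assms[unfolded weak_gradient_def]
  have "AE x in lebesgue_on E. g x $ i = g' x $ i" for i
  proof (rule AE_eq_of_test_integrals)
    show "locally_integrable (interior E) (\<lambda>x. g x $ i)" "locally_integrable (interior E) (\<lambda>x. g' x $ i)"
      using fg by (auto intro: locally_integrable_component)
    fix \<phi> assume "test_function (interior E) \<phi>"
    then have "(LINT x|lebesgue_on E. f x * partial i \<phi> x) = - (LINT x|lebesgue_on E. g x $ i * \<phi> x)"
      "(LINT x|lebesgue_on E. f x * partial i \<phi> x) = - (LINT x|lebesgue_on E. g' x $ i * \<phi> x)"
      using fg by auto
    then show "(LINT x|lebesgue_on E. g x $ i * \<phi> x) = (LINT x|lebesgue_on E. g' x $ i * \<phi> x)"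
      by linarith
  qed
  from this[of 1] this[of 2] show ?thesis
    by eventually_elim (simp add: vec_eq_iff forall_2)
qed

lemma weak_curl_cong_AE:
  assumes f: "weak_curl E f g"
    and ae: "AE x in lebesgue_on E. f' x = f x" "AE x in lebesgue_on E. g' x = g x"
  shows "weak_curl E f' g'"
proof -
  have fg: "locally_integrable (interior E) f" "locally_integrable (interior E) g"
    "test_function (interior E) \<phi> \<Longrightarrow>
      (LINT x|lebesgue_on E. f x $ 1 * partial 2 \<phi> x - f x $ 2 * partial 1 \<phi> x) = - (LINT x|lebesgue_on E. g x * \<phi> x)" for \<phi>
    using f by (auto simp: weak_curl_def)
  note f' = locally_integrable_cong_AE[OF fg(1) ae(1)]
  have "(LINT x|lebesgue_on E. f' x $ 1 * partial 2 \<phi> x - f' x $ 2 * partial 1 \<phi> x) = - (LINT x|lebesgue_on E. g' x * \<phi> x)"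
    if \<phi>: "test_function (interior E) \<phi>" for \<phi>
  proof -
    have i: "integrable (lebesgue_on E) (\<lambda>x. h x $ i * partial j \<phi> x)"
      if "locally_integrable (interior E) h" for h :: "real^2 \<Rightarrow> real^2" and i j
      by (intro test_integrable sets_lebesgue test_function_partial \<phi> locally_integrable_component that)
    have "(LINT x|lebesgue_on E. f' x $ 1 * partial 2 \<phi> x - f' x $ 2 * partial 1 \<phi> x)
      = (LINT x|lebesgue_on E. f x $ 1 * partial 2 \<phi> x - f x $ 2 * partial 1 \<phi> x)"
      using ae(1)
      by (intro integral_cong_AE borel_measurable_integrable Bochner_Integration.integrable_diff i f' fg(1))
         (auto elim: eventually_mono)
    then show ?thesis using fg(3)[OF \<phi>] integral_test_cong_AE[OF fg(2) ae(2) \<phi>] by simp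
  qed
  then show ?thesis
    using f' locally_integrable_cong_AE[OF fg(2) ae(2)]
    by (simp add: weak_curl_def)
qed

lemma weak_curl_unique:
  assumes "weak_curl E f g" "weak_curl E f g'"
  shows "AE x in lebesgue_on E. g x = g' x"
proof (rule AE_eq_of_test_integrals)
  note fg = assms[unfolded weak_curl_def]
  show "locally_integrable (interior E) g" "locally_integrable (interior E) g'"
    using fg by auto
  fix \<phi> assume \<phi>: "test_function (interior E) \<phi>"
  let ?I = "LINT x|lebesgue_on E. f x $ 1 * partial 2 \<phi> x - f x $ 2 * partial 1 \<phi> x"
  have "?I = - (LINT x|lebesgue_on E. g x * \<phi> x)" "?I = - (LINT x|lebesgue_on E. g' x * \<phi> x)"
    using fg \<phi> by blast+
  then show "(LINT x|lebesgue_on E. g x * \<phi> x) = (LINT x|lebesgue_on E. g' x * \<phi> x)"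
    by linarith
qed

lemma ae_class_eq_iff: "ae_class E f = ae_class E g \<longleftrightarrow> (AE x in lebesgue_on E. f x = g x)"
proof
  assume "ae_class E f = ae_class E g"
  moreover have "f \<in> ae_class E f" by (simp add: ae_class_def)
  ultimately show "AE x in lebesgue_on E. f x = g x" by (simp add: ae_class_def)
next
  assume ae: "AE x in lebesgue_on E. f x = g x"
  have "(AE x in lebesgue_on E. h x = f x) \<longleftrightarrow> (AE x in lebesgue_on E. h x = g x)" for h
  proof
    assume "AE x in lebesgue_on E. h x = f x"
    with ae show "AE x in lebesgue_on E. h x = g x" by eventually_elim simp
  next
    assume "AE x in lebesgue_on E. h x = g x"
    with ae show "AE x in lebesgue_on E. h x = f x" by eventually_elim simp
  qed
  then show "ae_class E f = ae_class E g" by (simp add: ae_class_def)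
qed

lemma class_add_ae_class:
  fixes f g :: "real^2 \<Rightarrow> 'b::ab_group_add"
  shows "class_add (ae_class E f) (ae_class E g) = ae_class E (\<lambda>x. f x + g x)"
proof (intro set_eqI iffI)
  fix h assume "h \<in> class_add (ae_class E f) (ae_class E g)"
  then obtain f' g' where h: "h = (\<lambda>x. f' x + g' x)" and
    ae: "AE x in lebesgue_on E. f' x = f x" "AE x in lebesgue_on E. g' x = g x"
    by (auto simp: class_add_def ae_class_def)
  from ae have "AE x in lebesgue_on E. h x = f x + g x" unfolding h by eventually_elim simp
  then show "h \<in> ae_class E (\<lambda>x. f x + g x)" by (simp add: ae_class_def)
next
  fix h assume "h \<in> ae_class E (\<lambda>x. f x + g x)"
  then have "AE x in lebesgue_on E. h x = f x + g x" by (simp add: ae_class_def)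
  then have "AE x in lebesgue_on E. h x - f x = g x" by eventually_elim simp
  then have "(\<lambda>x. h x - f x) \<in> ae_class E g" by (simp add: ae_class_def)
  moreover have "f \<in> ae_class E f" by (simp add: ae_class_def)
  moreover have "h = (\<lambda>x. f x + (h x - f x))" by simp
  ultimately show "h \<in> class_add (ae_class E f) (ae_class E g)"
    unfolding class_add_def by (intro CollectI exI[of _ f] exI[of _ "\<lambda>x. h x - f x"] conjI)
qed

text \<open>The weak gradient of a class is again a single class: uniqueness comes from the fundamental lemma.\<close>

lemma grad_ae_class:
  assumes "weak_gradient E f g"
  shows "grad E (ae_class E f) = ae_class E g"
proof (intro set_eqI iffI)
  fix h assume "h \<in> grad E (ae_class E f)"
  then obtain f' where f': "AE x in lebesgue_on E. f' x = f x" "weak_gradient E f' h"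
    by (auto simp: grad_def ae_class_def)
  have "weak_gradient E f h"
    by (rule weak_gradient_cong_AE[OF f'(2)]) (use f'(1) in \<open>auto elim: eventually_mono\<close>)
  from weak_gradient_unique[OF this assms] show "h \<in> ae_class E g" by (simp add: ae_class_def)
next
  fix h assume "h \<in> ae_class E g"
  then have "AE x in lebesgue_on E. h x = g x" by (simp add: ae_class_def)
  then have "weak_gradient E f h" by (intro weak_gradient_cong_AE[OF assms]) auto
  moreover have "f \<in> ae_class E f" by (simp add: ae_class_def)
  ultimately show "h \<in> grad E (ae_class E f)" unfolding grad_def by blast
qed

lemma curl_ae_class:
  assumes "weak_curl E f g"
  shows "curl E (ae_class E f) = ae_class E g"
proof (intro set_eqI iffI)
  fix h assume "h \<in> curl E (ae_class E f)"
  then obtain f' where f': "AE x in lebesgue_on E. f' x = f x" "weak_curl E f' h"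
    by (auto simp: curl_def ae_class_def)
  have "weak_curl E f h"
    by (rule weak_curl_cong_AE[OF f'(2)]) (use f'(1) in \<open>auto elim: eventually_mono\<close>)
  from weak_curl_unique[OF this assms] show "h \<in> ae_class E g" by (simp add: ae_class_def)
next
  fix h assume "h \<in> ae_class E g"
  then have "AE x in lebesgue_on E. h x = g x" by (simp add: ae_class_def)
  then have "weak_curl E f h" by (intro weak_curl_cong_AE[OF assms]) auto
  moreover have "f \<in> ae_class E f" by (simp add: ae_class_def)
  ultimately show "h \<in> curl E (ae_class E f)" unfolding curl_def by blast
qed

end

section \<open>Polynomials\<close>

definition peval :: "nat \<Rightarrow> (nat \<Rightarrow> nat \<Rightarrow> real) \<Rightarrow> real^2 \<Rightarrow> real" where
  "peval k q x = (\<Sum>(i, j)\<in>{(i, j). i + j \<le> k}. q i j * (x$1) ^ i * (x$2) ^ j)"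

lemma poly_fun_eq: "poly_fun k = range (peval k)"
  by (auto simp: poly_fun_def peval_def[abs_def])

lemma smooth_peval: "smooth (peval k q)"
  unfolding peval_def case_prod_unfold
  by (intro smooth_sum smooth_mult smooth_power smooth_component smooth_const)

text \<open>The restriction of a bivariate polynomial to a line, as a univariate polynomial. Its coefficient
  of degree \<open>k\<close> depends only on the direction of the line, which makes it possible to compare the
  restrictions to parallel lines.\<close>

definition line_poly :: "nat \<Rightarrow> (nat \<Rightarrow> nat \<Rightarrow> real) \<Rightarrow> real^2 \<Rightarrow> real^2 \<Rightarrow> real poly" where
  "line_poly k q x v = (\<Sum>(i, j)\<in>{(i, j). i + j \<le> k}. smult (q i j) ([:x$1, v$1:] ^ i * [:x$2, v$2:] ^ j))"

lemma poly_line_poly: "poly (line_poly k q x v) t = peval k q (x + t *\<^sub>R v)"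
  by (simp add: line_poly_def peval_def poly_sum case_prod_unfold mult.assoc)

lemma degree_line_power: "degree ([:a, b:] ^ i * [:c, d:] ^ j :: real poly) \<le> i + j"
  by (intro order_trans[OF degree_mult_le] add_mono order_trans[OF degree_power_le]) simp_all

lemma coeff_line_power: "coeff ([:a, b:] ^ i * [:c, d:] ^ j) (i + j) = b ^ i * (d ^ j :: real)"
proof -
  have deg: "coeff ([:a, b:] ^ i :: real poly) m = 0" if "m > i" for a b :: real and i m
    using order_le_less_trans[OF order_trans[OF degree_power_le, of "[:a, b:]" i i] that]
    by (intro coeff_eq_0) simp
  have "coeff ([:a, b:] ^ i * [:c, d:] ^ j) (i + j)
    = (\<Sum>m\<le>i + j. coeff ([:a, b:] ^ i) m * coeff ([:c, d:] ^ j) (i + j - m))"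
    by (rule coeff_mult)
  also have "\<dots> = (\<Sum>m\<in>{i}. coeff ([:a, b:] ^ i) m * coeff ([:c, d:] ^ j) (i + j - m))"
  proof (rule sum.mono_neutral_right)
    show "\<forall>m\<in>{..i + j} - {i}. coeff ([:a, b:] ^ i) m * coeff ([:c, d:] ^ j) (i + j - m) = 0"
    proof
      fix m assume "m \<in> {..i + j} - {i}"
      then consider "m > i" | "i + j - m > j" by force
      then show "coeff ([:a, b:] ^ i) m * coeff ([:c, d:] ^ j) (i + j - m) = 0"
        using deg by cases auto
    qed
  qed auto
  also have "\<dots> = b ^ i * d ^ j"
    by (simp add: coeff_linear_poly_power)
  finally show ?thesis .
qed

text \<open>The homogeneous part of degree \<open>k\<close>.\<close>

definition top_form :: "nat \<Rightarrow> (nat \<Rightarrow> nat \<Rightarrow> real) \<Rightarrow> real^2 \<Rightarrow> real" where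
  "top_form k q v = (\<Sum>(i, j)\<in>{(i, j). i + j \<le> k}. if i + j = k then q i j * (v$1) ^ i * (v$2) ^ j else 0)"

lemma coeff_line_poly: "coeff (line_poly k q x v) k = top_form k q v"
  unfolding line_poly_def top_form_def coeff_sum
proof (rule sum.cong[OF refl], clarify)
  fix i j assume ij: "i + j \<le> k"
  show "coeff (smult (q i j) ([:x$1, v$1:] ^ i * [:x$2, v$2:] ^ j)) k
    = (if i + j = k then q i j * v$1 ^ i * v$2 ^ j else 0)"
  proof (cases "i + j = k")
    case True
    then show ?thesis
      using coeff_line_power[of "x$1" "v$1" i "x$2" "v$2" j] by (simp add: mult.assoc)
  next
    case False
    then have "degree ([:x$1, v$1:] ^ i * [:x$2, v$2:] ^ j) < k"
      using ij degree_line_power[of "x$1" "v$1" i "x$2" "v$2" j] by linarith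
    then show ?thesis using False by (simp add: coeff_eq_0)
  qed
qed

lemma top_form_scale: "top_form k q (c *\<^sub>R v) = c ^ k * top_form k q v"
  unfolding top_form_def sum_distrib_left
  by (intro sum.cong refl) (auto simp: power_mult_distrib power_add mult_ac)

lemma poly_eq_of_interval:
  fixes P Q :: "real poly"
  assumes "a < b" "\<And>t. a < t \<Longrightarrow> t < b \<Longrightarrow> poly P t = poly Q t"
  shows "P = Q"
proof -
  have "infinite {a<..<b}" using assms(1) by simp
  moreover have "{a<..<b} \<subseteq> {t. poly (P - Q) t = 0}" using assms(2) by auto
  ultimately have "P - Q = 0" using poly_roots_finite finite_subset by blast
  then show ?thesis by simp
qed

lemma peval_eq_0_everywhere:
  assumes "open U" "U \<noteq> {}" "\<And>x. x \<in> U \<Longrightarrow> peval k q x = 0"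
  shows "peval k q y = 0"
proof -
  obtain x where x: "x \<in> U" using assms(2) by blast
  have "((\<lambda>t. x + t *\<^sub>R (y - x)) \<longlongrightarrow> x + 0 *\<^sub>R (y - x)) (at_right (0::real))"
    by (intro tendsto_intros)
  then have "\<forall>\<^sub>F t in at_right 0. x + t *\<^sub>R (y - x) \<in> U"
    using assms(1) x by (intro topological_tendstoD) auto
  then obtain b where b: "b > 0" "\<forall>t>0. t < b \<longrightarrow> x + t *\<^sub>R (y - x) \<in> U"
    unfolding eventually_at_right_field by auto
  have "line_poly k q x (y - x) = 0"
    by (rule poly_eq_of_interval[OF b(1)]) (use b(2) assms(3) in \<open>simp add: poly_line_poly\<close>)
  then show ?thesis using poly_line_poly[of k q x "y - x" 1] by simp
qed

lemma peval_scale: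
  "peval k q (t *\<^sub>R x) = (\<Sum>n\<le>k. (\<Sum>i\<le>n. q i (n - i) * (x$1) ^ i * (x$2) ^ (n - i)) * t ^ n)"
proof -
  have "peval k q (t *\<^sub>R x) = (\<Sum>n\<le>k. \<Sum>i\<le>n. q i (n - i) * ((t *\<^sub>R x)$1) ^ i * ((t *\<^sub>R x)$2) ^ (n - i))"
    unfolding peval_def by (rule sum.triangle_reindex_eq)
  also have "\<dots> = (\<Sum>n\<le>k. \<Sum>i\<le>n. q i (n - i) * (x$1) ^ i * (x$2) ^ (n - i) * t ^ n)"
    by (intro sum.cong refl) (auto simp: power_mult_distrib mult_ac power_add[symmetric])
  finally show ?thesis by (simp add: sum_distrib_right)
qed

text \<open>The coefficients of \<open>2 p + x \<bullet> \<nabla> p\<close>, the curl of \<open>p\<close> times \<open>(x\<^sub>2, - x\<^sub>1)\<close>: by Euler's identity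
  each homogeneous part of \<open>p\<close> is multiplied by two plus its degree.\<close>

definition curl_coeff :: "(nat \<Rightarrow> nat \<Rightarrow> real) \<Rightarrow> nat \<Rightarrow> nat \<Rightarrow> real" where
  "curl_coeff q i j = (2 + real i + real j) * q i j"

text \<open>Along the ray through \<open>x\<close> the homogeneous parts become the coefficients of a univariate
  polynomial, which can be compared one by one.\<close>

lemma curl_coeff_inj:
  assumes "\<And>x. peval k (curl_coeff q) x = 0"
  shows "peval k q x = 0"
proof -
  let ?c = "\<lambda>q n. \<Sum>i\<le>n. q i (n - i) * (x$1) ^ i * (x$2) ^ (n - i)"
  have cc: "?c (curl_coeff q) n = (2 + real n) * ?c q n" for n
    unfolding sum_distrib_left by (intro sum.cong refl) (simp add: curl_coeff_def of_nat_diff)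
  have "\<forall>t. (\<Sum>n\<le>k. ?c (curl_coeff q) n * t ^ n) = 0"
    using assms peval_scale[of k "curl_coeff q" _ x] by metis
  then have "\<forall>n\<le>k. ?c (curl_coeff q) n = 0"
    by (subst (asm) polyfun_eq_0)
  then have "\<forall>n\<le>k. ?c q n = 0" unfolding cc by auto
  then show ?thesis using peval_scale[of k q 1 x] by simp
qed

lemma curl_coeff_surj: "\<exists>q'. curl_coeff q' = q"
  by (intro exI[of _ "\<lambda>i j. q i j / (2 + real i + real j)"] ext)
     (simp add: curl_coeff_def add_eq_0_iff_both_eq_0)

definition rotated :: "(real^2 \<Rightarrow> real) \<Rightarrow> real^2 \<Rightarrow> real^2" where
  "rotated p x = p x *\<^sub>R vector [x$2, - x$1]"

lemma partialI_along:
  assumes "smooth f" "((\<lambda>t. f (x + t *\<^sub>R axis i 1)) has_real_derivative d) (at 0)"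
  shows "partial i f x = d"
  using has_derivative_along[OF assms(1), of x i 0] assms(2) DERIV_unique by fastforce

lemma shifted_power_derivative:
  "((\<lambda>t. (y + t) ^ Suc n) has_real_derivative (1 + real n) * y ^ n) (at 0)"
proof -
  have "((\<lambda>t. y + t) has_real_derivative 1) (at 0)" by (auto intro!: derivative_eq_intros)
  from DERIV_power_Suc[OF this, of n] show ?thesis by (simp del: power_Suc)
qed

lemma weak_curl_rotated:
  assumes E: "E \<in> sets lebesgue"
  shows "weak_curl E (rotated (peval k q)) (peval k (curl_coeff q))"
proof -
  let ?\<psi> = "rotated (peval k q)" and ?I = "{(i, j). i + j \<le> k}"
  have c1: "?\<psi> x $ 1 = peval k q x * x$2" and c2: "?\<psi> x $ 2 = peval k q x * - x$1" for x
    by (simp_all add: rotated_def)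
  have s: "smooth (\<lambda>x. ?\<psi> x $ i)" for i
    using exhaust_2[of i]
  proof
    assume "i = 1" then show ?thesis by (simp add: c1 smooth_mult smooth_peval smooth_component)
  next
    assume "i = 2" then show ?thesis
      unfolding c2 by (simp only: c2) (intro smooth_mult smooth_peval smooth_uminus smooth_component)
  qed
  have p1: "partial 2 (\<lambda>x. ?\<psi> x $ 1) x = (\<Sum>(i, j)\<in>?I. (1 + real j) * (q i j * (x$1) ^ i * (x$2) ^ j))" for x
  proof (rule partialI_along[OF s])
    have "((\<lambda>t. \<Sum>(i, j)\<in>?I. q i j * (x$1) ^ i * (x$2 + t) ^ Suc j) has_real_derivative
        (\<Sum>(i, j)\<in>?I. (1 + real j) * (q i j * (x$1) ^ i * (x$2) ^ j))) (at 0)"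
      unfolding case_prod_unfold
      by (intro DERIV_sum, rule DERIV_cong[OF DERIV_cmult[OF shifted_power_derivative]]) (simp add: mult_ac)
    moreover have "(\<lambda>t. ?\<psi> (x + t *\<^sub>R axis 2 1) $ 1) = (\<lambda>t. \<Sum>(i, j)\<in>?I. q i j * (x$1) ^ i * (x$2 + t) ^ Suc j)"
      unfolding c1 peval_def case_prod_unfold sum_distrib_right by (simp add: axis_def mult_ac)
    ultimately show "((\<lambda>t. ?\<psi> (x + t *\<^sub>R axis 2 1) $ 1) has_real_derivative
        (\<Sum>(i, j)\<in>?I. (1 + real j) * (q i j * (x$1) ^ i * (x$2) ^ j))) (at 0)" by simp
  qed
  have p2: "partial 1 (\<lambda>x. ?\<psi> x $ 2) x = (\<Sum>(i, j)\<in>?I. - (1 + real i) * (q i j * (x$1) ^ i * (x$2) ^ j))" for x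
  proof (rule partialI_along[OF s])
    have "((\<lambda>t. \<Sum>(i, j)\<in>?I. - q i j * (x$2) ^ j * (x$1 + t) ^ Suc i) has_real_derivative
        (\<Sum>(i, j)\<in>?I. - (1 + real i) * (q i j * (x$1) ^ i * (x$2) ^ j))) (at 0)"
      unfolding case_prod_unfold
      by (intro DERIV_sum, rule DERIV_cong[OF DERIV_cmult[OF shifted_power_derivative]]) (simp add: algebra_simps)
    moreover have "(\<lambda>t. ?\<psi> (x + t *\<^sub>R axis 1 1) $ 2) = (\<lambda>t. \<Sum>(i, j)\<in>?I. - q i j * (x$2) ^ j * (x$1 + t) ^ Suc i)"
      unfolding c2 peval_def case_prod_unfold sum_distrib_right
      by (intro ext sum.cong refl) (simp add: axis_def algebra_simps)
    ultimately show "((\<lambda>t. ?\<psi> (x + t *\<^sub>R axis 1 1) $ 2) has_real_derivative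
        (\<Sum>(i, j)\<in>?I. - (1 + real i) * (q i j * (x$1) ^ i * (x$2) ^ j))) (at 0)" by simp
  qed
  have "(\<lambda>x. partial 2 (\<lambda>x. ?\<psi> x $ 1) x - partial 1 (\<lambda>x. ?\<psi> x $ 2) x) = peval k (curl_coeff q)"
    unfolding p1 p2 peval_def curl_coeff_def sum_subtractf[symmetric] case_prod_unfold
    by (intro ext sum.cong refl) (simp add: algebra_simps)
  with weak_curl_smooth[OF E s] show ?thesis by simp
qed

section \<open>Exactness from continuous representatives\<close>

context convex_body
begin

lemma AE_peval_eq_0:
  assumes "AE x in lebesgue_on E. peval k q x = 0"
  shows "peval k q x = 0"
proof (rule peval_eq_0_everywhere[OF open_interior interior_nonempty])
  fix x assume "x \<in> interior E"
  then show "peval k q x = 0"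
    using AE_continuous_eq_0[OF smooth_continuous_on[OF smooth_peval] assms] interior_subset by blast
qed

text \<open>The curl annihilates the gradient part of \<open>V\<close> and
  maps the rotated polynomials of degree at most \<open>k\<close> bijectively onto the polynomials of degree
  at most \<open>k\<close>. This gives surjectivity, the kernel of the curl, and directness of the
  sum at once; continuity is used to conclude that a vanishing gradient leaves only constants.\<close>

lemma exact_of_regular_representatives:
  fixes D :: "(real^2 \<Rightarrow> real) set set" and k :: nat
  assumes D: "\<And>u. u \<in> D \<Longrightarrow> \<exists>f g. u = ae_class E f \<and> continuous_on E f \<and> weak_gradient E f g"
    and const: "range (const_class E) \<subseteq> D"
  defines "V \<equiv> space_sum (grad E ` D) (rot_poly_space E k)"
  shows "is_direct E (grad E ` D) (rot_poly_space E k)"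
    and "well_defined_sequence E D V (poly_space E k)"
    and "exact_sequence E D V (poly_space E k)"
proof -
  have gradD: "\<exists>g. grad E u = ae_class E g \<and> weak_curl E g (\<lambda>_. 0)" if "u \<in> D" for u
    using D[OF that] grad_ae_class weak_curl_gradient[OF sets_lebesgue] by blast
  have rot: "r \<in> rot_poly_space E k \<longleftrightarrow> (\<exists>q. r = ae_class E (rotated (peval k q)))" for r
    by (auto simp: rot_poly_space_def poly_fun_eq rotated_def[abs_def])
  have P: "w \<in> poly_space E k \<longleftrightarrow> (\<exists>q. w = ae_class E (peval k q))" for w
    by (auto simp: poly_space_def poly_fun_eq)
  have const_D: "ae_class E (\<lambda>_. t) \<in> D" for t
    using const by (auto simp: const_class_def)
  have grad_const: "grad E (ae_class E (\<lambda>_. t)) = zero_class E" for t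
    using grad_ae_class[OF weak_gradient_smooth[OF sets_lebesgue smooth_const]]
    by (simp add: partial_const zero_class_def zero_vec_def)
  have zero_grad: "zero_class E \<in> grad E ` D"
    using grad_const[of 0] const_D[of 0] by (metis imageI)
  have rotated_0: "rotated (peval k q) = (\<lambda>_. 0)" if "\<And>x. peval k q x = 0" for q
    using that by (auto simp: rotated_def)
  have zero_rot: "zero_class E \<in> rot_poly_space E k"
    unfolding rot zero_class_def
    by (intro exI[of _ "\<lambda>_ _. 0"]) (subst rotated_0, auto simp: peval_def)
  have V: "\<exists>g q. v = ae_class E (\<lambda>x. g x + rotated (peval k q) x) \<and> ae_class E g \<in> grad E ` D \<and>
      weak_curl E (\<lambda>x. g x + rotated (peval k q) x) (peval k (curl_coeff q)) \<and>
      curl E v = ae_class E (peval k (curl_coeff q))" if vV: "v \<in> V" for v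
  proof -
    obtain u q where u: "u \<in> D" and v: "v = class_add (grad E u) (ae_class E (rotated (peval k q)))"
    proof -
      obtain U W where UW: "v = class_add U W" "U \<in> grad E ` D" "W \<in> rot_poly_space E k"
        using vV unfolding V_def space_sum_def by auto
      from UW(2) obtain u where u: "U = grad E u" "u \<in> D" by (rule imageE)
      from UW(3) obtain q where "W = ae_class E (rotated (peval k q))" unfolding rot by (rule exE)
      then show ?thesis using that[OF u(2)] UW(1) u(1) by simp
    qed
    obtain g where g: "grad E u = ae_class E g" "weak_curl E g (\<lambda>_. 0)" using gradD[OF u] by blast
    have c: "weak_curl E (\<lambda>x. g x + rotated (peval k q) x) (peval k (curl_coeff q))"
      using weak_curl_add[OF sets_lebesgue g(2) weak_curl_rotated[OF sets_lebesgue, of k q]] by simp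
    have v': "v = ae_class E (\<lambda>x. g x + rotated (peval k q) x)" by (simp add: v g class_add_ae_class)
    have "ae_class E g \<in> grad E ` D" unfolding g(1)[symmetric] using u by (rule imageI)
    moreover have "curl E v = ae_class E (peval k (curl_coeff q))" unfolding v' by (rule curl_ae_class[OF c])
    ultimately show ?thesis using c v' by (intro exI conjI)
  qed
  have V_I: "ae_class E (\<lambda>x. g x + rotated (peval k q) x) \<in> V" if "ae_class E g \<in> grad E ` D" for g q
  proof -
    have "ae_class E (rotated (peval k q)) \<in> rot_poly_space E k" unfolding rot by (rule exI) (rule refl)
    then show ?thesis
      unfolding V_def space_sum_def class_add_ae_class[symmetric] using that
      by (intro CollectI exI conjI) (rule refl, assumption+)
  qed
  have ker: "peval k q x = 0" if "ae_class E (peval k (curl_coeff q)) = zero_class E" for q x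
    by (rule curl_coeff_inj, rule AE_peval_eq_0)
       (use that in \<open>simp only: zero_class_def ae_class_eq_iff\<close>)
  have gradV: "grad E ` D \<subseteq> V"
  proof
    fix c assume c: "c \<in> grad E ` D"
    then obtain g where g: "c = ae_class E g" using gradD by (elim imageE) blast
    have "rotated (peval k (\<lambda>_ _. 0)) = (\<lambda>_. 0)" by (rule rotated_0) (simp add: peval_def)
    then show "c \<in> V" using V_I[of g "\<lambda>_ _. 0"] c g by simp
  qed
  show "is_direct E (grad E ` D) (rot_poly_space E k)"
    unfolding is_direct_def
  proof (intro equalityI subsetI)
    fix c assume c: "c \<in> grad E ` D \<inter> rot_poly_space E k"
    then obtain g where g: "c = ae_class E g" "weak_curl E g (\<lambda>_. 0)" using gradD by blast
    have c0: "curl E c = zero_class E" unfolding g(1) zero_class_def by (rule curl_ae_class[OF g(2)])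
    from c have "c \<in> rot_poly_space E k" by simp
    then obtain q where q: "c = ae_class E (rotated (peval k q))" unfolding rot by (rule exE)
    then have "ae_class E (peval k (curl_coeff q)) = zero_class E"
      using c0 curl_ae_class[OF weak_curl_rotated[OF sets_lebesgue]] by simp
    from rotated_0[OF ker[OF this]] show "c \<in> {zero_class E}" by (simp add: q zero_class_def)
  qed (use zero_grad zero_rot in auto)
  show "well_defined_sequence E D V (poly_space E k)"
    unfolding well_defined_sequence_def
  proof (intro conjI const gradV)
    show "D \<subseteq> L1loc E"
    proof
      fix u assume "u \<in> D"
      from D[OF this] obtain f g where "u = ae_class E f" "weak_gradient E f g" by (elim exE conjE)
      then show "u \<in> L1loc E" unfolding L1loc_def by (auto simp: weak_gradient_def)
    qed
    show "V \<subseteq> L1loc E"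
    proof
      fix v assume "v \<in> V"
      from V[OF this] obtain f w where "v = ae_class E f" "weak_curl E f w" by (elim exE conjE)
      then show "v \<in> L1loc E" unfolding L1loc_def by (auto simp: weak_curl_def)
    qed
    show "poly_space E k \<subseteq> L1loc E"
    proof
      fix w assume "w \<in> poly_space E k"
      then obtain q where "w = ae_class E (peval k q)" unfolding P by (rule exE)
      moreover have "locally_integrable (interior E) (peval k q)"
        by (intro locally_integrable_continuous smooth_continuous_on smooth_peval)
      ultimately show "w \<in> L1loc E" unfolding L1loc_def by auto
    qed
    show "curl E ` V \<subseteq> poly_space E k"
      using V by (auto simp: P) metis
  qed
  show "exact_sequence E D V (poly_space E k)"
    unfolding exact_sequence_def
  proof (intro conjI)
    obtain p where p: "p \<in> E" using interior_nonempty interior_subset by blast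
    show "inj (const_class E)"
    proof (rule injI)
      fix s t assume "const_class E s = const_class E t"
      then show "s = t"
        unfolding const_class_def ae_class_eq_iff
        using AE_continuous_eq[OF continuous_on_const continuous_on_const _ p] by blast
    qed
    show "range (const_class E) = {u \<in> D. grad E u = zero_class E}"
    proof (intro equalityI subsetI)
      fix u assume "u \<in> range (const_class E)"
      then obtain t where "u = ae_class E (\<lambda>_. t)" unfolding const_class_def by (rule rangeE)
      then show "u \<in> {u \<in> D. grad E u = zero_class E}"
        using const_D[of t] grad_const[of t] by simp
    next
      fix u assume "u \<in> {u \<in> D. grad E u = zero_class E}"
      then have u: "u \<in> D" "grad E u = zero_class E" by auto
      from D[OF u(1)] obtain f g where fg: "u = ae_class E f" "continuous_on E f" "weak_gradient E f g"
        by (elim exE conjE)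
      have "AE x in lebesgue_on E. g x = 0"
        using u(2) grad_ae_class[OF fg(3)] by (simp add: fg(1) zero_class_def ae_class_eq_iff)
      with fg(2,3) obtain c where c: "\<forall>x\<in>E. f x = c"
        by (rule weak_gradient_0_constant)
      have "u = const_class E c"
        unfolding fg(1) const_class_def ae_class_eq_iff
        by (rule AE_I2) (use c in simp)
      then show "u \<in> range (const_class E)" by (rule range_eqI)
    qed
    show "grad E ` D = {v \<in> V. curl E v = zero_class E}"
    proof (intro equalityI subsetI)
      fix v assume v: "v \<in> grad E ` D"
      then obtain g where g: "v = ae_class E g" "weak_curl E g (\<lambda>_. 0)" using gradD by (elim imageE) blast
      have "curl E v = zero_class E" unfolding g(1) zero_class_def by (rule curl_ae_class[OF g(2)])
      then show "v \<in> {v \<in> V. curl E v = zero_class E}" using v gradV by blast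
    next
      fix v assume "v \<in> {v \<in> V. curl E v = zero_class E}"
      then have v: "v \<in> V" "curl E v = zero_class E" by auto
      from V[OF v(1)] obtain g q where gq: "v = ae_class E (\<lambda>x. g x + rotated (peval k q) x)" "ae_class E g \<in> grad E ` D"
        "curl E v = ae_class E (peval k (curl_coeff q))" by (elim exE conjE)
      from gq(3) v(2) have z: "ae_class E (peval k (curl_coeff q)) = zero_class E" by simp
      from rotated_0[OF ker[OF z]] show "v \<in> grad E ` D" using gq(1,2) by simp
    qed
    show "curl E ` V = poly_space E k"
    proof (intro equalityI subsetI)
      fix w assume "w \<in> curl E ` V"
      then show "w \<in> poly_space E k" using V by (auto simp: P) metis
    next
      fix w assume "w \<in> poly_space E k"
      then obtain q where w: "w = ae_class E (peval k q)" using P by blast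
      obtain q' where q': "curl_coeff q' = q" using curl_coeff_surj by blast
      have "ae_class E (\<lambda>x. 0 + rotated (peval k q') x) \<in> V"
        using V_I[of "\<lambda>_. 0" q'] zero_grad by (simp add: zero_class_def)
      moreover have "curl E (ae_class E (\<lambda>x. 0 + rotated (peval k q') x)) = w"
        using curl_ae_class[OF weak_curl_rotated[OF sets_lebesgue]] by (simp add: w q')
      ultimately show "w \<in> curl E ` V" by (metis imageI)
    qed
  qed
qed

end

section \<open>Orientation of a convex quadrilateral\<close>

text \<open>Twice the signed area of the triangle spanned by two vectors; orientation, parallelism and
  intersections of the edge lines are all expressed through it.\<close>

definition cross :: "real^2 \<Rightarrow> real^2 \<Rightarrow> real" where
  "cross v w = v$1 * w$2 - v$2 * w$1"

lemma cross_simps: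
  "cross (u + v) w = cross u w + cross v w" "cross u (v + w) = cross u v + cross u w"
  "cross (u - v) w = cross u w - cross v w" "cross u (v - w) = cross u v - cross u w"
  "cross (t *\<^sub>R u) w = t * cross u w" "cross u (t *\<^sub>R w) = t * cross u w" "cross u u = 0"
  by (simp_all add: cross_def algebra_simps)

lemma cross_commute: "cross v w = - cross w v"
  by (simp add: cross_def)

lemma cross_cramer: "cross v w *\<^sub>R e + cross w e *\<^sub>R v + cross e v *\<^sub>R w = 0"
  by (simp add: cross_def vec_eq_iff forall_2 algebra_simps)

lemma inner_2: "n \<bullet> x = n$1 * x$1 + n$2 * x$2" for n x :: "real^2"
  by (simp add: inner_vec_def sum_2)

text \<open>In the plane, two vectors orthogonal to a common nonzero vector are parallel.\<close>

lemma cross_eq_0_of_orthogonal: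
  assumes "n \<noteq> 0" "n \<bullet> v = 0" "n \<bullet> w = 0"
  shows "cross v w = 0"
proof -
  have "(n$1) * cross v w = 0" "(n$2) * cross v w = 0"
    using assms(2,3) unfolding inner_2 cross_def by algebra+
  moreover have "n$1 \<noteq> 0 \<or> n$2 \<noteq> 0" using assms(1) by (auto simp: vec_eq_iff forall_2)
  ultimately show ?thesis by auto
qed

text \<open>Faces of polytopes are exposed, so an edge is cut out by a supporting line; the cross product with
  the edge vector is proportional to the distance from that line.\<close>

lemma edge_sign:
  assumes "polytope E" and edge: "closed_segment p q edge_of E" and pq: "p \<noteq> q"
  obtains \<rho> where "\<rho> \<noteq> 0" "\<forall>x\<in>E. 0 \<le> \<rho> * cross (q - p) (x - p)"
    "\<forall>x\<in>E. x \<notin> closed_segment p q \<longrightarrow> 0 < \<rho> * cross (q - p) (x - p)"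
proof -
  let ?F = "closed_segment p q"
  have "?F exposed_face_of E"
    using assms by (simp add: exposed_face_of_polyhedron polytope_imp_polyhedron edge_of_def)
  then obtain n m where nm: "E \<subseteq> {x. n \<bullet> x \<le> m}" "?F = E \<inter> {x. n \<bullet> x = m}"
    unfolding exposed_face_of_def by blast
  have pm: "n \<bullet> p = m" "n \<bullet> q = m" using nm(2) ends_in_segment[of p q] by blast+
  define t where "t = cross n (q - p)"
  have nw: "n \<bullet> (q - p) = 0" using pm by (simp add: inner_diff_right)
  have key: "(n \<bullet> n) * cross (q - p) (x - p) = t * (m - n \<bullet> x)" for x
  proof -
    have "m - n \<bullet> x = - (n \<bullet> (x - p))" using pm by (simp add: inner_diff_right)
    moreover have "(n \<bullet> n) * cross w y = - (cross n w * (n \<bullet> y))" if "n \<bullet> w = 0" for w y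
      using that unfolding inner_2 cross_def by algebra
    ultimately show ?thesis using nw by (simp add: t_def)
  qed
  show ?thesis
  proof (cases "n = 0 \<or> t = 0")
    case False
    let ?\<rho> = "t * (n \<bullet> n)"
    have k: "?\<rho> * cross (q - p) (x - p) = t\<^sup>2 * (m - n \<bullet> x)" for x
      using key[of x] by (simp add: power2_eq_square mult.assoc)
    show ?thesis
    proof (rule that[of ?\<rho>])
      show "\<forall>x\<in>E. 0 \<le> ?\<rho> * cross (q - p) (x - p)" unfolding k using nm(1) by auto
      show "\<forall>x\<in>E. x \<notin> ?F \<longrightarrow> 0 < ?\<rho> * cross (q - p) (x - p)"
      proof (intro ballI impI)
        fix x assume "x \<in> E" "x \<notin> ?F"
        then have "n \<bullet> x < m" using nm by force
        then show "0 < ?\<rho> * cross (q - p) (x - p)" unfolding k using False by simp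
      qed
    qed (use False in auto)
  next
    case True
    have "n = 0"
    proof (rule ccontr)
      assume n: "n \<noteq> 0"
      then have "t = 0" using True by simp
      have "(n \<bullet> n) * (q - p)$1 = - (n$2) * t" "(n \<bullet> n) * (q - p)$2 = n$1 * t"
        using nw unfolding t_def cross_def inner_2 by algebra+
      moreover have "n \<bullet> n \<noteq> 0" using n by simp
      ultimately have "(q - p)$1 = 0" "(q - p)$2 = 0"
        using \<open>t = 0\<close> by (simp_all only: mult_zero_right mult_eq_0_iff simp_thms)
      then have "q - p = 0" by (simp only: vec_eq_iff forall_2 zero_index simp_thms)
      then show False using pq by simp
    qed
    then have "m = 0" using pm by simp
    then have EF: "E = ?F" using nm \<open>n = 0\<close> by auto
    have "cross (q - p) (x - p) = 0" if "x \<in> ?F" for x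
    proof -
      obtain u where "x = (1 - u) *\<^sub>R p + u *\<^sub>R q" using \<open>x \<in> ?F\<close> unfolding in_segment by blast
      then have "x - p = u *\<^sub>R (q - p)" by (simp add: algebra_simps)
      then show ?thesis by (simp only: cross_simps(6,7) mult_zero_right)
    qed
    then show ?thesis using EF by (intro that[of 1]) auto
  qed
qed

locale quadrilateral =
  fixes E :: "(real^2) set" and a b c d :: "real^2"
  assumes quad: "convex_quadrilateral E a b c d"
begin

lemma swap: "quadrilateral E a d c b"
  using quad unfolding quadrilateral_def convex_quadrilateral_def
  by (auto simp: closed_segment_commute insert_commute)

lemma polytope: "polytope E"
  using quad by (simp add: convex_quadrilateral_def)

lemma vertices: "a \<in> E" "b \<in> E" "c \<in> E" "d \<in> E"
  using quad unfolding convex_quadrilateral_def extreme_point_of_def by blast+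

lemma vertex_not_in_segment:
  assumes "z \<in> {a, b, c, d}" "p \<in> {a, b, c, d}" "q \<in> {a, b, c, d}" "z \<noteq> p" "z \<noteq> q"
  shows "z \<notin> closed_segment p q"
proof -
  have "z extreme_point_of E" "p \<in> E" "q \<in> E"
    using quad assms(1-3) vertices unfolding convex_quadrilateral_def by blast+
  then have "z \<notin> open_segment p q" unfolding extreme_point_of_def by blast
  then show ?thesis using assms(4,5) by (auto simp: open_segment_def)
qed

definition \<sigma> :: real where "\<sigma> = sgn (cross (b - a) (d - a))"

text \<open>Each edge has its own sign, but consecutive edges share a corner and hence a cross product, so
  that the four signs agree. The first four facts say that the corners are strictly convex, the other four
  that \<open>E\<close> lies on one side of each edge.\<close>

lemma orientation:
  "0 < \<sigma> * cross (b - a) (d - a)" "0 < \<sigma> * cross (b - a) (c - b)"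
  "0 < \<sigma> * cross (c - b) (d - c)" "0 < \<sigma> * cross (d - c) (a - d)"
  "x \<in> E \<Longrightarrow> 0 \<le> \<sigma> * cross (b - a) (x - a)" "x \<in> E \<Longrightarrow> 0 \<le> \<sigma> * cross (c - b) (x - b)"
  "x \<in> E \<Longrightarrow> 0 \<le> \<sigma> * cross (d - c) (x - c)" "x \<in> E \<Longrightarrow> 0 \<le> \<sigma> * cross (a - d) (x - d)"
proof -
  have dist: "a \<noteq> b" "b \<noteq> c" "c \<noteq> d" "d \<noteq> a" "a \<noteq> c" "b \<noteq> d"
    and edges: "closed_segment a b edge_of E" "closed_segment b c edge_of E"
      "closed_segment c d edge_of E" "closed_segment d a edge_of E"
    using quad by (auto simp: convex_quadrilateral_def)
  obtain \<rho>1 where r1: "\<rho>1 \<noteq> 0" "\<forall>x\<in>E. 0 \<le> \<rho>1 * cross (b - a) (x - a)"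
    "\<forall>x\<in>E. x \<notin> closed_segment a b \<longrightarrow> 0 < \<rho>1 * cross (b - a) (x - a)"
    by (rule edge_sign[OF polytope edges(1) dist(1)])
  obtain \<rho>2 where r2: "\<rho>2 \<noteq> 0" "\<forall>x\<in>E. 0 \<le> \<rho>2 * cross (c - b) (x - b)"
    "\<forall>x\<in>E. x \<notin> closed_segment b c \<longrightarrow> 0 < \<rho>2 * cross (c - b) (x - b)"
    by (rule edge_sign[OF polytope edges(2) dist(2)])
  obtain \<rho>3 where r3: "\<rho>3 \<noteq> 0" "\<forall>x\<in>E. 0 \<le> \<rho>3 * cross (d - c) (x - c)"
    "\<forall>x\<in>E. x \<notin> closed_segment c d \<longrightarrow> 0 < \<rho>3 * cross (d - c) (x - c)"
    by (rule edge_sign[OF polytope edges(3) dist(3)])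
  obtain \<rho>4 where r4: "\<rho>4 \<noteq> 0" "\<forall>x\<in>E. 0 \<le> \<rho>4 * cross (a - d) (x - d)"
    "\<forall>x\<in>E. x \<notin> closed_segment d a \<longrightarrow> 0 < \<rho>4 * cross (a - d) (x - d)"
    by (rule edge_sign[OF polytope edges(4) dist(4)])
  have p1: "0 < \<rho>1 * cross (b - a) (c - a)" "0 < \<rho>1 * cross (b - a) (d - a)"
    using r1(3) vertices vertex_not_in_segment[of _ a b] dist by auto
  have p2: "0 < \<rho>2 * cross (c - b) (a - b)" "0 < \<rho>2 * cross (c - b) (d - b)"
    using r2(3) vertices vertex_not_in_segment[of _ b c] dist by auto
  have p3: "0 < \<rho>3 * cross (d - c) (a - c)" "0 < \<rho>3 * cross (d - c) (b - c)"
    using r3(3) vertices vertex_not_in_segment[of _ c d] dist by auto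
  have p4: "0 < \<rho>4 * cross (a - d) (b - d)" "0 < \<rho>4 * cross (a - d) (c - d)"
    using r4(3) vertices vertex_not_in_segment[of _ d a] dist by auto
  have e1: "cross (b - a) (c - a) = cross (c - b) (a - b)" "cross (c - b) (d - b) = cross (d - c) (b - c)"
    "cross (d - c) (a - c) = cross (a - d) (c - d)" "cross (a - d) (b - d) = cross (b - a) (d - a)"
    by (simp_all add: cross_def algebra_simps)
  define s where "s = \<sigma>"
  have ss: "s = sgn (cross (b - a) (d - a))" by (simp add: s_def \<sigma>_def)
  have sgn_pos: "(0 < y) = (0 < r)" if "0 < r * y" for r y :: real
    using that by (auto simp: zero_less_mult_iff)
  have A: "0 < \<rho>4 * cross (b - a) (d - a)" and B: "0 < \<rho>1 * cross (c - b) (a - b)"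
    and C: "0 < \<rho>2 * cross (d - c) (b - c)" and D: "0 < \<rho>3 * cross (a - d) (c - d)"
    using p1(1) p2(2) p3(1) p4(1) unfolding e1 by auto
  \<comment> \<open>Both signs at a corner are the sign of its area.\<close>
  have sg: "(0 < \<rho>1) = (0 < \<rho>2)" "(0 < \<rho>2) = (0 < \<rho>3)" "(0 < \<rho>3) = (0 < \<rho>4)"
    "(0 < \<rho>4) = (0 < cross (b - a) (d - a))"
    using sgn_pos[OF A] sgn_pos[OF B] sgn_pos[OF C] sgn_pos[OF D]
      sgn_pos[OF p2(1)] sgn_pos[OF p3(2)] sgn_pos[OF p4(2)] by blast+
  have sgn': "sgn r = (if 0 < r then 1 else -1)" if "r \<noteq> 0" for r :: real
    using that by (simp add: sgn_if)
  have "cross (b - a) (d - a) \<noteq> 0" using A by auto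
  then have s1: "s = sgn \<rho>1" "s = sgn \<rho>2" "s = sgn \<rho>3" "s = sgn \<rho>4"
    unfolding ss using sg r1(1) r2(1) r3(1) r4(1) by (simp_all only: sgn' simp_thms)
  have pos: "0 < sgn r * y" if "0 < r * y" for r y :: real
    using that by (auto simp: sgn_if zero_less_mult_iff)
  have nonneg: "0 \<le> sgn r * y" if "0 \<le> r * y" for r y :: real
    using that by (auto simp: sgn_if zero_le_mult_iff)
  show "0 < \<sigma> * cross (b - a) (d - a)" using pos[OF p1(2)] s1 s_def by simp
  have "cross (b - a) (c - b) = cross (b - a) (c - a)" by (simp add: cross_def algebra_simps)
  then show "0 < \<sigma> * cross (b - a) (c - b)" using pos[OF p1(1)] s1 s_def by simp
  have "cross (c - b) (d - c) = cross (c - b) (d - b)" by (simp add: cross_def algebra_simps)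
  then show "0 < \<sigma> * cross (c - b) (d - c)" using pos[OF p2(2)] s1 s_def by simp
  have "cross (d - c) (a - d) = cross (d - c) (a - c)" by (simp add: cross_def algebra_simps)
  then show "0 < \<sigma> * cross (d - c) (a - d)" using pos[OF p3(1)] s1 s_def by simp
  show "x \<in> E \<Longrightarrow> 0 \<le> \<sigma> * cross (b - a) (x - a)" using nonneg r1(2) s1 s_def by metis
  show "x \<in> E \<Longrightarrow> 0 \<le> \<sigma> * cross (c - b) (x - b)" using nonneg r2(2) s1 s_def by metis
  show "x \<in> E \<Longrightarrow> 0 \<le> \<sigma> * cross (d - c) (x - c)" using nonneg r3(2) s1 s_def by metis
  show "x \<in> E \<Longrightarrow> 0 \<le> \<sigma> * cross (a - d) (x - d)" using nonneg r4(2) s1 s_def by metis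
qed

sublocale convex_body E
proof
  show "compact E" "convex E"
    using polytope polytope_imp_compact polytope_imp_convex by blast+
  show "interior E \<noteq> {}"
  proof
    assume "interior E = {}"
    then obtain n m where nm: "n \<noteq> 0" "E \<subseteq> {x. n \<bullet> x = m}"
      using empty_interior_subset_hyperplane[OF \<open>convex E\<close>] by metis
    have "n \<bullet> (b - a) = 0" "n \<bullet> (d - a) = 0"
      using nm(2) vertices by (auto simp: inner_diff_right)
    then have "cross (b - a) (d - a) = 0" by (rule cross_eq_0_of_orthogonal[OF nm(1)])
    then show False using orientation(1) by simp
  qed
qed

end

section \<open>Traces on opposite edges\<close>

text \<open>The parameter runs from \<open>-1\<close> to \<open>1\<close>, as on the sides of the reference square.\<close>

definition seg :: "real^2 \<Rightarrow> real^2 \<Rightarrow> real \<Rightarrow> real^2" where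
  "seg p q u = p + ((1 + u) / 2) *\<^sub>R (q - p)"

lemma seg_in_closed_segment:
  assumes "-1 \<le> u" "u \<le> 1"
  shows "seg p q u \<in> closed_segment p q"
proof -
  have "p + t *\<^sub>R (q - p) = (1 - t) *\<^sub>R p + t *\<^sub>R q" for t by (simp add: algebra_simps)
  then show ?thesis
    unfolding in_segment seg_def using assms by (intro exI[of _ "(1 + u) / 2"]) simp
qed

lemma seg_eq_line: "seg p q u = (p + (1/2) *\<^sub>R (q - p)) + u *\<^sub>R ((1/2) *\<^sub>R (q - p))"
proof -
  have "((1 + u) / 2) *\<^sub>R w = (1/2) *\<^sub>R w + u *\<^sub>R ((1/2) *\<^sub>R w)" for w :: "real^2"
    by (simp only: scaleR_scaleR scaleR_left_distrib[symmetric]) (simp add: add_divide_distrib)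
  then show ?thesis by (simp only: seg_def add.assoc)
qed

lemma affine_on_seg:
  "n \<bullet> seg p q u + m = (1 - u) / 2 * (n \<bullet> p + m) + (1 + u) / 2 * (n \<bullet> q + m)"
proof -
  have "n \<bullet> seg p q u = n \<bullet> p + (1 + u) / 2 * (n \<bullet> q - n \<bullet> p)"
    by (simp only: seg_def inner_add_right inner_scaleR_right inner_diff_right)
  then show ?thesis by (simp add: field_simps)
qed

text \<open>The trace on an edge of a supplement function: it vanishes at both ends of the edge.\<close>

definition edge_poly :: "real \<Rightarrow> real \<Rightarrow> real \<Rightarrow> nat \<Rightarrow> real poly" where
  "edge_poly k \<alpha> \<beta> n = smult k ([:1, 0, -1:] * [:\<alpha>, \<beta>:] ^ n)"

lemma poly_edge_poly: "poly (edge_poly k \<alpha> \<beta> n) u = k * ((1 - u\<^sup>2) * (\<alpha> + \<beta> * u) ^ n)"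
  by (simp add: edge_poly_def power2_eq_square algebra_simps)

lemma coeff_edge_poly: "coeff (edge_poly k \<alpha> \<beta> n) (n + 2) = - k * \<beta> ^ n"
proof -
  have "[:1, 0, -1:] * Q = Q - pCons 0 (pCons 0 Q)" for Q :: "real poly" by simp
  moreover have "degree ([:\<alpha>, \<beta>:] ^ n) \<le> n"
    by (rule order_trans[OF degree_power_le]) simp
  then have "coeff ([:\<alpha>, \<beta>:] ^ n) (Suc (Suc n)) = 0" by (intro coeff_eq_0) simp
  ultimately show ?thesis
    by (simp add: edge_poly_def coeff_linear_poly_power del: mult_pCons_left)
qed

lemma opposite_signs_absurd:
  fixes x y A B s :: real
  assumes "x > 0" "y > 0" "A * B > 0" "x * (s * A) = - (y * (s * B))"
  shows "s = 0"
proof (rule ccontr)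
  assume "s \<noteq> 0"
  have "s * (x * A) = s * - (y * B)" using assms(4) by (simp add: mult_ac)
  then have "x * A = - (y * B)"
    using mult_left_cancel[OF \<open>s \<noteq> 0\<close>, of "x * A" "- (y * B)"] by blast
  then have "x * A * B = - (y * B) * B" by simp
  then have "x * (A * B) = - (y * B\<^sup>2)" by (simp add: power2_eq_square mult.assoc)
  moreover have "x * (A * B) > 0" using assms by simp
  moreover have "y * B\<^sup>2 \<ge> 0" using assms by simp
  ultimately show False by linarith
qed

context quadrilateral
begin

text \<open>Zero if and only if the opposite edges \<open>a d\<close> and \<open>b c\<close> are parallel; otherwise the denominator in
  Cramer's rule for the intersection of their lines.\<close>

definition meeting :: real where "meeting = cross (d - a) (c - b)"

text \<open>The parameters of the intersection point on the lines of \<open>a d\<close> and \<open>b c\<close>.\<close>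

definition meet1 :: real where "meet1 = 2 * cross (b - a) (c - b) / meeting - 1"

definition meet2 :: real where "meet2 = 2 * cross (b - a) (d - a) / meeting - 1"

text \<open>The barycentric parameters of the intersection, and their differences from 1, are quotients of
  corner areas by \<open>meeting\<close>. All corner areas have the same sign, so the lines meet beyond the same end
  of both edges.\<close>

lemma meeting_point:
  assumes "meeting \<noteq> 0"
  shows "seg a d meet1 = seg b c meet2" "meet1\<^sup>2 > 1" "meet2\<^sup>2 > 1" "meet1 * meet2 > 0"
proof -
  let ?N = meeting and ?TB = "cross (b - a) (c - b)" and ?TA = "cross (b - a) (d - a)"
  have "?N *\<^sub>R (b - a) + cross (c - b) (b - a) *\<^sub>R (d - a) + ?TA *\<^sub>R (c - b) = 0"
    unfolding meeting_def by (rule cross_cramer)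
  then have "?N *\<^sub>R (b - a) = ?TB *\<^sub>R (d - a) - ?TA *\<^sub>R (c - b)"
    using cross_commute[of "c - b" "b - a"] by (simp add: algebra_simps)
  then have "b - a = (?TB / ?N) *\<^sub>R (d - a) - (?TA / ?N) *\<^sub>R (c - b)"
    using assms(1) by (metis (no_types) divide_inverse_commute scaleR_right_diff_distrib scaleR_scaleR
      left_inverse scaleR_one)
  then show "seg a d meet1 = seg b c meet2"
    unfolding seg_def meet1_def meet2_def by (simp add: algebra_simps)
  have C: "?TB - ?N = cross (c - b) (d - c)" and D: "?TA - ?N = cross (d - c) (a - d)"
    unfolding meeting_def cross_def by (simp_all add: algebra_simps)
  have uu: "?N * meet1 = ?TB + (?TB - ?N)" "?N * meet2 = ?TA + (?TA - ?N)"
    "?N * (meet1 - 1) = 2 * (?TB - ?N)" "?N * (meet2 - 1) = 2 * (?TA - ?N)"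
    "?N * (meet1 + 1) = 2 * ?TB" "?N * (meet2 + 1) = 2 * ?TA"
    using assms(1) unfolding meet1_def meet2_def by (simp_all add: field_simps)
  note o = orientation(1-4)
  have pos: "v\<^sup>2 > 1" if "?N * (v - 1) = 2 * x" "?N * (v + 1) = 2 * y" "0 < \<sigma> * x" "0 < \<sigma> * y" for v x y
  proof -
    have "(\<sigma> * x) * (\<sigma> * y) > 0" using that by simp
    moreover have "\<sigma>\<^sup>2 * ?N\<^sup>2 * (v\<^sup>2 - 1) = 4 * ((\<sigma> * x) * (\<sigma> * y))"
    proof -
      have "\<sigma>\<^sup>2 * ?N\<^sup>2 * (v\<^sup>2 - 1) = \<sigma>\<^sup>2 * ((?N * (v - 1)) * (?N * (v + 1)))"
        by (simp add: power2_eq_square algebra_simps)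
      then show ?thesis unfolding that(1,2) by (simp add: power2_eq_square)
    qed
    ultimately have "0 < \<sigma>\<^sup>2 * ?N\<^sup>2 * (v\<^sup>2 - 1)" by simp
    then have "\<not> v\<^sup>2 - 1 \<le> 0"
      using mult_nonneg_nonpos[of "\<sigma>\<^sup>2 * ?N\<^sup>2" "v\<^sup>2 - 1"] by fastforce
    then show ?thesis by simp
  qed
  show "meet1\<^sup>2 > 1" using pos[OF uu(3,5)] o C by simp
  show "meet2\<^sup>2 > 1" using pos[OF uu(4,6)] o D by simp
  have "0 < (\<sigma> * (?TB + (?TB - ?N))) * (\<sigma> * (?TA + (?TA - ?N)))"
    unfolding C D
  proof (rule mult_pos_pos)
    show "0 < \<sigma> * (?TB + cross (c - b) (d - c))" "0 < \<sigma> * (?TA + cross (d - c) (a - d))"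
      using o by (simp_all add: distrib_left)
  qed
  also have "\<dots> = (\<sigma> * ?N)\<^sup>2 * (meet1 * meet2)" unfolding uu(1,2)[symmetric] by (simp add: power2_eq_square)
  finally show "meet1 * meet2 > 0"
    using mult_nonneg_nonpos[of "(\<sigma> * ?N)\<^sup>2" "meet1 * meet2"] by fastforce
qed

text \<open>Strict convexity at the corners \<open>a\<close> and \<open>b\<close> excludes that parallel opposite edges point in opposite
  directions.\<close>

lemma parallel_ratio:
  assumes "meeting = 0"
  obtains \<kappa> where "\<kappa> > 0" "c - b = \<kappa> *\<^sub>R (d - a)"
proof (rule that[of "cross (b - a) (c - b) / cross (b - a) (d - a)"])
  let ?TB = "cross (b - a) (c - b)" and ?TA = "cross (b - a) (d - a)"
  have "0 < (\<sigma> * ?TB) / (\<sigma> * ?TA)" using orientation(1,2) by (rule divide_pos_pos[rotated])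
  then show "?TB / ?TA > 0" using orientation(1) by (auto simp: zero_less_divide_iff zero_less_mult_iff)
  have "meeting *\<^sub>R (b - a) + cross (c - b) (b - a) *\<^sub>R (d - a) + ?TA *\<^sub>R (c - b) = 0"
    unfolding meeting_def by (rule cross_cramer)
  then have e: "?TA *\<^sub>R (c - b) = ?TB *\<^sub>R (d - a)"
    using cross_commute[of "c - b" "b - a"] assms by (simp add: algebra_simps)
  have "?TA \<noteq> 0" using orientation(1) by auto
  then have "c - b = (1 / ?TA) *\<^sub>R (?TA *\<^sub>R (c - b))" by simp
  also have "\<dots> = (?TB / ?TA) *\<^sub>R (d - a)" unfolding e by simp
  finally show "c - b = (?TB / ?TA) *\<^sub>R (d - a)" .
qed

text \<open>What both kinds of supplements have in common: opposite signs on the two edges, and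
  factors \<open>\<alpha> + \<beta> u\<close> that have the same sign at the intersection of the edge lines. If the lines are
  parallel, the intersection is at infinity and the slopes take over this role.\<close>

definition opposite_trace :: "nat \<Rightarrow> (real^2 \<Rightarrow> real) \<Rightarrow> bool" where
  "opposite_trace r \<phi> \<longleftrightarrow> (\<exists>k1 k2 \<alpha>1 \<beta>1 \<alpha>2 \<beta>2. k1 > 0 \<and> k2 > 0 \<and>
     (\<forall>u. -1 \<le> u \<and> u \<le> 1 \<longrightarrow> \<phi> (seg a d u) = - k1 * ((1 - u\<^sup>2) * (\<alpha>1 + \<beta>1 * u) ^ (r - 1))) \<and>
     (\<forall>u. -1 \<le> u \<and> u \<le> 1 \<longrightarrow> \<phi> (seg b c u) = k2 * ((1 - u\<^sup>2) * (\<alpha>2 + \<beta>2 * u) ^ (r - 1))) \<and>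
     (meeting = 0 \<longrightarrow> \<beta>1 * \<beta>2 > 0) \<and>
     (meeting \<noteq> 0 \<longrightarrow> (\<alpha>1 + \<beta>1 * meet1) * (\<alpha>2 + \<beta>2 * meet2) > 0))"

text \<open>The reason why the supplement meets the polynomials only in zero. A polynomial that agrees with
  \<open>s \<phi>\<close> on two edges also continues its traces along the two edge lines. If the lines meet, the two
  traces must take the same value there, but they have opposite signs unless \<open>s = 0\<close>; if the lines
  are parallel, the same contradiction arises for the leading coefficients, since the homogeneous
  part of top degree depends only on the direction.\<close>

lemma opposite_trace_independent:
  assumes r: "r \<ge> 1" and \<phi>: "opposite_trace r \<phi>"
    and p: "\<And>x. x \<in> closed_segment a d \<union> closed_segment b c \<Longrightarrow> peval (r + 1) q x = s * \<phi> x"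
  shows "s = 0"
proof -
  obtain k1 k2 \<alpha>1 \<beta>1 \<alpha>2 \<beta>2 where k: "k1 > 0" "k2 > 0"
    and t1: "\<And>u. -1 \<le> u \<and> u \<le> 1 \<Longrightarrow> \<phi> (seg a d u) = - k1 * ((1 - u\<^sup>2) * (\<alpha>1 + \<beta>1 * u) ^ (r - 1))"
    and t2: "\<And>u. -1 \<le> u \<and> u \<le> 1 \<Longrightarrow> \<phi> (seg b c u) = k2 * ((1 - u\<^sup>2) * (\<alpha>2 + \<beta>2 * u) ^ (r - 1))"
    and par: "meeting = 0 \<Longrightarrow> \<beta>1 * \<beta>2 > 0"
    and npar: "meeting \<noteq> 0 \<Longrightarrow> (\<alpha>1 + \<beta>1 * meet1) * (\<alpha>2 + \<beta>2 * meet2) > 0"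
    using \<phi> unfolding opposite_trace_def by blast
  let ?P = "\<lambda>p q'. line_poly (r + 1) q (p + (1/2) *\<^sub>R (q' - p)) ((1/2) *\<^sub>R (q' - p))"
  have poly_P: "poly (?P p q') u = peval (r + 1) q (seg p q' u)" for p q' u
    by (simp add: poly_line_poly seg_eq_line)
  have P1: "?P a d = edge_poly (- s * k1) \<alpha>1 \<beta>1 (r - 1)"
  proof (rule poly_eq_of_interval[of "-1" 1])
    fix u :: real assume "-1 < u" "u < 1"
    then show "poly (?P a d) u = poly (edge_poly (- s * k1) \<alpha>1 \<beta>1 (r - 1)) u"
      using p[of "seg a d u"] t1[of u] seg_in_closed_segment[of u a d]
      unfolding poly_P poly_edge_poly by simp
  qed simp
  have P2: "?P b c = edge_poly (s * k2) \<alpha>2 \<beta>2 (r - 1)"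
  proof (rule poly_eq_of_interval[of "-1" 1])
    fix u :: real assume "-1 < u" "u < 1"
    then show "poly (?P b c) u = poly (edge_poly (s * k2) \<alpha>2 \<beta>2 (r - 1)) u"
      using p[of "seg b c u"] t2[of u] seg_in_closed_segment[of u b c]
      unfolding poly_P poly_edge_poly by simp
  qed simp
  show "s = 0"
  proof (cases "meeting = 0")
    case True
    obtain \<kappa> where \<kappa>: "\<kappa> > 0" "c - b = \<kappa> *\<^sub>R (d - a)" using parallel_ratio[OF True] .
    have r2: "r - 1 + 2 = r + 1" using r by simp
    have "top_form (r + 1) q ((1/2) *\<^sub>R (d - a)) = s * k1 * \<beta>1 ^ (r - 1)"
      using coeff_edge_poly[of "- s * k1" \<alpha>1 \<beta>1 "r - 1"] coeff_line_poly unfolding P1[symmetric] r2 by simp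
    moreover have "top_form (r + 1) q ((1/2) *\<^sub>R (c - b)) = - s * k2 * \<beta>2 ^ (r - 1)"
      using coeff_edge_poly[of "s * k2" \<alpha>2 \<beta>2 "r - 1"] coeff_line_poly unfolding P2[symmetric] r2 by simp
    moreover have "top_form (r + 1) q ((1/2) *\<^sub>R (c - b)) = \<kappa> ^ (r + 1) * top_form (r + 1) q ((1/2) *\<^sub>R (d - a))"
      unfolding \<kappa>(2) top_form_scale[symmetric] by (simp add: mult.commute)
    ultimately have e: "(\<kappa> ^ (r + 1) * k1) * (s * \<beta>1 ^ (r - 1)) = - (k2 * (s * \<beta>2 ^ (r - 1)))"
      by (simp add: mult_ac)
    have "\<beta>1 ^ (r - 1) * \<beta>2 ^ (r - 1) > 0"
      using par[OF True] by (simp add: power_mult_distrib[symmetric])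
    from opposite_signs_absurd[OF _ k(2) this e] show ?thesis using \<kappa>(1) k(1) by simp
  next
    case False
    note m = meeting_point[OF False]
    have "poly (?P a d) meet1 = poly (?P b c) meet2" unfolding poly_P m(1) ..
    then have "- s * k1 * ((1 - meet1\<^sup>2) * (\<alpha>1 + \<beta>1 * meet1) ^ (r - 1)) = s * k2 * ((1 - meet2\<^sup>2) * (\<alpha>2 + \<beta>2 * meet2) ^ (r - 1))"
      unfolding P1 P2 poly_edge_poly .
    then have e: "(k1 * (meet1\<^sup>2 - 1)) * (s * (\<alpha>1 + \<beta>1 * meet1) ^ (r - 1)) = - ((k2 * (meet2\<^sup>2 - 1)) * (s * (\<alpha>2 + \<beta>2 * meet2) ^ (r - 1)))"
      by (simp add: algebra_simps)
    have "(\<alpha>1 + \<beta>1 * meet1) ^ (r - 1) * (\<alpha>2 + \<beta>2 * meet2) ^ (r - 1) > 0"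
      using npar[OF False] by (simp add: power_mult_distrib[symmetric])
    from opposite_signs_absurd[OF _ _ this e] show ?thesis using k m(2,3) by simp
  qed
qed

text \<open>Vanishing on the other two edges decouples the two functions that span a supplement.\<close>

definition supplement_function :: "nat \<Rightarrow> (real^2 \<Rightarrow> real) \<Rightarrow> bool" where
  "supplement_function r \<phi> \<longleftrightarrow> opposite_trace r \<phi> \<and>
     (\<forall>x\<in>closed_segment a b \<union> closed_segment d c. \<phi> x = 0) \<and>
     continuous_on E \<phi> \<and> (\<exists>g. weak_gradient E \<phi> g)"

end

section \<open>Fully direct supplements\<close>

text \<open>If \<open>l\<close> vanished at a point off the line \<open>p q\<close>, the unit normal would be orthogonal to two
  independent vectors.\<close>

lemma edge_function_affine:
  assumes l: "edge_function E (closed_segment p q) l" and E: "p \<in> E" "q \<in> E"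
  obtains n m where "n \<noteq> 0" "l = (\<lambda>x. n \<bullet> x + m)" "l p = 0" "l q = 0"
    "\<And>x. x \<in> E \<Longrightarrow> cross (q - p) (x - p) \<noteq> 0 \<Longrightarrow> 0 < l x"
proof -
  obtain \<nu> x0 where nu: "unit_outer_normal E (closed_segment p q) \<nu>" "x0 \<in> closed_segment p q"
    and l_eq: "l = (\<lambda>x. - ((x - x0) \<bullet> \<nu>))"
    using l unfolding edge_function_def by blast
  have norm: "norm \<nu> = 1"
    and orth: "\<And>x y. x \<in> closed_segment p q \<Longrightarrow> y \<in> closed_segment p q \<Longrightarrow> (y - x) \<bullet> \<nu> = 0"
    and outer: "\<And>x y. x \<in> closed_segment p q \<Longrightarrow> y \<in> E \<Longrightarrow> (y - x) \<bullet> \<nu> \<le> 0"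
    using nu(1) unfolding unit_outer_normal_def by blast+
  have \<nu>0: "\<nu> \<noteq> 0" using norm by auto
  show ?thesis
  proof (rule that[of "- \<nu>" "x0 \<bullet> \<nu>"])
    show "l = (\<lambda>x. - \<nu> \<bullet> x + x0 \<bullet> \<nu>)"
    proof
      fix x
      have "\<nu> \<bullet> x = x \<bullet> \<nu>" by (rule inner_commute)
      then show "l x = - \<nu> \<bullet> x + x0 \<bullet> \<nu>" by (simp add: l_eq inner_diff_left)
    qed
    show lp: "l p = 0" and "l q = 0"
      unfolding l_eq using orth[OF nu(2)] ends_in_segment[of p q] by simp_all
    fix x assume x: "x \<in> E" "cross (q - p) (x - p) \<noteq> 0"
    have ge: "0 \<le> l x" unfolding l_eq using outer[OF nu(2) x(1)] by simp
    have "l x \<noteq> 0"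
    proof
      assume "l x = 0"
      then have "(x - p) \<bullet> \<nu> = 0"
        using lp unfolding l_eq by (simp add: inner_diff_left)
      moreover have "(q - p) \<bullet> \<nu> = 0" by (rule orth) simp_all
      ultimately have "cross (q - p) (x - p) = 0"
        by (intro cross_eq_0_of_orthogonal[OF \<nu>0]) (simp_all add: inner_commute)
      then show False using x(2) by simp
    qed
    then show "0 < l x" using ge by simp
  qed (use \<nu>0 in simp)
qed

lemma affine_hull_segment_eq: "affine hull closed_segment p q = range (\<lambda>u. p + u *\<^sub>R (q - p))"
  by (simp add: segment_convex_hull affine_hull_2_alt)

lemma affine_zero_on_segment:
  assumes "n \<bullet> p + m = 0" "n \<bullet> q + m = 0" "x \<in> closed_segment p q"
  shows "n \<bullet> x + m = 0"
proof -
  obtain u where u: "x = (1 - u) *\<^sub>R p + u *\<^sub>R q" using assms(3) unfolding in_segment by blast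
  have "n \<bullet> x + m = (1 - u) * (n \<bullet> p + m) + u * (n \<bullet> q + m)"
    unfolding u inner_add_right inner_scaleR_right by (simp add: algebra_simps)
  then show ?thesis using assms(1,2) by simp
qed

context quadrilateral
begin

lemma affine_parallel_iff:
  "affine_parallel (affine hull closed_segment a d) (affine hull closed_segment b c) \<longleftrightarrow> meeting = 0"
proof
  assume "affine_parallel (affine hull closed_segment a d) (affine hull closed_segment b c)"
  then obtain t where t: "range (\<lambda>u. b + u *\<^sub>R (c - b)) = (+) t ` range (\<lambda>u. a + u *\<^sub>R (d - a))"
    unfolding affine_parallel_def affine_hull_segment_eq by blast
  have mem: "t + (a + u *\<^sub>R (d - a)) \<in> range (\<lambda>u. b + u *\<^sub>R (c - b))" for u
    unfolding t by (intro imageI rangeI)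
  from mem[of 0] obtain u0 where u0: "t + a = b + u0 *\<^sub>R (c - b)" by auto
  from mem[of 1] obtain u1 where u1: "t + d = b + u1 *\<^sub>R (c - b)" by auto
  have "d - a = (t + d) - (t + a)" by simp
  also have "\<dots> = (u1 - u0) *\<^sub>R (c - b)" unfolding u0 u1 by (simp add: algebra_simps)
  finally show "meeting = 0" unfolding meeting_def by (simp only: cross_simps(5,7) mult_zero_right)
next
  assume "meeting = 0"
  then obtain \<kappa> where \<kappa>: "\<kappa> > 0" "c - b = \<kappa> *\<^sub>R (d - a)" by (rule parallel_ratio)
  have "range (\<lambda>u. b + u *\<^sub>R (c - b)) = (+) (b - a) ` range (\<lambda>u. a + u *\<^sub>R (d - a))"
  proof (intro equalityI subsetI)
    fix x assume "x \<in> range (\<lambda>u. b + u *\<^sub>R (c - b))"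
    then obtain u where "x = b + u *\<^sub>R (c - b)" by blast
    then have "x = (b - a) + (a + (u * \<kappa>) *\<^sub>R (d - a))" unfolding \<kappa>(2) by simp
    then show "x \<in> (+) (b - a) ` range (\<lambda>u. a + u *\<^sub>R (d - a))" by blast
  next
    fix x assume "x \<in> (+) (b - a) ` range (\<lambda>u. a + u *\<^sub>R (d - a))"
    then obtain u where "x = (b - a) + (a + u *\<^sub>R (d - a))" by blast
    then have "x = b + (u / \<kappa>) *\<^sub>R (c - b)" unfolding \<kappa>(2) using \<kappa>(1) by simp
    then show "x \<in> range (\<lambda>u. b + u *\<^sub>R (c - b))" by blast
  qed
  then show "affine_parallel (affine hull closed_segment a d) (affine hull closed_segment b c)"
    unfolding affine_parallel_def affine_hull_segment_eq by (rule exI)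
qed

text \<open>On the edge \<open>a d\<close> the product of the edge functions of \<open>a b\<close> and \<open>d c\<close> is a positive multiple of
  \<open>1 - u\<^sup>2\<close>, and likewise on \<open>b c\<close>. The condition on \<open>lH\<close> provides the common sign: at the intersection of the
  two lines both edge functions vanish and \<open>lH\<close> equals \<open>\<gamma>\<close>; if the lines are parallel, \<open>lH\<close> has a
  zero on each of them and so cannot be constant along their direction.\<close>

lemma direct_supplement_function:
  assumes l1: "edge_function E (closed_segment a d) l1" and l2: "edge_function E (closed_segment b c) l2"
    and l3: "edge_function E (closed_segment a b) l3" and l4: "edge_function E (closed_segment d c) l4"
    and lH: "admissible_linear (closed_segment a d) (closed_segment b c) l1 l2 lH"
    and R: "admissible_R E (closed_segment a d) (closed_segment b c) R"
  shows "supplement_function r (\<lambda>x. l3 x * l4 x * lH x ^ (r - 1) * R x)"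
proof -
  obtain n1 m1 where e1: "l1 = (\<lambda>x. n1 \<bullet> x + m1)" "l1 a = 0" "l1 d = 0"
    using edge_function_affine[OF l1] vertices by metis
  obtain n2 m2 where e2: "l2 = (\<lambda>x. n2 \<bullet> x + m2)" "l2 b = 0" "l2 c = 0"
    using edge_function_affine[OF l2] vertices by metis
  obtain n3 m3 where e3: "l3 = (\<lambda>x. n3 \<bullet> x + m3)" "l3 a = 0" "l3 b = 0"
    and p3: "\<And>x. x \<in> E \<Longrightarrow> cross (b - a) (x - a) \<noteq> 0 \<Longrightarrow> 0 < l3 x"
    using edge_function_affine[OF l3] vertices by metis
  obtain n4 m4 where e4: "l4 = (\<lambda>x. n4 \<bullet> x + m4)" "l4 d = 0" "l4 c = 0"
    and p4: "\<And>x. x \<in> E \<Longrightarrow> cross (c - d) (x - d) \<noteq> 0 \<Longrightarrow> 0 < l4 x"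
    using edge_function_affine[OF l4] vertices by metis
  have "cross (b - a) (c - a) = cross (b - a) (c - b)" "cross (c - d) (a - d) = - cross (d - c) (a - d)"
    "cross (c - d) (b - d) = - cross (c - b) (d - c)"
    by (simp_all add: cross_def algebra_simps)
  then have "cross (b - a) (d - a) \<noteq> 0" "cross (b - a) (c - a) \<noteq> 0" "cross (c - d) (a - d) \<noteq> 0" "cross (c - d) (b - d) \<noteq> 0"
    using orientation(1-4) by (metis less_irrefl mult_zero_right neg_equal_0_iff_equal)+
  then have pos: "0 < l3 d" "0 < l3 c" "0 < l4 a" "0 < l4 b"
    using p3 p4 vertices by blast+
  obtain n m where nm: "n \<noteq> 0" "lH = (\<lambda>x. n \<bullet> x + m)"
    using lH unfolding admissible_linear_def linear_poly_def by blast
  obtain \<eta> \<xi> where \<eta>: "\<eta> > 0" "\<xi> > 0" "\<forall>x\<in>closed_segment a d. R x = - \<eta>" "\<forall>x\<in>closed_segment b c. R x = \<xi>"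
    using R unfolding admissible_R_def by blast
  have seg3: "l3 (seg p q u) = (1 - u) / 2 * l3 p + (1 + u) / 2 * l3 q" for p q u
    unfolding e3(1) by (rule affine_on_seg)
  have seg4: "l4 (seg p q u) = (1 - u) / 2 * l4 p + (1 + u) / 2 * l4 q" for p q u
    unfolding e4(1) by (rule affine_on_seg)
  have segH': "lH (seg p q u) = (1 - u) / 2 * lH p + (1 + u) / 2 * lH q" for p q u
    unfolding nm(2) by (rule affine_on_seg)
  have segH: "lH (seg p q u) = (lH p + lH q) / 2 + (lH q - lH p) / 2 * u" for p q u
    unfolding segH' by (simp add: field_simps)
  have trace: "opposite_trace r (\<lambda>x. l3 x * l4 x * lH x ^ (r - 1) * R x)"
    unfolding opposite_trace_def
  proof (intro exI conjI allI impI)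
    show "0 < \<eta> * l3 d * l4 a / 4" "0 < \<xi> * l3 c * l4 b / 4" using \<eta>(1,2) pos by simp_all
    fix u :: real assume u: "-1 \<le> u \<and> u \<le> 1"
    show "l3 (seg a d u) * l4 (seg a d u) * lH (seg a d u) ^ (r - 1) * R (seg a d u)
      = - (\<eta> * l3 d * l4 a / 4) * ((1 - u\<^sup>2) * ((lH a + lH d) / 2 + (lH d - lH a) / 2 * u) ^ (r - 1))"
    proof -
      have 1: "l3 (seg a d u) = (1 + u) / 2 * l3 d" "l4 (seg a d u) = (1 - u) / 2 * l4 a"
        by (simp_all add: seg3 seg4 e3(2) e4(2))
      have 2: "R (seg a d u) = - \<eta>" using \<eta>(3) seg_in_closed_segment[of u a d] u by blast
      show ?thesis
        unfolding segH[symmetric] 1 2 by (simp add: power2_eq_square field_simps)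
    qed
    show "l3 (seg b c u) * l4 (seg b c u) * lH (seg b c u) ^ (r - 1) * R (seg b c u)
      = (\<xi> * l3 c * l4 b / 4) * ((1 - u\<^sup>2) * ((lH b + lH c) / 2 + (lH c - lH b) / 2 * u) ^ (r - 1))"
    proof -
      have 1: "l3 (seg b c u) = (1 + u) / 2 * l3 c" "l4 (seg b c u) = (1 - u) / 2 * l4 b"
        by (simp_all add: seg3 seg4 e3(3) e4(3))
      have 2: "R (seg b c u) = \<xi>" using \<eta>(4) seg_in_closed_segment[of u b c] u by blast
      show ?thesis
        unfolding segH[symmetric] 1 2 by (simp add: power2_eq_square field_simps)
    qed
  next
    assume par: "meeting = 0"
    obtain \<kappa> where \<kappa>: "\<kappa> > 0" "c - b = \<kappa> *\<^sub>R (d - a)" using parallel_ratio[OF par] .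
    have "{x. lH x = 0} \<inter> affine hull closed_segment a d \<noteq> {}" "{x. lH x = 0} \<inter> affine hull closed_segment b c \<noteq> {}"
      using lH par unfolding admissible_linear_def affine_parallel_iff by simp_all
    then obtain u v where uv: "lH (a + u *\<^sub>R (d - a)) = 0" "lH (b + v *\<^sub>R (c - b)) = 0"
      unfolding affine_hull_segment_eq by blast
    have slope: "lH d - lH a = n \<bullet> (d - a)" "lH c - lH b = \<kappa> * (n \<bullet> (d - a))"
      unfolding nm(2) by (simp_all add: inner_diff_right[symmetric] \<kappa>(2))
    have "n \<bullet> (d - a) \<noteq> 0"
    proof
      assume 0: "n \<bullet> (d - a) = 0"
      then have "lH a = 0" "lH b = 0" using uv unfolding nm(2) \<kappa>(2) by (simp_all add: inner_add_right)
      then have "n \<bullet> (b - a) = 0" unfolding nm(2) by (simp add: inner_diff_right)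
      then have "cross (b - a) (d - a) = 0" using 0 by (rule cross_eq_0_of_orthogonal[OF nm(1)])
      then show False using orientation(1) by simp
    qed
    then have "0 < \<kappa> * ((n \<bullet> (d - a)) * (n \<bullet> (d - a))) / 4"
      using \<kappa>(1) by (auto simp: zero_less_mult_iff linorder_neq_iff)
    then show "0 < (lH d - lH a) / 2 * ((lH c - lH b) / 2)"
      unfolding slope by (simp add: mult_ac)
  next
    assume npar: "meeting \<noteq> 0"
    then obtain \<alpha> \<beta> \<gamma> where g: "\<gamma> \<noteq> 0" "lH = (\<lambda>x. \<alpha> * l1 x + \<beta> * l2 x + \<gamma>)"
      using lH unfolding admissible_linear_def affine_parallel_iff by auto
    have meet: "seg a d meet1 = seg b c meet2" using meeting_point(1)[OF npar] .
    have "l1 (seg a d meet1) = 0"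
      using affine_on_seg[of n1 a d meet1 m1] e1(2,3) unfolding e1(1) by simp
    moreover have "l2 (seg b c meet2) = 0"
      using affine_on_seg[of n2 b c meet2 m2] e2(2,3) unfolding e2(1) by simp
    ultimately have "lH (seg a d meet1) = \<gamma>" "lH (seg b c meet2) = \<gamma>"
      using meet unfolding g(2) by simp_all
    then show "0 < ((lH a + lH d) / 2 + (lH d - lH a) / 2 * meet1) *
        ((lH b + lH c) / 2 + (lH c - lH b) / 2 * meet2)"
      using g(1) unfolding segH by (auto simp: zero_less_mult_iff linorder_neq_iff)
  qed
  let ?p = "\<lambda>x. l3 x * l4 x * lH x ^ (r - 1)"
  have p: "smooth ?p"
    unfolding e3(1) e4(1) nm(2) by (intro smooth_mult smooth_power smooth_linear)
  have "\<forall>x\<in>closed_segment a b \<union> closed_segment d c. ?p x * R x = 0"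
  proof
    fix x assume "x \<in> closed_segment a b \<union> closed_segment d c"
    then have "l3 x = 0 \<or> l4 x = 0"
      using affine_zero_on_segment[of n3 a m3 b x] affine_zero_on_segment[of n4 d m4 c x] e3 e4 by auto
    then show "?p x * R x = 0" by auto
  qed
  moreover have "continuous_on E (\<lambda>x. ?p x * R x)"
    using R unfolding admissible_R_def by (intro continuous_on_mult[OF smooth_continuous_on[OF p]]) simp
  moreover have "\<exists>g. weak_gradient E (\<lambda>x. ?p x * R x) g"
    using R weak_gradient_mult_smooth[OF sets_lebesgue _ p] unfolding admissible_R_def H1_def by blast
  ultimately show ?thesis
    using trace unfolding supplement_function_def by (intro conjI)
qed

end

section \<open>Mapped supplements\<close>

lemma ref_square_cbox: "ref_square = cbox (vector [-1, -1]) (vector [1, 1])"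
  by (auto simp: ref_square_def mem_box_cart forall_2)

lemma ref_square_iff: "x \<in> ref_square \<longleftrightarrow> -1 \<le> x$1 \<and> x$1 \<le> 1 \<and> -1 \<le> x$2 \<and> x$2 \<le> 1"
  by (auto simp: ref_square_def)

context quadrilateral
begin

abbreviation "F \<equiv> bilinear_map a b c d"

text \<open>\<open>F1\<close> and \<open>F2\<close> are the partial derivatives of the bilinear map, and \<open>jac\<close> is its Jacobian determinant.\<close>

definition F1 :: "real^2 \<Rightarrow> real^2" where
  "F1 x = (1/4) *\<^sub>R ((1 - x$2) *\<^sub>R (b - a) + (1 + x$2) *\<^sub>R (c - d))"

definition F2 :: "real^2 \<Rightarrow> real^2" where
  "F2 x = (1/4) *\<^sub>R ((1 - x$1) *\<^sub>R (d - a) + (1 + x$1) *\<^sub>R (c - b))"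

definition jac :: "real^2 \<Rightarrow> real" where "jac x = cross (F1 x) (F2 x)"

text \<open>The Jacobian interpolates its corner values bilinearly, and those are the corner areas up to a
  positive factor.\<close>

lemma jac_nonzero:
  assumes "x \<in> ref_square"
  shows "jac x \<noteq> 0"
proof -
  have D: "cross (c - d) (d - a) = cross (d - c) (a - d)" and C: "cross (c - d) (c - b) = cross (c - b) (d - c)"
    by (simp_all add: cross_def algebra_simps)
  let ?A = "\<sigma> * cross (b - a) (d - a)" and ?B = "\<sigma> * cross (b - a) (c - b)"
    and ?C = "\<sigma> * cross (c - b) (d - c)" and ?D = "\<sigma> * cross (d - c) (a - d)"
  let ?s = "(1 + x$1) / 2" and ?t = "(1 + x$2) / 2"
  have eq: "4 * (\<sigma> * jac x) = (1 - ?s) * ((1 - ?t) * ?A + ?t * ?D) + ?s * ((1 - ?t) * ?B + ?t * ?C)"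
    unfolding jac_def F1_def F2_def cross_simps(1,2,5,6) D C by (simp add: field_simps)
  have pos: "0 < (1 - u) * y + u * z" if "0 \<le> u" "u \<le> 1" "0 < y" "0 < z" for u y z :: real
  proof (cases "u = 0")
    case False
    then show ?thesis using that by (intro add_nonneg_pos mult_nonneg_nonneg mult_pos_pos) auto
  qed (use that in simp)
  have "0 < 4 * (\<sigma> * jac x)"
    unfolding eq using assms orientation(1-4) by (intro pos) (auto simp: ref_square_iff)
  then show ?thesis by auto
qed

text \<open>For a quadratic map the difference of two values is exactly the derivative at the midpoint. Together
  with the nonvanishing Jacobian this gives injectivity.\<close>

lemma F_diff:
  "F x - F y = (x$1 - y$1) *\<^sub>R F1 ((1/2) *\<^sub>R (x + y)) + (x$2 - y$2) *\<^sub>R F2 ((1/2) *\<^sub>R (x + y))"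
  unfolding bilinear_map_def F1_def F2_def
  by (simp add: vec_eq_iff field_simps)

lemma cross_independent:
  assumes "u *\<^sub>R v + t *\<^sub>R w = 0" "cross v w \<noteq> 0"
  shows "u = 0" "t = 0"
proof -
  have "cross (u *\<^sub>R v + t *\<^sub>R w) w = 0" "cross v (u *\<^sub>R v + t *\<^sub>R w) = 0"
    using assms(1) by (simp_all add: cross_def)
  then show "u = 0" "t = 0" using assms(2) by (simp_all add: cross_simps)
qed

lemma F_inj: "inj_on F ref_square"
proof (rule inj_onI)
  fix x y assume xy: "x \<in> ref_square" "y \<in> ref_square" "F x = F y"
  let ?z = "(1/2) *\<^sub>R (x + y)"
  have "?z \<in> ref_square" using xy(1,2) by (auto simp: ref_square_iff)
  then have "jac ?z \<noteq> 0" by (rule jac_nonzero)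
  moreover have "(x$1 - y$1) *\<^sub>R F1 ?z + (x$2 - y$2) *\<^sub>R F2 ?z = 0"
    using F_diff[of x y] xy(3) by simp
  ultimately have "x$1 - y$1 = 0" "x$2 - y$2 = 0"
    unfolding jac_def by (blast intro: cross_independent)+
  then show "x = y" by (simp add: vec_eq_iff forall_2)
qed

lemma F_nested:
  "F x = (1 - (1 + x$2) / 2) *\<^sub>R (a + ((1 + x$1) / 2) *\<^sub>R (b - a)) + ((1 + x$2) / 2) *\<^sub>R (d + ((1 + x$1) / 2) *\<^sub>R (c - d))"
  unfolding bilinear_map_def by (simp add: vec_eq_iff field_simps)

text \<open>Surjectivity: the segment joining the points with parameter \<open>s\<close> on \<open>a b\<close> and \<open>d c\<close> sweeps over \<open>E\<close>
  from \<open>a d\<close> to \<open>b c\<close>, so by the intermediate value theorem its line passes through \<open>x\<close> for some \<open>s\<close>; the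
  sides \<open>a b\<close> and \<open>d c\<close> then confine the second parameter.\<close>

lemma F_image: "F ` ref_square = E"
proof (intro equalityI subsetI)
  fix y assume "y \<in> F ` ref_square"
  then obtain x where x: "x \<in> ref_square" "y = F x" by blast
  have comb: "p + t *\<^sub>R (q - p) \<in> E" if "p \<in> E" "q \<in> E" "0 \<le> t" "t \<le> 1" for p q t
  proof -
    have "(1 - t) *\<^sub>R p + t *\<^sub>R q \<in> E" using convex that by (intro convexD) auto
    moreover have "(1 - t) *\<^sub>R p + t *\<^sub>R q = p + t *\<^sub>R (q - p)" by (simp add: algebra_simps)
    ultimately show ?thesis by simp
  qed
  show "y \<in> E"
    unfolding x(2) F_nested
    by (rule convexD[OF convex]) (use x(1) vertices comb in \<open>auto simp: ref_square_iff\<close>)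
next
  fix x assume x: "x \<in> E"
  define P where "P s = a + s *\<^sub>R (b - a)" for s
  define Q where "Q s = d + s *\<^sub>R (c - d)" for s
  \<comment> \<open>Zero exactly if \<open>x\<close> lies on the line through \<open>P s\<close> and \<open>Q s\<close>.\<close>
  define h where "h s = \<sigma> * cross (Q s - P s) (x - P s)" for s
  have "h 0 = - (\<sigma> * cross (a - d) (x - d))" "h 1 = \<sigma> * cross (c - b) (x - b)"
    by (simp_all add: h_def P_def Q_def cross_def algebra_simps)
  then have h: "h 0 \<le> 0" "0 \<le> h 1" using orientation(6,8)[OF x] by simp_all
  have "continuous_on {0..1} h"
    unfolding h_def P_def Q_def cross_def by (intro continuous_intros)
  then obtain s where s: "0 \<le> s" "s \<le> 1" "h s = 0"
    using IVT'[of h 0 0 1] h by auto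
  have \<sigma>: "\<sigma> \<noteq> 0" using orientation(1) by auto
  have pos: "0 < (1 - s) * y + s * z" if "0 < y" "0 < z" for y z :: real
  proof (cases "s = 0")
    case False
    then show ?thesis using that s by (intro add_nonneg_pos mult_nonneg_nonneg mult_pos_pos) auto
  qed (use that in simp)
  let ?w = "Q s - P s" and ?v = "x - P s"
  have "\<sigma> * cross (b - a) ?w = (1 - s) * (\<sigma> * cross (b - a) (d - a)) + s * (\<sigma> * cross (b - a) (c - b))"
    unfolding P_def Q_def cross_def by (simp add: algebra_simps)
  then have AQ: "0 < \<sigma> * cross (b - a) ?w" using pos orientation(1,2) by simp
  have "\<sigma> * cross (d - c) (- ?w) = (1 - s) * (\<sigma> * cross (d - c) (a - d)) + s * (\<sigma> * cross (c - b) (d - c))"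
    unfolding P_def Q_def cross_def by (simp add: algebra_simps)
  then have BP: "0 < \<sigma> * cross (d - c) (- ?w)" using pos orientation(3,4) by simp
  define t where "t = cross (b - a) ?v / cross (b - a) ?w"
  have "cross ?w ?v = 0" using s(3) \<sigma> by (simp add: h_def)
  moreover have "cross ?w ?v *\<^sub>R (b - a) + cross ?v (b - a) *\<^sub>R ?w + cross (b - a) ?w *\<^sub>R ?v = 0" by (rule cross_cramer)
  ultimately have e: "cross (b - a) ?w *\<^sub>R ?v = cross (b - a) ?v *\<^sub>R ?w"
    using cross_commute[of ?v "b - a"] by (simp add: algebra_simps)
  have nz: "cross (b - a) ?w \<noteq> 0" using AQ by auto
  then have "?v = (1 / cross (b - a) ?w) *\<^sub>R (cross (b - a) ?w *\<^sub>R ?v)" by simp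
  also have "\<dots> = t *\<^sub>R ?w" unfolding e t_def by simp
  finally have xt: "x = P s + t *\<^sub>R ?w" by (simp add: algebra_simps)
  have "x - a = s *\<^sub>R (b - a) + t *\<^sub>R ?w" using xt by (simp add: P_def)
  then have A: "\<sigma> * cross (b - a) (x - a) = t * (\<sigma> * cross (b - a) ?w)"
    by (simp only: cross_simps(2,6,7) mult_zero_right add_0_left mult.left_commute)
  have "0 \<le> t * (\<sigma> * cross (b - a) ?w)" using orientation(5)[OF x] unfolding A .
  then have t0: "0 \<le> t" using AQ by (simp add: zero_le_mult_iff)
  have xQ: "x - c = (Q s - c) + (1 - t) *\<^sub>R (- ?w)" unfolding xt by (simp add: algebra_simps)
  have "cross (d - c) (Q s - c) = 0" unfolding Q_def cross_def by (simp add: algebra_simps)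
  then have B: "\<sigma> * cross (d - c) (x - c) = (1 - t) * (\<sigma> * cross (d - c) (- ?w))"
    by (simp only: xQ cross_simps(2,6) add_0_left mult.left_commute)
  have "0 \<le> (1 - t) * (\<sigma> * cross (d - c) (- ?w))" using orientation(7)[OF x] unfolding B .
  then have t1: "t \<le> 1" using BP by (simp add: zero_le_mult_iff)
  let ?y = "vector [2 * s - 1, 2 * t - 1] :: real^2"
  have "F ?y = (1 - t) *\<^sub>R P s + t *\<^sub>R Q s"
    unfolding F_nested P_def Q_def by simp
  also have "\<dots> = x" unfolding xt by (simp add: algebra_simps)
  finally have "x = F ?y" ..
  moreover have "?y \<in> ref_square" using s t0 t1 by (simp add: ref_square_iff)
  ultimately show "x \<in> F ` ref_square" by (rule image_eqI)
qed

definition G :: "real^2 \<Rightarrow> real^2" where "G = inv_into ref_square F"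

lemma G_F: "x \<in> ref_square \<Longrightarrow> G (F x) = x"
  unfolding G_def by (rule inv_into_f_f[OF F_inj])

lemma F_G: "y \<in> E \<Longrightarrow> F (G y) = y"
  unfolding G_def by (rule f_inv_into_f) (simp add: F_image)

lemma G_mem: "y \<in> E \<Longrightarrow> G y \<in> ref_square"
  unfolding G_def by (rule inv_into_into) (simp add: F_image)

lemma push_forward_G: "push_forward a b c d \<phi> = (\<lambda>x. \<phi> (G x))"
  by (simp add: push_forward_def G_def fun_eq_iff)

lemma F_continuous: "continuous_on S F"
  unfolding bilinear_map_def[abs_def] by (intro continuous_intros)

lemma G_continuous: "continuous_on E G"
proof -
  have "compact ref_square" unfolding ref_square_cbox by (rule compact_cbox)
  then have "continuous_on (F ` ref_square) G"
    using G_F by (intro continuous_on_inv F_continuous) auto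
  then show ?thesis unfolding F_image .
qed

lemma F_has_derivative: "(F has_derivative (\<lambda>h. h$1 *\<^sub>R F1 x + h$2 *\<^sub>R F2 x)) (at x)"
proof -
  note D = vec_nth_has_derivative
  let ?D = "\<lambda>h::real^2. (1/4) *\<^sub>R ((((1 - x$1) * - h$2 + - h$1 * (1 - x$2)) *\<^sub>R a
    + ((1 + x$1) * - h$2 + h$1 * (1 - x$2)) *\<^sub>R b + ((1 + x$1) * h$2 + h$1 * (1 + x$2)) *\<^sub>R c
    + ((1 - x$1) * h$2 + - h$1 * (1 + x$2)) *\<^sub>R d))"
  have "(F has_derivative ?D) (at x)"
    unfolding bilinear_map_def[abs_def] by (rule derivative_eq_intros D refl | simp)+
  moreover have "?D = (\<lambda>h. h$1 *\<^sub>R F1 x + h$2 *\<^sub>R F2 x)"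
    unfolding F1_def F2_def by (simp add: vec_eq_iff fun_eq_iff field_simps)
  ultimately show ?thesis by simp
qed

text \<open>The inverse of the derivative of the bilinear map, by Cramer's rule.\<close>

definition DG :: "real^2 \<Rightarrow> real^2 \<Rightarrow> real^2" where
  "DG z v = vector [cross v (F2 z) / jac z, cross (F1 z) v / jac z]"

lemma G_has_derivative:
  assumes y: "y \<in> interior E"
  shows "(G has_derivative DG (G y)) (at y)"
proof (rule has_derivative_inverse_basic[OF F_has_derivative])
  have yE: "y \<in> E" using y interior_subset by blast
  have J: "jac (G y) \<noteq> 0" by (rule jac_nonzero[OF G_mem[OF yE]])
  show "bounded_linear (DG (G y))"
  proof (rule linear_conv_bounded_linear[THEN iffD1], rule linearI)
    show "DG z (v + w) = DG z v + DG z w" for z v w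
      by (simp add: DG_def vec_eq_iff forall_2 cross_simps add_divide_distrib)
    show "DG z (t *\<^sub>R v) = t *\<^sub>R DG z v" for z v t
      by (simp add: DG_def vec_eq_iff forall_2 cross_simps)
  qed
  show "DG (G y) \<circ> (\<lambda>h. h$1 *\<^sub>R F1 (G y) + h$2 *\<^sub>R F2 (G y)) = id"
    using J by (simp add: fun_eq_iff DG_def vec_eq_iff forall_2 cross_simps jac_def)
  show "continuous (at y) G"
    using G_continuous y by (simp add: continuous_on_interior)
  show "F (G z) = z" if "z \<in> interior E" for z
    using that interior_subset F_G by blast
qed (use y in auto)

text \<open>The inverse of the bilinear map is continuous on \<open>E\<close> by compactness and continuously
  differentiable inside, with derivative given by Cramer's rule.\<close>

lemma push_forward_regular:
  assumes \<phi>: "smooth \<phi>"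
  shows "continuous_on E (push_forward a b c d \<phi>)" "\<exists>g. weak_gradient E (push_forward a b c d \<phi>) g"
proof -
  show "continuous_on E (push_forward a b c d \<phi>)"
    unfolding push_forward_G
    by (rule continuous_on_compose2[OF smooth_continuous_on[OF \<phi>, of UNIV] G_continuous]) simp
  define D where "D x v = DG (G x) v $ 1 * partial 1 \<phi> (G x) + DG (G x) v $ 2 * partial 2 \<phi> (G x)" for x v
  have "(push_forward a b c d \<phi> has_derivative D x) (at x)" if "x \<in> interior E" for x
    unfolding push_forward_G D_def
    by (rule has_derivative_compose[OF G_has_derivative[OF that] has_derivative_partial[OF smooth_differentiable[OF \<phi>]]])
  moreover have "continuous_on (interior E) (\<lambda>x. D x (axis i 1))" for i
  proof -
    let ?M = "\<lambda>z. cross (axis i 1) (F2 z) / jac z * partial 1 \<phi> z + cross (F1 z) (axis i 1) / jac z * partial 2 \<phi> z"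
    have cF: "continuous_on ref_square F1" "continuous_on ref_square F2"
      unfolding F1_def[abs_def] F2_def[abs_def] by (intro continuous_intros)+
    have cj: "continuous_on ref_square jac"
      unfolding jac_def[abs_def] cross_def by (intro continuous_intros cF)
    have cc: "continuous_on ref_square (\<lambda>z. cross v (F2 z))" "continuous_on ref_square (\<lambda>z. cross (F1 z) v)" for v
      unfolding cross_def by (intro continuous_intros cF)+
    have "continuous_on ref_square ?M"
      using jac_nonzero
      by (intro continuous_on_add continuous_on_mult continuous_on_divide cc cj
          smooth_continuous_on smooth_partial \<phi> ballI)
    then have "continuous_on (interior E) (\<lambda>x. ?M (G x))"
      by (rule continuous_on_compose2[OF _ continuous_on_subset[OF G_continuous interior_subset]])
         (use G_mem interior_subset in blast)
    then show ?thesis by (simp add: D_def DG_def)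
  qed
  ultimately show "\<exists>g. weak_gradient E (push_forward a b c d \<phi>) g"
    using weak_gradient_classical[OF sets_lebesgue] by blast
qed

lemma F_sides:
  "F (vector [-1, u]) = seg a d u" "F (vector [1, u]) = seg b c u"
  "F (vector [u, -1]) = seg a b u" "F (vector [u, 1]) = seg d c u"
  by (simp_all add: bilinear_map_def seg_def vec_eq_iff field_simps)

lemma push_forward_sides:
  assumes "-1 \<le> u" "u \<le> 1"
  shows "push_forward a b c d \<phi> (seg a d u) = \<phi> (vector [-1, u])"
    "push_forward a b c d \<phi> (seg b c u) = \<phi> (vector [1, u])"
    "push_forward a b c d \<phi> (seg a b u) = \<phi> (vector [u, -1])"
    "push_forward a b c d \<phi> (seg d c u) = \<phi> (vector [u, 1])"
  unfolding push_forward_G F_sides[symmetric]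
  by (subst G_F; use assms in \<open>simp add: ref_square_iff\<close>)+

lemma closed_segment_seg:
  assumes "x \<in> closed_segment p q"
  obtains u where "-1 \<le> u" "u \<le> 1" "x = seg p q u"
proof -
  obtain t where t: "0 \<le> t" "t \<le> 1" "x = (1 - t) *\<^sub>R p + t *\<^sub>R q" using assms unfolding in_segment by blast
  have "x = seg p q (2 * t - 1)" unfolding t(3) seg_def by (simp add: algebra_simps)
  then show ?thesis using t(1,2) by (intro that[of "2 * t - 1"]) auto
qed

text \<open>Here \<open>\<alpha> = 0\<close> and \<open>\<beta> = 1\<close>: the required sign condition says that the intersection of the edge lines has
  coordinates of the same sign on both, which is the last part of \<open>meeting_point\<close>.\<close>

lemma opposite_trace_mapped:
  assumes "\<And>u. -1 \<le> u \<Longrightarrow> u \<le> 1 \<Longrightarrow> \<phi> (seg a d u) = - ((1 - u\<^sup>2) * u ^ (r - 1))"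
    and "\<And>u. -1 \<le> u \<Longrightarrow> u \<le> 1 \<Longrightarrow> \<phi> (seg b c u) = (1 - u\<^sup>2) * u ^ (r - 1)"
  shows "opposite_trace r \<phi>"
  unfolding opposite_trace_def
proof (rule exI[of _ 1], rule exI[of _ 1], rule exI[of _ 0], rule exI[of _ 1], rule exI[of _ 0], rule exI[of _ 1],
    intro conjI allI impI)
  assume "meeting \<noteq> 0"
  from meeting_point(4)[OF this]
  show "0 < (0 + 1 * meet1) * (0 + 1 * meet2)"
    by simp
qed (use assms in simp_all)

lemma mapped_supplement_function:
  "supplement_function r (push_forward a b c d (\<lambda>xh. (1 - (xh$2)\<^sup>2) * xh$1 * (xh$2) ^ (r - 1)))"
proof -
  let ?p = "\<lambda>xh :: real^2. (1 - (xh$2)\<^sup>2) * xh$1 * (xh$2) ^ (r - 1)"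
  have "smooth ?p"
    by (intro smooth_mult smooth_diff smooth_const smooth_power smooth_component)
  moreover have "opposite_trace r (push_forward a b c d ?p)"
    by (rule opposite_trace_mapped) (simp_all add: push_forward_sides algebra_simps)
  moreover have "push_forward a b c d ?p x = 0" if "x \<in> closed_segment a b \<union> closed_segment d c" for x
    using that by (auto elim!: closed_segment_seg simp: push_forward_sides)
  ultimately show ?thesis
    unfolding supplement_function_def using push_forward_regular by blast
qed

text \<open>Exchanging \<open>b\<close> and \<open>d\<close> exchanges the two pairs of opposite edges and the two reference coordinates.\<close>

lemma mapped_supplement_function':
  "quadrilateral.supplement_function E a d c b r
     (push_forward a b c d (\<lambda>xh. (1 - (xh$1)\<^sup>2) * xh$2 * (xh$1) ^ (r - 1)))"
proof -
  interpret swapped: quadrilateral E a d c b by (rule swap)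
  let ?p = "\<lambda>xh :: real^2. (1 - (xh$1)\<^sup>2) * xh$2 * (xh$1) ^ (r - 1)"
  have "smooth ?p"
    by (intro smooth_mult smooth_diff smooth_const smooth_power smooth_component)
  moreover have "swapped.opposite_trace r (push_forward a b c d ?p)"
    by (rule swapped.opposite_trace_mapped) (simp_all add: push_forward_sides algebra_simps)
  moreover have "push_forward a b c d ?p x = 0" if "x \<in> closed_segment a d \<union> closed_segment b c" for x
    using that by (auto elim!: closed_segment_seg simp: push_forward_sides)
  ultimately show ?thesis
    unfolding swapped.supplement_function_def using push_forward_regular by blast
qed

section \<open>The direct serendipity spaces\<close>

lemma supplement_exists:
  assumes "DS_supplement E a b c d r S"
  obtains \<phi>1 \<phi>2 where "S = span2 E \<phi>1 \<phi>2" "supplement_function r \<phi>1"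
    "quadrilateral.supplement_function E a d c b r \<phi>2"
proof -
  interpret swapped: quadrilateral E a d c b by (rule swap)
  consider "fully_direct_supplement E a b c d r S" | "S = mapped_supplement E a b c d r"
    using assms unfolding DS_supplement_def by blast
  then show ?thesis
  proof cases
    case 1
    then obtain l1 l2 l3 l4 lH lV RV RH where
      e: "edge_function E (closed_segment a d) l1" "edge_function E (closed_segment b c) l2"
        "edge_function E (closed_segment a b) l3" "edge_function E (closed_segment d c) l4"
      and H: "admissible_linear (closed_segment a d) (closed_segment b c) l1 l2 lH"
      and V: "admissible_linear (closed_segment a b) (closed_segment d c) l3 l4 lV"
      and RV: "admissible_R E (closed_segment a d) (closed_segment b c) RV"
      and RH: "admissible_R E (closed_segment a b) (closed_segment d c) RH"
      and S: "S = span2 E (\<lambda>x. l3 x * l4 x * lH x ^ (r - 1) * RV x) (\<lambda>x. l1 x * l2 x * lV x ^ (r - 1) * RH x)"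
      unfolding fully_direct_supplement_def Let_def by (elim exE conjE)
    show ?thesis
      by (rule that[OF S direct_supplement_function[OF e H RV]
            swapped.direct_supplement_function[OF e(3,4,1,2) V RH]])
  next
    case 2
    then show ?thesis
      unfolding mapped_supplement_def
      by (rule that[OF _ mapped_supplement_function mapped_supplement_function'])
  qed
qed

lemma peval_const: "peval k (\<lambda>i j. if i = 0 \<and> j = 0 then t else 0) x = t"
proof -
  have "finite {(i, j). i + j \<le> k}"
    by (rule finite_subset[of _ "{..k} \<times> {..k}"]) auto
  then have "peval k (\<lambda>i j. if i = 0 \<and> j = 0 then t else 0) x
    = (\<Sum>(i, j)\<in>{(0, 0)}. (if i = 0 \<and> j = 0 then t else 0) * (x$1) ^ i * (x$2) ^ j)"
    unfolding peval_def by (intro sum.mono_neutral_right) (auto split: if_splits)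
  then show ?thesis by simp
qed

text \<open>Restricting to one pair of opposite edges at a time isolates one of the two spanning functions, so
  each coefficient of a polynomial element of the supplement vanishes.\<close>

lemma DS_properties:
  assumes r: "r \<ge> 1" and S: "DS_supplement E a b c d r S"
  shows "is_direct E (poly_space E (r + 1)) S"
    and "range (const_class E) \<subseteq> DS E r S"
    and "u \<in> DS E r S \<Longrightarrow> \<exists>f g. u = ae_class E f \<and> continuous_on E f \<and> weak_gradient E f g"
proof -
  interpret swapped: quadrilateral E a d c b by (rule swap)
  obtain \<phi>1 \<phi>2 where S_eq: "S = span2 E \<phi>1 \<phi>2" and \<phi>1: "supplement_function r \<phi>1"
    and \<phi>2: "swapped.supplement_function r \<phi>2"
    by (rule supplement_exists[OF S])
  have tr: "opposite_trace r \<phi>1" "swapped.opposite_trace r \<phi>2"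
    and c: "continuous_on E \<phi>1" "continuous_on E \<phi>2"
    and z1: "\<forall>x\<in>closed_segment a b \<union> closed_segment d c. \<phi>1 x = 0"
    and z2: "\<forall>x\<in>closed_segment a d \<union> closed_segment b c. \<phi>2 x = 0"
    and w: "\<exists>g. weak_gradient E \<phi>1 g" "\<exists>g. weak_gradient E \<phi>2 g"
    using \<phi>1 \<phi>2 unfolding supplement_function_def swapped.supplement_function_def by blast+
  have P: "p \<in> poly_space E k \<longleftrightarrow> (\<exists>q. p = ae_class E (peval k q))" for p k
    by (auto simp: poly_space_def poly_fun_eq)
  have Sm: "v \<in> S \<longleftrightarrow> (\<exists>s t. v = ae_class E (\<lambda>x. s * \<phi>1 x + t * \<phi>2 x))" for v
    by (auto simp: S_eq span2_def)
  have peval0: "peval k (\<lambda>i j. if i = 0 \<and> j = 0 then t else 0) = (\<lambda>_. t)" for k t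
    by (rule ext) (rule peval_const)
  have zP: "zero_class E \<in> poly_space E k" for k
    unfolding P zero_class_def by (rule exI[of _ "\<lambda>i j. if i = 0 \<and> j = 0 then 0 else 0"]) (simp only: peval0)
  have zS: "zero_class E \<in> S"
    unfolding Sm zero_class_def by (rule exI[of _ 0], rule exI[of _ 0]) simp
  have sub: "closed_segment p q \<subseteq> E" if "p \<in> E" "q \<in> E" for p q
    using that convex by (simp add: closed_segment_subset)
  show "is_direct E (poly_space E (r + 1)) S"
    unfolding is_direct_def
  proof (intro equalityI subsetI)
    fix v assume v: "v \<in> poly_space E (r + 1) \<inter> S"
    then obtain q where q: "v = ae_class E (peval (r + 1) q)" using P by blast
    obtain s t where st: "v = ae_class E (\<lambda>x. s * \<phi>1 x + t * \<phi>2 x)" using v Sm by blast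
    have eq: "peval (r + 1) q x = s * \<phi>1 x + t * \<phi>2 x" if "x \<in> E" for x
    proof (rule AE_continuous_eq[OF smooth_continuous_on[OF smooth_peval] _ _ that])
      show "continuous_on E (\<lambda>x. s * \<phi>1 x + t * \<phi>2 x)"
        by (intro continuous_on_add continuous_on_mult continuous_on_const c)
      show "AE x in lebesgue_on E. peval (r + 1) q x = s * \<phi>1 x + t * \<phi>2 x"
        using q st unfolding ae_class_eq_iff[symmetric] by (rule subst)
    qed
    have "s = 0"
    proof (rule opposite_trace_independent[OF r tr(1)])
      fix x assume x: "x \<in> closed_segment a d \<union> closed_segment b c"
      then have "x \<in> E" using sub vertices by blast
      then show "peval (r + 1) q x = s * \<phi>1 x" using eq z2 x by simp
    qed
    moreover have "t = 0"
    proof (rule swapped.opposite_trace_independent[OF r tr(2)])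
      fix x assume x: "x \<in> closed_segment a b \<union> closed_segment d c"
      then have "x \<in> E" using sub vertices by blast
      then show "peval (r + 1) q x = t * \<phi>2 x" using eq z1 x by simp
    qed
    ultimately show "v \<in> {zero_class E}" by (simp add: st zero_class_def)
  qed (use zP zS in auto)
  have DS_I: "class_add p v \<in> DS E r S" if "p \<in> poly_space E (r + 1)" "v \<in> S" for p v
    unfolding DS_def space_sum_def using that by blast
  show "range (const_class E) \<subseteq> DS E r S"
  proof
    fix u assume "u \<in> range (const_class E)"
    then obtain t where u: "u = ae_class E (\<lambda>_. t)" unfolding const_class_def by (rule rangeE)
    have "ae_class E (\<lambda>_. t) \<in> poly_space E (r + 1)"
      unfolding P by (rule exI[of _ "\<lambda>i j. if i = 0 \<and> j = 0 then t else 0"]) (simp only: peval0)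
    from DS_I[OF this zS] show "u \<in> DS E r S"
      by (simp add: u zero_class_def class_add_ae_class)
  qed
  assume "u \<in> DS E r S"
  then obtain p v where pv: "p \<in> poly_space E (r + 1)" "v \<in> S" "u = class_add p v"
    unfolding DS_def space_sum_def by auto
  from pv(1) obtain q where q: "p = ae_class E (peval (r + 1) q)" unfolding P by (rule exE)
  from pv(2) obtain s t where st: "v = ae_class E (\<lambda>x. s * \<phi>1 x + t * \<phi>2 x)" unfolding Sm by (elim exE)
  from w obtain g1 g2 where g: "weak_gradient E \<phi>1 g1" "weak_gradient E \<phi>2 g2" by (elim exE)
  let ?f = "\<lambda>x. peval (r + 1) q x + (s * \<phi>1 x + t * \<phi>2 x)"
  have "u = ae_class E ?f" unfolding pv(3) q st by (rule class_add_ae_class)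
  moreover have "continuous_on E ?f"
    by (intro continuous_on_add continuous_on_mult continuous_on_const c smooth_continuous_on smooth_peval)
  moreover have "\<exists>h. weak_gradient E ?f h"
    by (rule exI, rule weak_gradient_add[OF sets_lebesgue weak_gradient_smooth[OF sets_lebesgue smooth_peval]
        weak_gradient_add[OF sets_lebesgue weak_gradient_mult_smooth[OF sets_lebesgue g(1) smooth_const]
          weak_gradient_mult_smooth[OF sets_lebesgue g(2) smooth_const]]])
  ultimately show "\<exists>f g. u = ae_class E f \<and> continuous_on E f \<and> weak_gradient E f g"
    by (elim exE) (intro exI conjI)
qed

end

theorem mainTheorem5:
  fixes E :: "(real^2) set" and a b c d :: "real^2" and r :: nat
    and S :: "(real^2 \<Rightarrow> real) set set"
  assumes "convex_quadrilateral E a b c d" and "r \<ge> 1"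
    and "DS_supplement E a b c d r S"
  shows "is_direct E (poly_space E (r + 1)) S
    \<and> is_direct E (grad E ` DS E r S) (rot_poly_space E r)
    \<and> is_direct E (grad E ` DS E r S) (rot_poly_space E (r - 1))
    \<and> well_defined_sequence E (DS E r S) (V_full E r S) (poly_space E r)
    \<and> exact_sequence E (DS E r S) (V_full E r S) (poly_space E r)
    \<and> well_defined_sequence E (DS E r S) (V_red E r S) (poly_space E (r - 1))
    \<and> exact_sequence E (DS E r S) (V_red E r S) (poly_space E (r - 1))"
proof -
  interpret quadrilateral E a b c d by unfold_locales (rule assms(1))
  note DS = DS_properties[OF assms(2,3)]
  note full = exact_of_regular_representatives[OF DS(3) DS(2), where k = r, folded V_full_def]
  note red = exact_of_regular_representatives[OF DS(3) DS(2), where k = "r - 1", folded V_red_def]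
  show ?thesis
    by (intro conjI DS(1) full red)
qed

end
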